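(* Suppose the pair of functions $(u(x,t), s(t))$ is a classical solution of Problem $P$ with data $\lambda,\sigma,b,f,\varphi$ (i.e. it satisfies (i), (ii), (iii) of the context). If $f \in C^m((0,T])$, where $m \in \mathbb{N}$, $m \geq 2$ and $T>0$ is a constant, then $s \in C^{m+1}((0,T])$. In particular, if $f \in C^\infty((0,\infty))$, then $s \in C^\infty((0,\infty))$.
   Context: Problem $P$. Let $\lambda>0$, $\sigma>0$, $b>0$ be constants, and let $f:[0,\infty)\to\mathbb{R}$ and $\varphi:[0,b]\to\mathbb{R}$ be given functions with $\varphi(0)=f(0)$. Find $s(t)>0$ and $u(x,t)$ such that (P1) $u_t = u_{xx}-\lambda u$ for $0<x<s(t)$, $t>0$; (P2) $u(0,t)=f(t)$ for $t\ge 0$; (P3) $u(x,0)=\varphi(x)$ for $x\in[0,b]$, and $s(0)=b$; (P4) $u_x(s(t),t)=0$ for $t>0$; (P5) $s'(t)=\int_0^{s(t)}(u(x,t)-\sigma)\,dx$ for $t>0$. A classical solution of Problem $P$ is a pair $(u,s)$ such that: (i) $u(x,t)$ is defined, continuous and has continuous partial derivatives $u_x,u_t,u_{xx}$ in the domain $\{(x,t): 0\le x\le s(t),\ t\ge 0\}$ (one-sided derivatives at the boundary); (ii) $s\in C^1([0,\infty))$ and $s(t)>0$ for $t\ge 0$; (iii) conditions (P1)–(P5) hold. $C^m((0,T])$ denotes the functions having continuous derivatives up to order $m$ on $(0,T]$ (one-sided at $T$). *)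

theory Defs
  imports "HOL-Analysis.Analysis"
begin

(* C^m on an interval S: D k is the k-th derivative. Derivatives are taken within S, hence
   one-sided at an endpoint of S that belongs to S. Meant for nondegenerate intervals, where
   derivatives within S are unique. *)
definition C_on :: "nat \<Rightarrow> real set \<Rightarrow> (real \<Rightarrow> real) \<Rightarrow> bool" where
  "C_on m S g \<longleftrightarrow>
     (\<exists>D :: nat \<Rightarrow> real \<Rightarrow> real.
        (\<forall>x\<in>S. D 0 x = g x) \<and>
        (\<forall>k<m. \<forall>x\<in>S. (D k has_real_derivative D (Suc k) x) (at x within S)) \<and>
        (\<forall>k\<le>m. continuous_on S (D k)))"

definition C_inf_on :: "real set \<Rightarrow> (real \<Rightarrow> real) \<Rightarrow> bool" where
  "C_inf_on S g \<longleftrightarrow> (\<forall>m. C_on m S g)"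

definition closed_domain :: "(real \<Rightarrow> real) \<Rightarrow> (real \<times> real) set" where
  "closed_domain s = {(x, t). 0 \<le> x \<and> x \<le> s t \<and> 0 \<le> t}"

(* ux, ut, uxx are the partial derivatives of u on the closed domain, all continuous there.
   Each difference quotient only uses points of the domain, so derivatives are one-sided at the
   boundary. The vertical slice {r. 0 \<le> r \<and> x \<le> s r} may be isolated at t when x = s t (for
   instance at a strict local maximum of s); the condition on ut x t is then void, but
   continuity of ut on the closed domain still determines its value. *)
definition has_partials ::
  "(real \<Rightarrow> real) \<Rightarrow> (real \<Rightarrow> real \<Rightarrow> real) \<Rightarrow> (real \<Rightarrow> real \<Rightarrow> real) \<Rightarrow>
   (real \<Rightarrow> real \<Rightarrow> real) \<Rightarrow> (real \<Rightarrow> real \<Rightarrow> real) \<Rightarrow> bool" where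
  "has_partials s u ux ut uxx \<longleftrightarrow>
     continuous_on (closed_domain s) (\<lambda>(x, t). u x t) \<and>
     continuous_on (closed_domain s) (\<lambda>(x, t). ux x t) \<and>
     continuous_on (closed_domain s) (\<lambda>(x, t). ut x t) \<and>
     continuous_on (closed_domain s) (\<lambda>(x, t). uxx x t) \<and>
     (\<forall>(x, t)\<in>closed_domain s.
        ((\<lambda>y. u y t) has_real_derivative ux x t) (at x within {0..s t}) \<and>
        ((\<lambda>y. ux y t) has_real_derivative uxx x t) (at x within {0..s t}) \<and>
        ((\<lambda>r. u x r) has_real_derivative ut x t) (at t within {r. 0 \<le> r \<and> x \<le> s r}))"

definition classical_solution ::
  "real \<Rightarrow> real \<Rightarrow> real \<Rightarrow> (real \<Rightarrow> real) \<Rightarrow> (real \<Rightarrow> real) \<Rightarrow>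
   (real \<Rightarrow> real \<Rightarrow> real) \<Rightarrow> (real \<Rightarrow> real) \<Rightarrow> bool" where
  "classical_solution lam \<sigma> b f \<phi> u s \<longleftrightarrow>
     C_on 1 {0..} s \<and> (\<forall>t\<ge>0. s t > 0) \<and>
     (\<exists>ux ut uxx. has_partials s u ux ut uxx \<and>
        (\<forall>t>0. \<forall>x. 0 < x \<and> x < s t \<longrightarrow> ut x t = uxx x t - lam * u x t) \<and>
        (\<forall>t\<ge>0. u 0 t = f t) \<and>
        (\<forall>x\<in>{0..b}. u x 0 = \<phi> x) \<and> s 0 = b \<and>
        (\<forall>t>0. ux (s t) t = 0) \<and>
        (\<forall>t>0. (s has_real_derivative integral {0..s t} (\<lambda>x. u x t - \<sigma>)) (at t)))"

end

theory Submission
  imports Defs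
begin

text \<open>
  Put \<open>w = exp (lam t) u\<close>. Then \<open>w\<^sub>t = w\<^sub>x\<^sub>x\<close> below the curve \<open>x = s t\<close>, with \<open>w\<^sub>x = 0\<close> on the curve and
  \<open>w = exp (lam t) f\<close> on \<open>x = 0\<close>. The equation for \<open>s\<close> reads \<open>s' = exp (- lam t) mass - \<sigma> s\<close>, where
  \<open>mass t\<close> is the integral of \<open>w\<close> over \<open>[0, s t]\<close>. Write \<open>trace t = w (s t) t\<close>. Two representation
  formulas, both obtained from Green's identity on the time interval \<open>[a, t]\<close> with a Gaussian test
  function, turn the theorem into a bootstrap in one variable.

  The mass. The test function \<open>Q(x, t - \<tau>)\<close> with \<open>Q = erf (x / (2 sqrt (t - \<tau>)))\<close> vanishes at \<open>x = 0\<close>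
  and tends to 1 inside the domain as \<open>\<tau>\<close> tends to \<open>t\<close>. So the unknown flux \<open>w\<^sub>x(0, t)\<close> does not enter, and \<open>mass\<close> is a sum
  of the integral of \<open>trace s'\<close>, the Abel integral of \<open>w(0, .)\<close>, a term from the values of \<open>w\<close> at time \<open>a\<close> that is
  smooth for \<open>t > a\<close>, and an integral with a kernel that is flat (all its derivatives vanish) at \<open>\<tau> = t\<close>, because \<open>s > 0\<close>.
  If \<open>trace\<close> and \<open>s'\<close> are of class \<open>C\<^sup>k\<close> and \<open>f\<close> is of class \<open>C\<^bsup>k+1\<^esup>\<close>, then \<open>mass\<close> is of class \<open>C\<^bsup>k+1\<^esup>\<close> (\<open>mass_formula\<close>, \<open>mass_regular\<close>).

  The trace. The heat kernel with pole at the moving point \<open>(s t, t)\<close> gives a Volterra equation of the second kind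
  \<open>trace = V trace + F\<close> on \<open>[a, T]\<close>, where \<open>V\<close> has a kernel of order \<open>(t - \<tau>) powr (-1/2)\<close> that is built from \<open>s'\<close>.
  Such an equation passes on the regularity of its kernel and of \<open>F\<close>: \<open>s'\<close> of class \<open>C\<^sup>k\<close> gives \<open>trace\<close> of class
  \<open>C\<^sup>k\<close> (\<open>trace_formula\<close>, \<open>volterra_regularity\<close>, \<open>trace_regular\<close>).

  Together: if \<open>s'\<close> is of class \<open>C\<^sup>k\<close> and \<open>k < m\<close>, then so is \<open>trace\<close>, hence \<open>mass\<close> and \<open>s'\<close> are of class \<open>C\<^bsup>k+1\<^esup>\<close>.
  Starting from \<open>s\<close> of class \<open>C\<^sup>1\<close> one arrives at \<open>s'\<close> of class \<open>C\<^sup>m\<close>.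

  One difficulty shapes the text. The values of \<open>w\<close> at time \<open>a\<close> produce a term in \<open>F\<close> whose derivatives blow up
  at \<open>a\<close>. All regularity in the Volterra equation is therefore measured with the scaling field \<open>(t - a) d/dt\<close>
  in place of \<open>d/dt\<close>: the initial term is smooth along this field, up to \<open>t = a\<close> (\<open>initial_layer\<close>), the substitution
  \<open>\<tau> = a + (t - a) (1 - y\<^sup>2)\<close> commutes with the field and removes the singularity of the kernel, and away from \<open>a\<close> both
  notions of regularity agree.
\<close>

section \<open>Differentiability along a vector field on the time axis\<close>

text \<open>
  Functions of time \<open>t\<close> and a parameter \<open>y\<close> that can be differentiated \<open>n\<close> times along \<open>\<omega>(t) d/dt\<close>, with
  all these derivatives jointly continuous. The choice \<open>\<omega> = 1\<close> is \<open>C\<^sup>n\<close> with a parameter, and \<open>\<omega> t = t - a\<close> is the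
  scaling field at \<open>a\<close>. At a zero of \<open>\<omega>\<close> no difference quotient is asked for, but the derivative must have
  the value 0 there: this is what a rescaling of time needs when it collapses to the point \<open>a\<close>.
\<close>

primrec cdiff :: "nat \<Rightarrow> (real \<Rightarrow> real) \<Rightarrow> real set \<Rightarrow> 'y::topological_space set \<Rightarrow> (real \<Rightarrow> 'y \<Rightarrow> real) \<Rightarrow> bool" where
  "cdiff 0 \<omega> U Y B \<longleftrightarrow> continuous_on (U \<times> Y) (\<lambda>p. B (fst p) (snd p))"
| "cdiff (Suc n) \<omega> U Y B \<longleftrightarrow> continuous_on (U \<times> Y) (\<lambda>p. B (fst p) (snd p)) \<and>
     (\<exists>B'. (\<forall>t\<in>U. \<forall>y\<in>Y.
         (\<omega> t \<noteq> 0 \<longrightarrow> ((\<lambda>t. B t y) has_real_derivative B' t y / \<omega> t) (at t within U)) \<and>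
         (\<omega> t = 0 \<longrightarrow> B' t y = 0)) \<and> cdiff n \<omega> U Y B')"

abbreviation deriv_along :: "(real \<Rightarrow> real) \<Rightarrow> real set \<Rightarrow> 'y set \<Rightarrow> (real \<Rightarrow> 'y \<Rightarrow> real) \<Rightarrow> (real \<Rightarrow> 'y \<Rightarrow> real) \<Rightarrow> bool" where
  "deriv_along \<omega> U Y B B' \<equiv> (\<forall>t\<in>U. \<forall>y\<in>Y.
         (\<omega> t \<noteq> 0 \<longrightarrow> ((\<lambda>t. B t y) has_real_derivative B' t y / \<omega> t) (at t within U)) \<and>
         (\<omega> t = 0 \<longrightarrow> B' t y = 0))"

lemma cdiff_cont: "cdiff n \<omega> U Y B \<Longrightarrow> continuous_on (U \<times> Y) (\<lambda>p. B (fst p) (snd p))"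
  by (cases n) auto

lemma cdiff_SucI:
  assumes "deriv_along \<omega> U Y B B'" "continuous_on (U \<times> Y) (\<lambda>p. B (fst p) (snd p))" "cdiff n \<omega> U Y B'"
  shows "cdiff (Suc n) \<omega> U Y B"
  using assms by auto

lemma cdiff_SucE:
  assumes "cdiff (Suc n) \<omega> U Y B"
  obtains B' where "deriv_along \<omega> U Y B B'" "continuous_on (U \<times> Y) (\<lambda>p. B (fst p) (snd p))" "cdiff n \<omega> U Y B'"
  using assms by auto

lemma cdiff_Suc_imp: "cdiff (Suc n) \<omega> U Y B \<Longrightarrow> cdiff n \<omega> U Y B"
proof (induction n arbitrary: B)
  case (Suc n)
  from Suc.prems obtain B' where "deriv_along \<omega> U Y B B'" "continuous_on (U \<times> Y) (\<lambda>p. B (fst p) (snd p))" "cdiff (Suc n) \<omega> U Y B'"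
    by (rule cdiff_SucE)
  with Suc.IH show ?case by (intro cdiff_SucI)
qed auto

lemma cdiff_mono: "cdiff n \<omega> U Y B \<Longrightarrow> m \<le> n \<Longrightarrow> cdiff m \<omega> U Y B"
proof (induction n arbitrary: m)
  case (Suc n)
  then show ?case using cdiff_Suc_imp le_Suc_eq by metis
qed auto

lemma cdiff_cong:
  assumes "cdiff n \<omega> U Y B" "\<And>t y. t \<in> U \<Longrightarrow> y \<in> Y \<Longrightarrow> B t y = C t y"
  shows "cdiff n \<omega> U Y C"
proof (cases n)
  case 0
  with assms show ?thesis by (auto elim!: continuous_on_eq)
next
  case (Suc k)
  with assms obtain B' where B': "deriv_along \<omega> U Y B B'" "continuous_on (U \<times> Y) (\<lambda>p. B (fst p) (snd p))" "cdiff k \<omega> U Y B'"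
    by (auto elim: cdiff_SucE)
  have "((\<lambda>t. C t y) has_real_derivative D) (at t within U)"
    if "t \<in> U" "y \<in> Y" "((\<lambda>t. B t y) has_real_derivative D) (at t within U)" for t y D
    by (rule has_field_derivative_transform_within[OF that(3), of 1]) (use that assms(2) in auto)
  with B' have "deriv_along \<omega> U Y C B'" by blast
  moreover have "continuous_on (U \<times> Y) (\<lambda>p. C (fst p) (snd p))"
    using B'(2) assms(2) by (auto elim!: continuous_on_eq)
  ultimately show ?thesis using B'(3) Suc by (auto intro: cdiff_SucI)
qed

lemma cdiff_subset:
  assumes "cdiff n \<omega> U Y B" "V \<subseteq> U" "Z \<subseteq> Y"
  shows "cdiff n \<omega> V Z B"
  using assms(1)
proof (induction n arbitrary: B)
  case 0
  with assms show ?case by (auto elim!: continuous_on_subset)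
next
  case (Suc n)
  from Suc.prems obtain B' where B': "deriv_along \<omega> U Y B B'" "continuous_on (U \<times> Y) (\<lambda>p. B (fst p) (snd p))" "cdiff n \<omega> U Y B'"
    by (rule cdiff_SucE)
  have "deriv_along \<omega> V Z B B'"
    using B'(1) assms by (meson DERIV_subset subsetD)
  moreover have "continuous_on (V \<times> Z) (\<lambda>p. B (fst p) (snd p))"
    using B'(2) by (rule continuous_on_subset) (use assms in auto)
  ultimately show ?case using Suc.IH[OF B'(3)] by (intro cdiff_SucI)
qed

lemma cdiff_const_t:
  assumes "continuous_on Y c"
  shows "cdiff n \<omega> U Y (\<lambda>t y. c y)"
proof -
  have c: "continuous_on (U \<times> Y) (\<lambda>p. c (snd p))" if "continuous_on Y c" for c :: "'a \<Rightarrow> real"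
    by (intro continuous_on_compose2[OF that] continuous_intros) auto
  show ?thesis using assms
  proof (induction n arbitrary: c)
    case (Suc n)
    have "cdiff n \<omega> U Y (\<lambda>t y. 0)" by (rule Suc.IH) auto
    then show ?case by (intro cdiff_SucI[where B'="\<lambda>t y. 0"]) (auto intro: c Suc.prems)
  qed (simp add: c)
qed

lemma cdiff_const: "cdiff n \<omega> U Y (\<lambda>t y. c)"
  by (rule cdiff_const_t) auto

lemma cdiff_add:
  assumes "cdiff n \<omega> U Y B" "cdiff n \<omega> U Y C"
  shows "cdiff n \<omega> U Y (\<lambda>t y. B t y + C t y)"
  using assms
proof (induction n arbitrary: B C)
  case 0
  then show ?case by (auto intro: continuous_intros)
next
  case (Suc n)
  from Suc.prems(1) obtain B' where B': "deriv_along \<omega> U Y B B'" "continuous_on (U \<times> Y) (\<lambda>p. B (fst p) (snd p))" "cdiff n \<omega> U Y B'"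
    by (rule cdiff_SucE)
  from Suc.prems(2) obtain C' where C': "deriv_along \<omega> U Y C C'" "continuous_on (U \<times> Y) (\<lambda>p. C (fst p) (snd p))" "cdiff n \<omega> U Y C'"
    by (rule cdiff_SucE)
  have "deriv_along \<omega> U Y (\<lambda>t y. B t y + C t y) (\<lambda>t y. B' t y + C' t y)"
  proof (intro ballI conjI impI)
    fix t y assume "t \<in> U" "y \<in> Y" "\<omega> t \<noteq> 0"
    then show "((\<lambda>t. B t y + C t y) has_real_derivative (B' t y + C' t y) / \<omega> t) (at t within U)"
      using DERIV_add[of "\<lambda>t. B t y" "B' t y / \<omega> t" t U "\<lambda>t. C t y" "C' t y / \<omega> t"] B'(1) C'(1)
      by (simp add: add_divide_distrib)
  qed (use B' C' in auto)
  moreover have "cdiff n \<omega> U Y (\<lambda>t y. B' t y + C' t y)"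
    by (intro Suc.IH B' C')
  ultimately show ?case using B' C' by (intro cdiff_SucI continuous_intros)
qed

lemma deriv_along_mult:
  assumes B': "deriv_along \<omega> U Y B B'" and C': "deriv_along \<omega> U Y C C'"
  shows "deriv_along \<omega> U Y (\<lambda>t y. B t y * C t y) (\<lambda>t y. B' t y * C t y + B t y * C' t y)"
proof (intro ballI conjI impI)
  fix t y assume *: "t \<in> U" "y \<in> Y" "\<omega> t \<noteq> 0"
  have "((\<lambda>t. B t y * C t y) has_real_derivative (B' t y / \<omega> t) * C t y + (C' t y / \<omega> t) * B t y) (at t within U)"
    using B' C' * by (intro DERIV_mult) auto
  also have "(B' t y / \<omega> t) * C t y + (C' t y / \<omega> t) * B t y = (B' t y * C t y + B t y * C' t y) / \<omega> t"
    using * by (simp add: field_simps)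
  finally show "((\<lambda>t. B t y * C t y) has_real_derivative \<dots>) (at t within U)" .
qed (use B' C' in auto)

lemma cdiff_mult:
  assumes "cdiff n \<omega> U Y B" "cdiff n \<omega> U Y C"
  shows "cdiff n \<omega> U Y (\<lambda>t y. B t y * C t y)"
  using assms
proof (induction n arbitrary: B C)
  case 0
  then show ?case by (auto intro: continuous_intros)
next
  case (Suc n)
  from Suc.prems(1) obtain B' where B': "deriv_along \<omega> U Y B B'" "continuous_on (U \<times> Y) (\<lambda>p. B (fst p) (snd p))" "cdiff n \<omega> U Y B'"
    by (rule cdiff_SucE)
  from Suc.prems(2) obtain C' where C': "deriv_along \<omega> U Y C C'" "continuous_on (U \<times> Y) (\<lambda>p. C (fst p) (snd p))" "cdiff n \<omega> U Y C'"
    by (rule cdiff_SucE)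
  note deriv_along_mult[OF B'(1) C'(1)]
  moreover have "cdiff n \<omega> U Y (\<lambda>t y. B' t y * C t y + B t y * C' t y)"
    by (intro cdiff_add Suc.IH B' C' Suc.prems[THEN cdiff_Suc_imp])
  ultimately show ?case using B' C' by (intro cdiff_SucI continuous_intros)
qed

lemma cdiff_cmult: "cdiff n \<omega> U Y B \<Longrightarrow> cdiff n \<omega> U Y (\<lambda>t y. c * B t y)"
  by (rule cdiff_mult[OF cdiff_const])

lemma cdiff_minus: "cdiff n \<omega> U Y B \<Longrightarrow> cdiff n \<omega> U Y (\<lambda>t y. - B t y)"
  using cdiff_cmult[of n \<omega> U Y B "-1"] by simp

lemma cdiff_diff:
  "cdiff n \<omega> U Y B \<Longrightarrow> cdiff n \<omega> U Y C \<Longrightarrow> cdiff n \<omega> U Y (\<lambda>t y. B t y - C t y)"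
  using cdiff_add[OF _ cdiff_minus, of n \<omega> U Y B C] by simp

lemma cdiff_power: "cdiff n \<omega> U Y B \<Longrightarrow> cdiff n \<omega> U Y (\<lambda>t y. B t y ^ k)"
  by (induction k) (auto intro: cdiff_const cdiff_mult)

lemma cdiff_exp:
  assumes "cdiff n \<omega> U Y B"
  shows "cdiff n \<omega> U Y (\<lambda>t y. exp (B t y))"
  using assms
proof (induction n arbitrary: B)
  case 0
  then show ?case by (auto intro: continuous_intros)
next
  case (Suc n)
  from Suc.prems obtain B' where B': "deriv_along \<omega> U Y B B'" "continuous_on (U \<times> Y) (\<lambda>p. B (fst p) (snd p))" "cdiff n \<omega> U Y B'"
    by (rule cdiff_SucE)
  have "deriv_along \<omega> U Y (\<lambda>t y. exp (B t y)) (\<lambda>t y. exp (B t y) * B' t y)"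
    using B'(1) by (auto intro!: derivative_eq_intros)
  moreover have "cdiff n \<omega> U Y (\<lambda>t y. exp (B t y) * B' t y)"
    by (intro cdiff_mult B' Suc.IH cdiff_Suc_imp[OF Suc.prems])
  ultimately show ?case using B' by (intro cdiff_SucI continuous_intros) auto
qed

lemma cdiff_param:
  assumes "cdiff n \<omega> U Y B" "continuous_on Z \<beta>" "\<beta> ` Z \<subseteq> Y"
  shows "cdiff n \<omega> U Z (\<lambda>t z. B t (\<beta> z))"
proof -
  have cont: "continuous_on (U \<times> Z) (\<lambda>p. B (fst p) (\<beta> (snd p)))"
    if "continuous_on (U \<times> Y) (\<lambda>p. B (fst p) (snd p))" for B :: "real \<Rightarrow> 'a \<Rightarrow> real"
    using assms(3)
    by (intro continuous_on_compose2[OF that, of _ "\<lambda>p. (fst p, \<beta> (snd p))", simplified]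
        continuous_intros continuous_on_compose2[OF assms(2), of _ snd]) auto
  show ?thesis using assms(1)
  proof (induction n arbitrary: B)
    case 0
    then show ?case using cont by auto
  next
    case (Suc n)
    from Suc.prems obtain B' where B': "deriv_along \<omega> U Y B B'" "continuous_on (U \<times> Y) (\<lambda>p. B (fst p) (snd p))" "cdiff n \<omega> U Y B'"
      by (rule cdiff_SucE)
    have "deriv_along \<omega> U Z (\<lambda>t z. B t (\<beta> z)) (\<lambda>t z. B' t (\<beta> z))"
      using B'(1) assms(3) by blast
    then show ?case using Suc.IH[OF B'(3)] cont[OF B'(2)] by (intro cdiff_SucI)
  qed
qed

lemma continuous_on_integral_param:
  fixes B :: "real \<Rightarrow> 'y::topological_space \<times> real \<Rightarrow> real"
  assumes "continuous_on (U \<times> (Y \<times> {a..b})) (\<lambda>p. B (fst p) (snd p))"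
  shows "continuous_on (U \<times> Y) (\<lambda>p. integral {a..b} (\<lambda>z. B (fst p) (snd p, z)))"
proof -
  have "continuous_on ((U \<times> Y) \<times> cbox a b) (\<lambda>(p, z). B (fst p) (snd p, z))"
    unfolding split_beta
    by (rule continuous_on_compose2[OF assms, of _ "\<lambda>q. (fst (fst q), (snd (fst q), snd q))", simplified])
      (auto intro!: continuous_intros)
  from integral_continuous_on_param[OF this] show ?thesis by simp
qed

text \<open>
  Differentiation under the integral sign, for any field: the Leibniz rule needs a derivative on a whole convex set of times,
  so it is applied near a time with \<open>\<omega> t \<noteq> 0\<close>, where \<open>\<omega>\<close> has no zero.
\<close>

lemma deriv_along_integral:
  fixes B :: "real \<Rightarrow> 'y::topological_space \<times> real \<Rightarrow> real"
  assumes B': "deriv_along \<omega> U (Y \<times> {a..b}) B B'"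
    and cB: "continuous_on (U \<times> (Y \<times> {a..b})) (\<lambda>p. B (fst p) (snd p))"
    and cB': "continuous_on (U \<times> (Y \<times> {a..b})) (\<lambda>p. B' (fst p) (snd p))"
    and U: "convex U" "continuous_on U \<omega>"
  shows "deriv_along \<omega> U Y (\<lambda>t y. integral {a..b} (\<lambda>z. B t (y, z))) (\<lambda>t y. integral {a..b} (\<lambda>z. B' t (y, z)))"
proof -
  have "((\<lambda>t. integral {a..b} (\<lambda>z. B t (y, z))) has_real_derivative integral {a..b} (\<lambda>z. B' t (y, z)) / \<omega> t) (at t within U)"
    if t: "t \<in> U" and y: "y \<in> Y" and "\<omega> t \<noteq> 0" for t y
  proof -
    from U(2) t obtain e where e: "e > 0" "\<And>r. r \<in> U \<Longrightarrow> dist r t < e \<Longrightarrow> dist (\<omega> r) (\<omega> t) < \<bar>\<omega> t\<bar>"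
      using \<open>\<omega> t \<noteq> 0\<close> unfolding continuous_on_iff by (metis zero_less_abs_iff)
    define V where "V = U \<inter> ball t e"
    have nz: "\<omega> r \<noteq> 0" if "r \<in> V" for r
      using e(2)[of r] that by (auto simp: V_def dist_commute dist_real_def)
    have VU: "V \<subseteq> U" by (auto simp: V_def)
    have cont: "continuous_on (V \<times> cbox a b) (\<lambda>(r, z). C r (y, z) / \<omega> r)"
      if "continuous_on (U \<times> (Y \<times> {a..b})) (\<lambda>p. C (fst p) (snd p))" for C
      unfolding split_beta using nz y VU
      by (intro continuous_intros continuous_on_compose2[OF U(2)] 
         continuous_on_compose2[OF that, of _ "\<lambda>q. (fst q, (y, snd q))", simplified]) auto
    have int: "(\<lambda>z. B r (y, z)) integrable_on cbox a b" if "r \<in> V" for r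
      using that y VU
      by (intro integrable_continuous continuous_on_compose2[OF cB, of _ "\<lambda>z. (r, (y, z))", simplified] continuous_intros) auto
    have "((\<lambda>t. integral (cbox a b) (\<lambda>z. B t (y, z))) has_real_derivative integral (cbox a b) (\<lambda>z. B' t (y, z) / \<omega> t)) (at t within V)"
    proof (rule leibniz_rule_field_derivative[OF _ int cont[OF cB']])
      show "((\<lambda>t. B t (y, z)) has_real_derivative B' r (y, z) / \<omega> r) (at r within V)" if "r \<in> V" "z \<in> cbox a b" for r z
        by (rule DERIV_subset[OF _ VU]) (use B' nz[OF that(1)] that VU y in auto)
      show "t \<in> V" using t e by (auto simp: V_def)
      show "convex V" unfolding V_def using U(1) by (intro convex_Int convex_ball)
    qed
    moreover have "at t within V = at t within U"
      unfolding V_def using e by (intro at_within_nhd[of _ "ball t e"]) auto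
    ultimately show ?thesis by simp
  qed
  moreover have "integral {a..b} (\<lambda>z. B' t (y, z)) = 0" if "t \<in> U" "y \<in> Y" "\<omega> t = 0" for t y
    using B' that by (intro integral_unique has_integral_is_0) auto
  ultimately show ?thesis by auto
qed

lemma cdiff_integral:
  fixes B :: "real \<Rightarrow> 'y::topological_space \<times> real \<Rightarrow> real"
  assumes "cdiff n \<omega> U (Y \<times> {a..b}) B" "convex U" "continuous_on U \<omega>"
  shows "cdiff n \<omega> U Y (\<lambda>t y. integral {a..b} (\<lambda>z. B t (y, z)))"
  using assms(1)
proof (induction n arbitrary: B)
  case 0
  then show ?case by (auto intro: continuous_on_integral_param)
next
  case (Suc n)
  from Suc.prems obtain B' where B': "deriv_along \<omega> U (Y \<times> {a..b}) B B'"
      "continuous_on (U \<times> (Y \<times> {a..b})) (\<lambda>p. B (fst p) (snd p))" "cdiff n \<omega> U (Y \<times> {a..b}) B'"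
    by (rule cdiff_SucE)
  from deriv_along_integral[OF B'(1,2) cdiff_cont[OF B'(3)] assms(2,3)] Suc.IH[OF B'(3)]
    continuous_on_integral_param[OF B'(2)]
  show ?case by (intro cdiff_SucI)
qed

text \<open>
  Functions of time alone are families over a one-point parameter space, so that they share all closure lemmas.
\<close>

abbreviation cdiff_fun :: "nat \<Rightarrow> (real \<Rightarrow> real) \<Rightarrow> real set \<Rightarrow> (real \<Rightarrow> real) \<Rightarrow> bool" where
  "cdiff_fun n \<omega> U q \<equiv> cdiff n \<omega> U {0::real} (\<lambda>t _. q t)"

lemma continuous_on_fun_iff:
  "continuous_on (U \<times> {0::real}) (\<lambda>p. q (fst p)) \<longleftrightarrow> continuous_on U (q :: real \<Rightarrow> real)"
proof
  assume "continuous_on (U \<times> {0::real}) (\<lambda>p. q (fst p))"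
  then have "continuous_on U (\<lambda>t. q (fst (t, 0::real)))"
    by (rule continuous_on_compose2[where f="\<lambda>t. (t, 0)"]) (auto intro!: continuous_intros)
  then show "continuous_on U q" by simp
next
  assume "continuous_on U q"
  then show "continuous_on (U \<times> {0::real}) (\<lambda>p. q (fst p))"
    by (rule continuous_on_compose2) (auto intro!: continuous_intros)
qed

lemma cdiff_fun_cont: "cdiff_fun n \<omega> U q \<Longrightarrow> continuous_on U q"
  using cdiff_cont[of n \<omega> U "{0::real}" "\<lambda>t _. q t"] by (simp add: continuous_on_fun_iff)

lemma cdiff_fun_SucE:
  assumes "cdiff_fun (Suc n) \<omega> U q"
  obtains q' where "\<And>t. t \<in> U \<Longrightarrow> \<omega> t \<noteq> 0 \<Longrightarrow> (q has_real_derivative q' t / \<omega> t) (at t within U)"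
    "\<And>t. t \<in> U \<Longrightarrow> \<omega> t = 0 \<Longrightarrow> q' t = 0" "cdiff_fun n \<omega> U q'"
proof -
  from assms obtain B' where B': "deriv_along \<omega> U {0::real} (\<lambda>t _. q t) B'" "cdiff n \<omega> U {0::real} B'"
    by (rule cdiff_SucE)
  have "cdiff_fun n \<omega> U (\<lambda>t. B' t 0)"
    by (rule cdiff_cong[OF B'(2)]) auto
  with B'(1) show ?thesis by (intro that[of "\<lambda>t. B' t 0"]) auto
qed

lemma cdiff_fun_SucI:
  assumes "\<And>t. t \<in> U \<Longrightarrow> \<omega> t \<noteq> 0 \<Longrightarrow> (q has_real_derivative q' t / \<omega> t) (at t within U)"
    "\<And>t. t \<in> U \<Longrightarrow> \<omega> t = 0 \<Longrightarrow> q' t = 0" "continuous_on U q" "cdiff_fun n \<omega> U q'"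
  shows "cdiff_fun (Suc n) \<omega> U q"
  using assms by (intro cdiff_SucI[where B'="\<lambda>t _. q' t"]) (auto simp: continuous_on_fun_iff)

lemma cdiff_fun_param: "cdiff_fun n \<omega> U q \<Longrightarrow> cdiff n \<omega> U Y (\<lambda>t y. q t)"
  using cdiff_param[of n \<omega> U "{0::real}" "\<lambda>t _. q t" Y "\<lambda>_. 0"] by auto

lemma cdiff_fun_antiderivative:
  assumes "\<And>t. t \<in> U \<Longrightarrow> (G has_real_derivative q t) (at t within U)" "cdiff_fun n (\<lambda>_. 1) U q"
  shows "cdiff_fun (Suc n) (\<lambda>_. 1) U G"
  using assms by (intro cdiff_fun_SucI DERIV_continuous_on) auto

lemma cdiff_plain_SucE:
  assumes "cdiff_fun (Suc n) (\<lambda>_. 1) U q"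
  obtains q' where "\<And>t. t \<in> U \<Longrightarrow> (q has_real_derivative q' t) (at t within U)" "cdiff_fun n (\<lambda>_. 1) U q'"
proof -
  from cdiff_fun_SucE[OF assms] obtain q' where
    "\<And>t. t \<in> U \<Longrightarrow> (1::real) \<noteq> 0 \<Longrightarrow> (q has_real_derivative q' t / 1) (at t within U)" "cdiff_fun n (\<lambda>_. 1) U q'"
    by metis
  then show ?thesis by (intro that[of q']) simp_all
qed

lemma C_on_iff_cdiff: "C_on n S g \<longleftrightarrow> cdiff_fun n (\<lambda>_. 1) S g"
proof
  assume "C_on n S g"
  then show "cdiff_fun n (\<lambda>_. 1) S g"
  proof (induction n arbitrary: g)
    case 0
    then obtain D where D: "\<forall>x\<in>S. D 0 x = g x" "continuous_on S (D (0::nat))"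
      unfolding C_on_def by auto
    then have "continuous_on S g" by (auto intro: continuous_on_eq)
    then show ?case by (simp add: continuous_on_fun_iff)
  next
    case (Suc n)
    from Suc.prems obtain D where D: "\<forall>x\<in>S. D 0 x = g x" "\<forall>k\<le>Suc n. continuous_on S (D k)"
       "\<forall>k<Suc n. \<forall>x\<in>S. (D k has_real_derivative D (Suc k) x) (at x within S)"
      unfolding C_on_def by blast
    have "C_on n S (D 1)"
      unfolding C_on_def
    proof (intro exI[of _ "\<lambda>k. D (Suc k)"] conjI ballI allI impI)
      show "(D (Suc k) has_real_derivative D (Suc (Suc k)) x) (at x within S)" if "k < n" "x \<in> S" for k x
        using D(3) that by blast
      show "continuous_on S (D (Suc k))" if "k \<le> n" for k
        using D(2) that by blast
    qed simp
    moreover have "(g has_real_derivative D 1 x) (at x within S)" if "x \<in> S" for x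
      by (rule has_field_derivative_transform_within[of "D 0" _ x S 1])
        (use D(3)[THEN spec, of 0] that D(1) in auto)
    ultimately show ?case by (rule cdiff_fun_antiderivative[OF _ Suc.IH, rotated])
  qed
next
  assume "cdiff_fun n (\<lambda>_. 1) S g"
  then show "C_on n S g"
  proof (induction n arbitrary: g)
    case 0
    then show ?case unfolding C_on_def
      by (intro exI[of _ "\<lambda>_. g"]) (simp add: continuous_on_fun_iff)
  next
    case (Suc n)
    from cdiff_plain_SucE[OF Suc.prems] obtain q' where q': "\<And>t. t \<in> S \<Longrightarrow> (g has_real_derivative q' t) (at t within S)"
        "cdiff_fun n (\<lambda>_. 1) S q'"
      by blast
    from Suc.IH[OF q'(2)] obtain D where D: "\<forall>x\<in>S. D 0 x = q' x" "\<forall>k\<le>n. continuous_on S (D k)"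
       "\<forall>k<n. \<forall>x\<in>S. (D k has_real_derivative D (Suc k) x) (at x within S)"
      unfolding C_on_def by blast
    have "continuous_on S g" using q'(1) by (rule DERIV_continuous_on)
    then have "\<forall>k\<le>Suc n. continuous_on S (case_nat g D k)"
      using D(2) by (simp split: nat.split)
    moreover have "(case_nat g D k has_real_derivative case_nat g D (Suc k) x) (at x within S)"
      if "k < Suc n" "x \<in> S" for k x
      using that D(1,3) q'(1) by (cases k) auto
    ultimately show ?case unfolding C_on_def
      by (intro exI[of _ "case_nat g D"] conjI ballI allI impI) auto
  qed
qed

text \<open>
  Plain derivatives can be traded for \<open>\<omega>\<close>-derivatives, since \<open>\<omega>\<close> itself is smooth along \<open>\<omega>\<close>; this holds up to the zeros
  of \<open>\<omega>\<close>. The converse (\<open>cdiff_to_plain\<close>) divides by \<open>t - a\<close> and is restricted to sets that avoid \<open>a\<close>.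
\<close>

lemma cdiff_from_plain:
  assumes "\<And>k. cdiff_fun k \<omega> U \<omega>" "cdiff n (\<lambda>_. 1) U Y B"
  shows "cdiff n \<omega> U Y B"
  using assms(2)
proof (induction n arbitrary: B)
  case (Suc n)
  from Suc.prems obtain B' where B': "deriv_along (\<lambda>_. 1) U Y B B'" "continuous_on (U \<times> Y) (\<lambda>p. B (fst p) (snd p))" "cdiff n (\<lambda>_. 1) U Y B'"
    by (rule cdiff_SucE)
  have "cdiff n \<omega> U Y (\<lambda>t y. \<omega> t * B' t y)"
    by (intro cdiff_mult Suc.IH B' cdiff_fun_param[OF assms(1)])
  then show ?case using B' by (intro cdiff_SucI[where B'="\<lambda>t y. \<omega> t * B' t y"]) auto
qed auto

lemma cdiff_shift: "cdiff_fun n (\<lambda>t. t - a) U (\<lambda>t. t - a)"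
proof (induction n)
  case 0
  then show ?case by (auto simp: continuous_on_fun_iff intro!: continuous_intros)
next
  case (Suc n)
  then show ?case
    by (intro cdiff_fun_SucI[where q'="\<lambda>t. t - a"]) (auto intro!: derivative_eq_intros continuous_intros)
qed

text \<open>
  The reason for the scaling field: the square root is not differentiable at \<open>a\<close>, but an eigenfunction of \<open>(t - a) d/dt\<close>.
\<close>

lemma cdiff_sqrt: "U \<subseteq> {a..} \<Longrightarrow> cdiff_fun n (\<lambda>t. t - a) U (\<lambda>t. sqrt (t - a))"
proof (induction n)
  case 0
  then show ?case by (auto simp: continuous_on_fun_iff intro!: continuous_intros)
next
  case (Suc n)
  have "((\<lambda>t. sqrt (t - a)) has_real_derivative (1/2 * sqrt (t - a)) / (t - a)) (at t within U)"
    if "t \<in> U" "t - a \<noteq> 0" for t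
  proof -
    from that Suc.prems have "t > a" by auto
    then have "((\<lambda>t. sqrt (t - a)) has_real_derivative inverse (sqrt (t - a)) / 2) (at t within U)"
      by (auto intro!: derivative_eq_intros simp: field_simps)
    also have "inverse (sqrt (t - a)) / 2 = (1/2 * sqrt (t - a)) / (t - a)"
      using \<open>t > a\<close> by (simp add: field_simps)
    finally show ?thesis .
  qed
  moreover have "cdiff_fun n (\<lambda>t. t - a) U (\<lambda>t. 1/2 * sqrt (t - a))"
    by (intro cdiff_cmult Suc.IH Suc.prems)
  ultimately show ?case
    by (intro cdiff_fun_SucI[where q'="\<lambda>t. 1/2 * sqrt (t - a)"]) (auto intro!: continuous_intros)
qed

lemma cdiff_inverse_shift:
  assumes "a \<notin> U"
  shows "cdiff_fun n (\<lambda>_. 1) U (\<lambda>t. (1 / (t - a)) ^ k)"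
proof (induction n arbitrary: k)
  case 0
  show ?case using assms by (auto simp: continuous_on_fun_iff intro!: continuous_intros)
next
  case (Suc n)
  have "((\<lambda>t. (1 / (t - a)) ^ k) has_real_derivative (- real k * (1 / (t - a)) ^ (k + 1))) (at t within U)"
    if "t \<in> U" for t
  proof -
    have "t \<noteq> a" using that assms by auto
    then have "((\<lambda>t. (1 / (t - a)) ^ k) has_real_derivative
        real k * (1 / (t - a)) ^ (k - 1) * (- (1 / (t - a)\<^sup>2))) (at t within U)"
      by (auto intro!: derivative_eq_intros simp: power2_eq_square)
    also have "real k * (1 / (t - a)) ^ (k - 1) * (- (1 / (t - a)\<^sup>2)) = - real k * (1 / (t - a)) ^ (k + 1)"
      using \<open>t \<noteq> a\<close> by (cases k) (simp_all add: power2_eq_square power_divide divide_simps)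
    finally show ?thesis .
  qed
  then show ?case
    by (rule cdiff_fun_antiderivative[OF _ cdiff_cmult[OF Suc.IH]])
qed

lemma cdiff_to_plain:
  assumes "cdiff n (\<lambda>t. t - a) U Y B" "V \<subseteq> U" "a \<notin> V"
  shows "cdiff n (\<lambda>_. 1) V Y B"
  using assms(1)
proof (induction n arbitrary: B)
  case 0
  then show ?case using assms by (auto elim!: continuous_on_subset)
next
  case (Suc n)
  from Suc.prems obtain B' where B': "deriv_along (\<lambda>t. t - a) U Y B B'" "continuous_on (U \<times> Y) (\<lambda>p. B (fst p) (snd p))" "cdiff n (\<lambda>t. t - a) U Y B'"
    by (rule cdiff_SucE)
  have "cdiff n (\<lambda>_. 1) V Y (\<lambda>t y. B' t y * (1 / (t - a)) ^ 1)"
    by (intro cdiff_mult Suc.IH B' cdiff_fun_param[OF cdiff_inverse_shift[OF assms(3)]])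
  moreover have "deriv_along (\<lambda>_. 1) V Y B (\<lambda>t y. B' t y * (1 / (t - a)) ^ 1)"
  proof (intro ballI conjI impI)
    fix t y assume "t \<in> V" "y \<in> Y"
    then have "((\<lambda>t. B t y) has_real_derivative B' t y / (t - a)) (at t within U)"
      using B'(1) assms(2,3) by auto
    then show "((\<lambda>t. B t y) has_real_derivative B' t y * (1 / (t - a)) ^ 1 / 1) (at t within V)"
      using assms(2) DERIV_subset by auto
  qed auto
  moreover have "continuous_on (V \<times> Y) (\<lambda>p. B (fst p) (snd p))"
    by (rule continuous_on_subset[OF B'(2)]) (use assms in auto)
  ultimately show ?case by (intro cdiff_SucI)
qed

lemma scale_mem:
  assumes "t \<in> {a..T}" "0 \<le> x" "x \<le> 1" shows "a + (t - a) * x \<in> {a..(T::real)}"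
  using assms mult_left_le[of x "t - a"] by auto

text \<open>
  Rescaling time by a factor \<open>\<beta> y\<close> about \<open>a\<close> commutes with the scaling field. Where \<open>\<beta> y = 0\<close> the composite is constant in
  time, which agrees with the formula because the derivative vanishes at \<open>a\<close>.
\<close>

lemma deriv_along_scale_comp:
  assumes q': "\<And>t. t \<in> {a..T} \<Longrightarrow> t - a \<noteq> 0 \<Longrightarrow> (q has_real_derivative q' t / (t - a)) (at t within {a..T})"
    "q' a = 0" and \<beta>: "\<beta> ` Y \<subseteq> {0..1}"
  shows "deriv_along (\<lambda>t. t - a) {a..T} Y (\<lambda>t y. q (a + (t - a) * \<beta> y)) (\<lambda>t y. q' (a + (t - a) * \<beta> y))"
proof (intro ballI conjI impI)
  fix t y assume t: "t \<in> {a..T}" and y: "y \<in> Y" and nz: "t - a \<noteq> 0"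
  show "((\<lambda>t. q (a + (t - a) * \<beta> y)) has_real_derivative q' (a + (t - a) * \<beta> y) / (t - a)) (at t within {a..T})"
  proof (cases "\<beta> y = 0")
    case True
    then show ?thesis using q'(2) by auto
  next
    case False
    let ?g = "\<lambda>t. a + (t - a) * \<beta> y"
    have mem: "?g t \<in> {a..T}" if "t \<in> {a..T}" for t
      by (rule scale_mem[OF that]) (use \<beta> y in auto)
    have "(q has_real_derivative q' (?g t) / (?g t - a)) (at (?g t) within ?g ` {a..T})"
      by (rule DERIV_subset[OF q'(1)]) (use mem[OF t] mem nz False in auto)
    moreover have "(?g has_real_derivative \<beta> y) (at t within {a..T})"
      by (auto intro!: derivative_eq_intros)
    ultimately have "((q \<circ> ?g) has_real_derivative q' (?g t) / (?g t - a) * \<beta> y) (at t within {a..T})"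
      by (rule DERIV_image_chain)
    then show ?thesis using False nz by (simp add: o_def)
  qed
next
  fix t y assume "t \<in> {a..T}" "y \<in> Y" "t - a = 0"
  then show "q' (a + (t - a) * \<beta> y) = 0" by (simp only: \<open>t - a = 0\<close> mult_zero_left add_0_right q'(2))
qed

lemma continuous_on_scale_comp:
  fixes \<beta> :: "'y::topological_space \<Rightarrow> real"
  assumes "continuous_on {a..T} q" "continuous_on Y \<beta>" "\<beta> ` Y \<subseteq> {0..1}"
  shows "continuous_on ({a..T} \<times> Y) (\<lambda>p. q (a + (fst p - a) * \<beta> (snd p)))"
proof (rule continuous_on_compose2[OF assms(1), where f="\<lambda>p. a + (fst p - a) * \<beta> (snd p)"])
  have "continuous_on ({a..T} \<times> Y) (\<lambda>p. \<beta> (snd p))"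
    by (rule continuous_on_compose2[OF assms(2), of _ snd]) (auto intro: continuous_intros)
  then show "continuous_on ({a..T} \<times> Y) (\<lambda>p. a + (fst p - a) * \<beta> (snd p))"
    by (intro continuous_intros)
  show "(\<lambda>p. a + (fst p - a) * \<beta> (snd p)) ` ({a..T} \<times> Y) \<subseteq> {a..T}"
  proof clarify
    fix t y assume "t \<in> {a..T}" "y \<in> Y"
    then show "a + (fst (t, y) - a) * \<beta> (snd (t, y)) \<in> {a..T}"
      unfolding fst_conv snd_conv by (intro scale_mem) (use assms(3) in auto)
  qed
qed

lemma cdiff_scale_comp:
  fixes \<beta> :: "'y::topological_space \<Rightarrow> real"
  assumes "cdiff_fun n (\<lambda>t. t - a) {a..T} q" "continuous_on Y \<beta>" "\<beta> ` Y \<subseteq> {0..1}"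
  shows "cdiff n (\<lambda>t. t - a) {a..T} Y (\<lambda>t y. q (a + (t - a) * \<beta> y))"
  using assms(1)
proof (induction n arbitrary: q)
  case 0
  then show ?case using continuous_on_scale_comp[OF _ assms(2,3)] by (simp add: continuous_on_fun_iff)
next
  case (Suc n)
  from cdiff_fun_SucE[OF Suc.prems] obtain q' where q': "\<And>t. t \<in> {a..T} \<Longrightarrow> t - a \<noteq> 0 \<Longrightarrow> (q has_real_derivative q' t / (t - a)) (at t within {a..T})"
    "\<And>t. t \<in> {a..T} \<Longrightarrow> t - a = 0 \<Longrightarrow> q' t = 0" "cdiff_fun n (\<lambda>t. t - a) {a..T} q'"
    by blast
  show ?case
  proof (cases "a \<le> T")
    case True
    then have "q' a = 0" using q'(2)[of a] by simp
    from deriv_along_scale_comp[OF q'(1) this assms(3)] Suc.IH[OF q'(3)]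
      continuous_on_scale_comp[OF cdiff_fun_cont[OF Suc.prems] assms(2,3)]
    show ?thesis by (intro cdiff_SucI)
  next
    case False
    then have "cdiff (Suc n) (\<lambda>t. t - a) {a..T} Y (\<lambda>_ _. 0)" by (intro cdiff_const)
    then show ?thesis by (rule cdiff_cong) (use False in auto)
  qed
qed

text \<open>
  Being \<open>C\<^sup>n\<close> is a local property. Derivatives within \<open>S\<close> are unique, so the local ones fit together.
\<close>

lemma cdiff_fun_local:
  assumes "\<And>x. x \<in> S \<Longrightarrow> \<exists>V. open V \<and> x \<in> V \<and> cdiff_fun n (\<lambda>_. 1) (S \<inter> V) g"
    and "\<And>x. x \<in> S \<Longrightarrow> at x within S \<noteq> bot"
  shows "cdiff_fun n (\<lambda>_. 1) S g"
  using assms(1)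
proof (induction n arbitrary: g)
  case 0
  have "continuous (at x within S) g" if x: "x \<in> S" for x
  proof -
    from 0[OF x] obtain V where V: "open V" "x \<in> V" "cdiff_fun 0 (\<lambda>_. 1) (S \<inter> V) g" by blast
    have "continuous (at x within (S \<inter> V)) g"
      using cdiff_fun_cont[OF V(3)] x V(2) by (simp add: continuous_on_eq_continuous_within)
    then show ?thesis using at_within_nhd[OF V(2,1), of "S \<inter> V" S] by auto
  qed
  then have "continuous_on S g" by (simp add: continuous_on_eq_continuous_within)
  then show ?case by (simp add: continuous_on_fun_iff)
next
  case (Suc n)
  define g' where "g' x = (SOME D. (g has_real_derivative D) (at x within S))" for x
  have ex: "\<exists>V. open V \<and> x \<in> V \<and> cdiff_fun n (\<lambda>_. 1) (S \<inter> V) g' \<and>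
      (\<forall>r\<in>S \<inter> V. (g has_real_derivative g' r) (at r within S))" if x: "x \<in> S" for x
  proof -
    from Suc.prems[OF x] obtain V where V: "open V" "x \<in> V" "cdiff_fun (Suc n) (\<lambda>_. 1) (S \<inter> V) g" by blast
    from cdiff_plain_SucE[OF V(3)] obtain q' where q': "\<And>t. t \<in> S \<inter> V \<Longrightarrow> (g has_real_derivative q' t) (at t within (S \<inter> V))"
        "cdiff_fun n (\<lambda>_. 1) (S \<inter> V) q'"
      by blast
    have d: "(g has_real_derivative q' r) (at r within S)" if "r \<in> S \<inter> V" for r
      using q'(1)[OF that] at_within_nhd[of r V "S \<inter> V" S] that V(1) by auto
    then have d': "(g has_real_derivative g' r) (at r within S)" if "r \<in> S \<inter> V" for r
      unfolding g'_def using that by (metis someI)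
    have "q' r = g' r" if "r \<in> S \<inter> V" for r
      using has_field_derivative_unique[OF d[OF that] d'[OF that]] assms(2) that by auto
    then have "cdiff_fun n (\<lambda>_. 1) (S \<inter> V) g'"
      by (intro cdiff_cong[OF q'(2)])
    with V d' show ?thesis by blast
  qed
  have "cdiff_fun n (\<lambda>_. 1) S g'" by (rule Suc.IH) (use ex in blast)
  moreover have "(g has_real_derivative g' x) (at x within S)" if "x \<in> S" for x
    using ex that by blast
  ultimately show ?case by (rule cdiff_fun_antiderivative[rotated])
qed

section \<open>Gaussian kernels\<close>

text \<open>
  The family \<open>x\<^sup>i r powr (- j / 2) exp (- x\<^sup>2 / (4 r))\<close> contains the heat kernel (up to a constant) and is closed
  under both partial derivatives. With the value 0 for \<open>r \<le> 0\<close> its members are smooth everywhere except at the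
  origin, because they are flat at \<open>r = 0\<close> when \<open>x \<noteq> 0\<close>. So an integral over past times \<open>\<tau> \<le> t\<close> can be
  written with a fixed upper limit, and no boundary term arises when it is differentiated in \<open>t\<close>.
\<close>

definition gauss :: "nat \<Rightarrow> nat \<Rightarrow> real \<Rightarrow> real \<Rightarrow> real" where
  "gauss i j x r = (if r > 0 then x ^ i * (1 / sqrt r) ^ j * exp (- x\<^sup>2 / (4 * r)) else 0)"

lemma power_over_fact_le_exp:
  assumes "(0::real) \<le> y" shows "y ^ n / fact n \<le> exp y"
proof -
  have "(\<Sum>k\<in>{n}. y ^ k /\<^sub>R fact k) \<le> (\<Sum>k. y ^ k /\<^sub>R fact k)"
    using assms summable_exp_generic[of y] by (intro sum_le_suminf) auto
  then show ?thesis by (simp add: exp_def scaleR_conv_of_real field_simps)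
qed

lemma exp_minus_le_fact_over_power:
  assumes "(0::real) < y" shows "exp (- y) \<le> fact n / y ^ n"
proof -
  have "y ^ n \<le> exp y * fact n"
    using power_over_fact_le_exp[of y n] assms by (simp add: divide_le_eq)
  then show ?thesis using assms by (simp add: exp_minus divide_simps mult.commute)
qed

text \<open>
  A spare factor \<open>r\<close> turns continuity of the family at \<open>r = 0\<close> into differentiability there.
\<close>

lemma gauss_time_factor: "gauss i j x r = r * gauss i (j + 2) x r"
proof (cases "r > 0")
  case True
  then have "(1 / sqrt r)\<^sup>2 = 1 / r" by (simp add: power_divide)
  then have "r * (1 / sqrt r) ^ (j + 2) = (1 / sqrt r) ^ j"
    using True by (simp only: power_add) simp
  then show ?thesis using True by (simp add: gauss_def)
qed (simp add: gauss_def)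

lemma gauss_le:
  assumes "x \<noteq> 0" "r \<le> 1"
  shows "\<bar>gauss i j x r\<bar> \<le> fact (j + 1) * 4 ^ (j + 1) * \<bar>x\<bar> ^ i / (x\<^sup>2) ^ (j + 1) * \<bar>r\<bar>"
proof (cases "r > 0")
  case True
  let ?N = "j + 1" and ?y = "x\<^sup>2 / (4 * r)"
  have y: "?y > 0" using assms True by simp
  have "exp (- ?y) \<le> fact ?N / ?y ^ ?N"
    by (rule exp_minus_le_fact_over_power[OF y])
  also have "fact ?N / ?y ^ ?N = fact ?N * 4 ^ ?N / (x\<^sup>2) ^ ?N * r ^ ?N"
    by (simp add: power_divide power_mult_distrib del: fact_Suc power_Suc)
  finally have e: "exp (- x\<^sup>2 / (4 * r)) \<le> fact ?N * 4 ^ ?N / (x\<^sup>2) ^ ?N * r ^ ?N" by simp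
  have "r \<le> sqrt r" using assms True by (simp add: real_le_rsqrt power2_eq_square mult_left_le)
  then have s: "(1 / sqrt r) ^ j \<le> (1 / r) ^ j"
    using True by (intro power_mono frac_le) auto
  have "\<bar>gauss i j x r\<bar> = \<bar>x\<bar> ^ i * (1 / sqrt r) ^ j * exp (- x\<^sup>2 / (4 * r))"
    using True by (simp add: gauss_def abs_mult power_abs)
  also have "\<dots> \<le> \<bar>x\<bar> ^ i * (1 / r) ^ j * (fact ?N * 4 ^ ?N / (x\<^sup>2) ^ ?N * r ^ ?N)"
    using True by (intro mult_mono s e mult_left_mono) auto
  also have "\<dots> = fact ?N * 4 ^ ?N * \<bar>x\<bar> ^ i / (x\<^sup>2) ^ ?N * \<bar>r\<bar>"
    using True by (simp add: power_divide field_simps del: fact_Suc)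
  finally show ?thesis .
next
  case False
  have "0 \<le> fact (j + 1) * 4 ^ (j + 1) * \<bar>x\<bar> ^ i / (x\<^sup>2) ^ (j + 1) * \<bar>r\<bar>"
    by (intro mult_nonneg_nonneg divide_nonneg_nonneg) auto
  then show ?thesis using False by (simp add: gauss_def del: fact_Suc power_Suc)
qed

text \<open>
  At \<open>r = 0\<close>, \<open>x \<noteq> 0\<close> the exponential beats every power of \<open>1 / r\<close> (\<open>gauss_le\<close>).
\<close>

lemma isCont_gauss:
  assumes "x \<noteq> 0 \<or> r \<noteq> 0"
  shows "isCont (\<lambda>p. gauss i j (fst p) (snd p)) (x, r)"
proof -
  consider "r > 0" | "r < 0" | "r = 0" "x \<noteq> 0" using assms by linarith
  then show ?thesis
  proof cases
    case 1
    have "open {p::real \<times> real. snd p > 0}" by (intro open_Collect_less continuous_intros)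
    then have ev: "eventually (\<lambda>p. fst p ^ i * (1 / sqrt (snd p)) ^ j * exp (- (fst p)\<^sup>2 / (4 * snd p)) = gauss i j (fst p) (snd p)) (nhds (x, r))"
      unfolding eventually_nhds using 1 by (intro exI[of _ "{p. snd p > 0}"]) (auto simp: gauss_def)
    have "isCont (\<lambda>p. fst p ^ i * (1 / sqrt (snd p)) ^ j * exp (- (fst p)\<^sup>2 / (4 * snd p))) (x, r)"
      using 1 by (intro continuous_intros) auto
    then show ?thesis by (subst (asm) isCont_cong[OF ev])
  next
    case 2
    have "open {p::real \<times> real. snd p < 0}" by (intro open_Collect_less continuous_intros)
    then have ev: "eventually (\<lambda>p. 0 = gauss i j (fst p) (snd p)) (nhds (x, r))"
      unfolding eventually_nhds using 2 by (intro exI[of _ "{p. snd p < 0}"]) (auto simp: gauss_def)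
    have "isCont (\<lambda>p. 0::real) (x, r)" by simp
    then show ?thesis by (subst (asm) isCont_cong[OF ev])
  next
    case 3
    let ?b = "\<lambda>p::real\<times>real. fact (j + 1) * 4 ^ (j + 1) * \<bar>fst p\<bar> ^ i / ((fst p)\<^sup>2) ^ (j + 1) * \<bar>snd p\<bar>"
    have "isCont ?b (x, r)"
      using 3 by (intro continuous_intros) auto
    then have b0: "(?b \<longlongrightarrow> 0) (at (x, r))" using 3 by (simp add: isCont_def del: fact_Suc)
    have "open ({p::real \<times> real. snd p < 1} \<inter> {p. fst p \<noteq> 0})"
      by (intro open_Int open_Collect_less open_Collect_neq continuous_intros)
    then have "eventually (\<lambda>p. p \<in> {p::real \<times> real. snd p < 1} \<inter> {p. fst p \<noteq> 0}) (nhds (x, r))"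
      using 3 by (intro eventually_nhds_in_open) auto
    then have "eventually (\<lambda>p. norm (gauss i j (fst p) (snd p)) \<le> ?b p) (at (x, r))"
      unfolding real_norm_def
      by (intro filter_leD[OF at_within_le_nhds]) (elim eventually_mono, rule gauss_le, auto)
    from Lim_null_comparison[OF this b0] show ?thesis
      using 3 by (simp add: isCont_def gauss_def)
  qed
qed

lemma continuous_on_gauss:
  assumes "continuous_on A f" "continuous_on A g" "\<And>a. a \<in> A \<Longrightarrow> f a \<noteq> 0 \<or> g a \<noteq> 0"
  shows "continuous_on A (\<lambda>a. gauss i j (f a) (g a))"
proof -
  have "continuous_on {p. fst p \<noteq> 0 \<or> snd p \<noteq> 0} (\<lambda>p. gauss i j (fst p) (snd p))"
    by (intro continuous_at_imp_continuous_on) (auto intro: isCont_gauss)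
  then have "continuous_on A (\<lambda>a. gauss i j (fst (f a, g a)) (snd (f a, g a)))"
    by (rule continuous_on_compose2[where f="\<lambda>a. (f a, g a)"])
      (use assms in \<open>auto intro!: continuous_intros\<close>)
  then show ?thesis by simp
qed

definition gauss_x :: "nat \<Rightarrow> nat \<Rightarrow> real \<Rightarrow> real \<Rightarrow> real" where
  "gauss_x i j x r = real i * gauss (i - 1) j x r - 1/2 * gauss (i + 1) (j + 2) x r"

definition gauss_r :: "nat \<Rightarrow> nat \<Rightarrow> real \<Rightarrow> real \<Rightarrow> real" where
  "gauss_r i j x r = 1/4 * gauss (i + 2) (j + 4) x r - real j / 2 * gauss i (j + 2) x r"

lemma gauss_has_derivative:
  assumes x: "(x has_real_derivative x') (at t within U)" and r: "(r has_real_derivative r') (at t within U)"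
    and nz: "x t \<noteq> 0 \<or> r t \<noteq> 0"
  shows "((\<lambda>t. gauss i j (x t) (r t)) has_real_derivative
     x' * gauss_x i j (x t) (r t) + r' * gauss_r i j (x t) (r t)) (at t within U)"
proof -
  have cr: "(r \<longlongrightarrow> r t) (at t within U)" using r has_field_derivative_iff DERIV_continuous continuous_within by blast
  have cx: "(x \<longlongrightarrow> x t) (at t within U)" using x has_field_derivative_iff DERIV_continuous continuous_within by blast
  consider "r t > 0" | "r t < 0" | "r t = 0" "x t \<noteq> 0" using nz by linarith
  then show ?thesis
  proof cases
    case 1
    define R where "R = sqrt (r t)"
    have R: "R > 0" "r t = R\<^sup>2" using 1 by (auto simp: R_def)
    have dR: "((\<lambda>t. 1 / sqrt (r t)) has_real_derivative - r' / (2 * R ^ 3)) (at t within U)"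
      using 1 R by (auto intro!: derivative_eq_intros r simp: R_def[symmetric] field_simps power2_eq_square power3_eq_cube)
    have dE: "((\<lambda>t. exp (- (x t)\<^sup>2 / (4 * r t))) has_real_derivative
       exp (- (x t)\<^sup>2 / (4 * r t)) * (- x' * x t / (2 * R\<^sup>2) + r' * (x t)\<^sup>2 / (4 * R ^ 4))) (at t within U)"
      using R by (auto intro!: derivative_eq_intros x r simp: R(2) field_simps power2_eq_square power4_eq_xxxx)
    have "((\<lambda>t. x t ^ i * (1 / sqrt (r t)) ^ j * exp (- (x t)\<^sup>2 / (4 * r t))) has_real_derivative
       (real i * x t ^ (i - 1) * x') * ((1 / R) ^ j * exp (- (x t)\<^sup>2 / (4 * r t))) +
       (real j * (1 / R) ^ (j - 1) * (- r' / (2 * R ^ 3))) * (x t ^ i * exp (- (x t)\<^sup>2 / (4 * r t))) +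
       x t ^ i * (1 / R) ^ j * (exp (- (x t)\<^sup>2 / (4 * r t)) * (- x' * x t / (2 * R\<^sup>2) + r' * (x t)\<^sup>2 / (4 * R ^ 4)))) (at t within U)"
      by (rule derivative_eq_intros dR dE x refl | simp add: R_def algebra_simps)+
    also have "(real j * (1 / R) ^ (j - 1) * (- r' / (2 * R ^ 3))) = - r' * real j / 2 * (1 / R) ^ (j + 2)"
      using R by (cases j) (auto simp: field_simps power_divide power2_eq_square power3_eq_cube)
    also have "(real i * x t ^ (i - 1) * x') * ((1 / R) ^ j * exp (- (x t)\<^sup>2 / (4 * r t))) +
       (- r' * real j / 2 * (1 / R) ^ (j + 2)) * (x t ^ i * exp (- (x t)\<^sup>2 / (4 * r t))) +
       x t ^ i * (1 / R) ^ j * (exp (- (x t)\<^sup>2 / (4 * r t)) * (- x' * x t / (2 * R\<^sup>2) + r' * (x t)\<^sup>2 / (4 * R ^ 4))) =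
       x' * gauss_x i j (x t) (r t) + r' * gauss_r i j (x t) (r t)"
    proof -
      have *: "(1 / R) ^ j / R\<^sup>2 = (1 / R) ^ (j + 2)" "(1 / R) ^ j / R ^ 4 = (1 / R) ^ (j + 4)"
        by (simp_all add: power_add power_divide power2_eq_square)
      have eq: "z ^ i * P * (E * (- x' * z / (2 * S) + r' * z\<^sup>2 / (4 * V))) =
          - x' / 2 * (z ^ (i + 1) * (P / S) * E) + r' / 4 * (z ^ (i + 2) * (P / V) * E)" for z P E S V :: real
        by (simp add: algebra_simps power2_eq_square add_divide_distrib)
      show ?thesis unfolding eq *
        using 1 by (simp add: gauss_x_def gauss_r_def gauss_def R_def[symmetric] algebra_simps del: power_Suc power_Suc2)
    qed
    finally have D: "((\<lambda>t. x t ^ i * (1 / sqrt (r t)) ^ j * exp (- (x t)\<^sup>2 / (4 * r t))) has_real_derivative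
       x' * gauss_x i j (x t) (r t) + r' * gauss_r i j (x t) (r t)) (at t within U)" .
    have "eventually (\<lambda>s. r s > 0) (at t within U)" using cr 1 by (rule order_tendstoD)
    then have "eventually (\<lambda>s. x s ^ i * (1 / sqrt (r s)) ^ j * exp (- (x s)\<^sup>2 / (4 * r s)) = gauss i j (x s) (r s)) (at t within U)"
      by eventually_elim (simp add: gauss_def)
    from has_field_derivative_cong_eventually[OF this] D show ?thesis using 1 by (simp add: gauss_def)
  next
    case 2
    have "eventually (\<lambda>s. r s < 0) (at t within U)" using cr 2 by (rule order_tendstoD)
    then have "eventually (\<lambda>s. 0 = gauss i j (x s) (r s)) (at t within U)"
      by eventually_elim (simp add: gauss_def)
    then have "((\<lambda>t. gauss i j (x t) (r t)) has_real_derivative 0) (at t within U)"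
      using has_field_derivative_cong_eventually[of "\<lambda>_. 0"] 2 by (fastforce simp: gauss_def)
    then show ?thesis using 2 by (simp add: gauss_x_def gauss_r_def gauss_def)
  next
    case 3
    have "((\<lambda>s. (r s - r t) / (s - t) * gauss i (j + 2) (x s) (r s)) \<longlongrightarrow> r' * gauss i (j + 2) (x t) (r t)) (at t within U)"
      using r isCont_tendsto_compose[OF isCont_gauss[of "x t" "r t" i "j+2"] tendsto_Pair[OF cx cr]] 3
      by (intro tendsto_mult) (auto simp: has_field_derivative_iff)
    moreover have "(r s - r t) / (s - t) * gauss i (j + 2) (x s) (r s) = (gauss i j (x s) (r s) - gauss i j (x t) (r t)) / (s - t)" for s
      using gauss_time_factor[of i j "x s" "r s"] 3 by (simp add: gauss_def[of i j "x t"])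
    ultimately have "((\<lambda>s. (gauss i j (x s) (r s) - gauss i j (x t) (r t)) / (s - t)) \<longlongrightarrow> r' * gauss i (j + 2) (x t) (r t)) (at t within U)"
      by (simp only:)
    then show ?thesis using 3 by (simp add: has_field_derivative_iff gauss_x_def gauss_r_def gauss_def[of _ _ "x t" 0])
  qed
qed

text \<open>
  The chain rule of order \<open>n\<close>. The induction is over \<open>n\<close> for all members of the family at once; since the family
  is closed under derivatives, no formula for higher derivatives of composites is needed.
\<close>

lemma cdiff_gauss:
  assumes "cdiff n (\<lambda>_. 1) U Y X" "cdiff n (\<lambda>_. 1) U Y R" "\<And>t y. t \<in> U \<Longrightarrow> y \<in> Y \<Longrightarrow> X t y \<noteq> 0 \<or> R t y \<noteq> 0"
  shows "cdiff n (\<lambda>_. 1) U Y (\<lambda>t y. gauss i j (X t y) (R t y))"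
  using assms(1,2)
proof (induction n arbitrary: i j)
  case 0
  then show ?case using assms(3) by (auto intro!: continuous_on_gauss)
next
  case (Suc n)
  from Suc.prems(1) obtain X' where X': "deriv_along (\<lambda>_. 1) U Y X X'" "continuous_on (U \<times> Y) (\<lambda>p. X (fst p) (snd p))" "cdiff n (\<lambda>_. 1) U Y X'"
    by (rule cdiff_SucE)
  from Suc.prems(2) obtain R' where R': "deriv_along (\<lambda>_. 1) U Y R R'" "continuous_on (U \<times> Y) (\<lambda>p. R (fst p) (snd p))" "cdiff n (\<lambda>_. 1) U Y R'"
    by (rule cdiff_SucE)
  have d: "deriv_along (\<lambda>_. 1) U Y (\<lambda>t y. gauss i j (X t y) (R t y))
     (\<lambda>t y. X' t y * gauss_x i j (X t y) (R t y) + R' t y * gauss_r i j (X t y) (R t y))"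
  proof (intro ballI conjI impI)
    fix t y assume "t \<in> U" "y \<in> Y"
    then show "((\<lambda>t. gauss i j (X t y) (R t y)) has_real_derivative
     (X' t y * gauss_x i j (X t y) (R t y) + R' t y * gauss_r i j (X t y) (R t y)) / 1) (at t within U)"
      unfolding div_by_1 using X'(1) R'(1) assms(3) by (intro gauss_has_derivative) auto
  qed auto
  have e: "cdiff n (\<lambda>_. 1) U Y (\<lambda>t y. X' t y * gauss_x i j (X t y) (R t y) + R' t y * gauss_r i j (X t y) (R t y))"
    unfolding gauss_x_def gauss_r_def
    by (intro cdiff_add cdiff_diff cdiff_mult[OF X'(3)] cdiff_mult[OF R'(3)] cdiff_cmult Suc.IH
        cdiff_Suc_imp[OF Suc.prems(1)] cdiff_Suc_imp[OF Suc.prems(2)])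
  have c: "continuous_on (U \<times> Y) (\<lambda>p. gauss i j (X (fst p) (snd p)) (R (fst p) (snd p)))"
    using assms(3) X' R' by (intro continuous_on_gauss) auto
  show ?case by (rule cdiff_SucI[OF d c e])
qed

section \<open>Volterra equations of the second kind\<close>

lemma integrable_on_section:
  fixes B :: "real \<Rightarrow> real \<Rightarrow> real"
  assumes "continuous_on ({a..T} \<times> {0..1}) (\<lambda>p. B (fst p) (snd p))" "t \<in> {a..T}"
  shows "(\<lambda>y. B t y :: real) integrable_on {0..1::real}"
proof -
  have "continuous_on {0..1} (\<lambda>y. B (fst (t, y)) (snd (t, y)))"
    by (rule continuous_on_compose2[OF assms(1), where f="\<lambda>y. (t, y)"]) (use assms(2) in \<open>auto intro!: continuous_intros\<close>)
  then show ?thesis by (simp add: integrable_continuous_interval)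
qed

text \<open>
  The norm of the Abel operator in the weighted space with weight \<open>exp (\<mu> t)\<close> is \<open>O(1 / sqrt \<mu>)\<close>, uniformly in the
  length \<open>c = t - a\<close> of the time interval. The estimate \<open>exp (- z) \<le> 1 / (1 + z)\<close> makes the integral elementary.
\<close>

lemma sqrt_mult_integral_exp_le:
  fixes c \<mu> :: real
  assumes "0 \<le> c" "0 < \<mu>"
  shows "sqrt c * integral {0..1} (\<lambda>y. exp (- \<mu> * c * y\<^sup>2)) \<le> pi / 2 / sqrt \<mu>"
proof -
  let ?k = "sqrt (\<mu> * c)"
  have k2: "?k\<^sup>2 = \<mu> * c" using assms by simp
  have "((\<lambda>y. sqrt c / (1 + (?k * y)\<^sup>2)) has_integral arctan (?k * 1) / sqrt \<mu> - arctan (?k * 0) / sqrt \<mu>) {0..1}"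
  proof (rule fundamental_theorem_of_calculus)
    fix y :: real
    have "((\<lambda>y. arctan (?k * y) / sqrt \<mu>) has_real_derivative (inverse (1 + (?k * y)\<^sup>2) * ?k) / sqrt \<mu>) (at y within {0..1})"
      by (intro DERIV_cdivide DERIV_chain2[OF DERIV_arctan]) (auto intro!: derivative_eq_intros)
    also have "(inverse (1 + (?k * y)\<^sup>2) * ?k) / sqrt \<mu> = sqrt c / (1 + (?k * y)\<^sup>2)"
    proof -
      have "?k / sqrt \<mu> = sqrt c" using assms by (simp add: real_sqrt_mult)
      then show ?thesis by (metis (no_types, lifting) divide_inverse mult.assoc mult.commute)
    qed
    finally show "((\<lambda>y. arctan (?k * y) / sqrt \<mu>) has_vector_derivative sqrt c / (1 + (?k * y)\<^sup>2)) (at y within {0..1})"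
      by (simp add: has_real_derivative_iff_has_vector_derivative)
  qed simp
  then have I: "((\<lambda>y. sqrt c / (1 + (?k * y)\<^sup>2)) has_integral arctan ?k / sqrt \<mu>) {0..1}" by simp
  have "sqrt c * integral {0..1} (\<lambda>y. exp (- \<mu> * c * y\<^sup>2)) = integral {0..1} (\<lambda>y. sqrt c * exp (- \<mu> * c * y\<^sup>2))"
    by simp
  also have "\<dots> \<le> integral {0..1} (\<lambda>y. sqrt c / (1 + (?k * y)\<^sup>2))"
  proof (rule integral_le, goal_cases)
    case 2
    show "(\<lambda>y. sqrt c / (1 + (?k * y)\<^sup>2)) integrable_on {0..1}"
      by (rule has_integral_integrable[OF I])
  next
    case (3 y)
    have "1 + (?k * y)\<^sup>2 \<le> exp ((?k * y)\<^sup>2)" by (rule exp_ge_add_one_self)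
    then have "exp (- ((?k * y)\<^sup>2)) \<le> 1 / (1 + (?k * y)\<^sup>2)"
      by (simp add: exp_minus divide_simps add_pos_nonneg)
    moreover have "- \<mu> * c * y\<^sup>2 = - ((?k * y)\<^sup>2)" by (simp only: power_mult_distrib k2)
    ultimately have "sqrt c * exp (- \<mu> * c * y\<^sup>2) \<le> sqrt c * (1 / (1 + (?k * y)\<^sup>2))"
      using assms by (metis mult_left_mono real_sqrt_ge_zero)
    then show "sqrt c * exp (- \<mu> * c * y\<^sup>2) \<le> sqrt c / (1 + (?k * y)\<^sup>2)" by simp
  qed (intro integrable_continuous_interval continuous_intros)
  also have "\<dots> = arctan ?k / sqrt \<mu>" using I by (rule integral_unique)
  also have "\<dots> \<le> pi / 2 / sqrt \<mu>"
    using assms arctan_ubound[of ?k] by (intro divide_right_mono) auto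
  finally show ?thesis .
qed

text \<open>
  This is half the integral of \<open>(t - \<tau>) powr (-1/2) k(t, \<tau>) q(\<tau>)\<close> over \<open>[a, t]\<close> after the substitution
  \<open>\<tau> = a + (t - a) (1 - y\<^sup>2)\<close>, with \<open>K t y = k(t, \<tau>)\<close>. It has no singularity, and \<open>\<tau>\<close> depends on \<open>t\<close> only through a
  rescaling about \<open>a\<close>.
\<close>

definition volterra :: "real \<Rightarrow> (real \<Rightarrow> real \<Rightarrow> real) \<Rightarrow> (real \<Rightarrow> real) \<Rightarrow> real \<Rightarrow> real" where
  "volterra a K q t = sqrt (t - a) * integral {0..1} (\<lambda>y. K t y * q (a + (t - a) * (1 - y\<^sup>2)))"

lemma lag_range: "(\<lambda>y. 1 - y\<^sup>2) ` {0..1} \<subseteq> {0..1::real}"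
  by (auto simp: power_le_one)

lemma continuous_on_volterra_integrand:
  fixes K :: "real \<Rightarrow> real \<Rightarrow> real" and q :: "real \<Rightarrow> real"
  assumes "continuous_on ({a..T} \<times> {0..1}) (\<lambda>p. K (fst p) (snd p))" "continuous_on {a..T} q"
  shows "continuous_on ({a..T} \<times> {0..1}) (\<lambda>p. K (fst p) (snd p) * q (a + (fst p - a) * (1 - (snd p)\<^sup>2)))"
  by (rule continuous_on_mult[OF assms(1) continuous_on_scale_comp[OF assms(2) _ lag_range]])
    (intro continuous_intros)

text \<open>
  The value of \<open>\<mu>\<close> makes the operator a contraction with factor 1/4. A factor 1/2 would give convergence of the
  iterates; the smaller one leaves room for the extra term in the iteration of the derivatives.
\<close>

lemma volterra_bound:
  assumes "a \<le> T" and K: "continuous_on ({a..T} \<times> {0..1}) (\<lambda>p. K (fst p) (snd p))" and q: "continuous_on {a..T} q"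
    and M: "\<And>t y. t \<in> {a..T} \<Longrightarrow> y \<in> {0..1} \<Longrightarrow> \<bar>K t y\<bar> \<le> M" and "M > 0"
    and N: "\<And>t. t \<in> {a..T} \<Longrightarrow> \<bar>q t\<bar> \<le> N * exp (\<mu> * (t - a))"
    and \<mu>: "\<mu> = (2 * pi * M)\<^sup>2" and t: "t \<in> {a..T}"
  shows "\<bar>volterra a K q t\<bar> \<le> N / 4 * exp (\<mu> * (t - a))"
proof -
  have \<mu>0: "\<mu> > 0" and s\<mu>: "sqrt \<mu> = 2 * pi * M" using \<open>M > 0\<close> by (auto simp: \<mu>)
  have "\<bar>q a\<bar> \<le> N * exp (\<mu> * (a - a))" by (rule N) (use \<open>a \<le> T\<close> in auto)
  then have N0: "N \<ge> 0" by simp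
  let ?f = "\<lambda>y. K t y * q (a + (t - a) * (1 - y\<^sup>2))"
  have int: "?f integrable_on {0..1}"
    by (rule integrable_on_section[OF continuous_on_volterra_integrand[OF K q] t])
  have "norm (integral {0..1} ?f) \<le> integral {0..1} (\<lambda>y. M * N * exp (\<mu> * (t - a)) * exp (- \<mu> * (t - a) * y\<^sup>2))"
  proof (rule integral_norm_bound_integral[OF int])
    fix y :: real assume y: "y \<in> {0..1}"
    have "a + (t - a) * (1 - y\<^sup>2) \<in> {a..T}"
      using y by (intro scale_mem[OF t]) (auto simp: power_le_one)
    from N[OF this] have "\<bar>q (a + (t - a) * (1 - y\<^sup>2))\<bar> \<le> N * (exp (\<mu> * (t - a)) * exp (- \<mu> * (t - a) * y\<^sup>2))"
      by (simp add: exp_add[symmetric] algebra_simps)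
    then show "norm (?f y) \<le> M * N * exp (\<mu> * (t - a)) * exp (- \<mu> * (t - a) * y\<^sup>2)"
      using mult_mono[OF M[OF t y]] \<open>M > 0\<close> by (simp add: abs_mult mult.assoc)
  qed (intro integrable_continuous_interval continuous_intros)
  then have "\<bar>integral {0..1} ?f\<bar> \<le> M * N * exp (\<mu> * (t - a)) * integral {0..1} (\<lambda>y. exp (- \<mu> * (t - a) * y\<^sup>2))"
    by simp
  then have "\<bar>volterra a K q t\<bar> \<le> sqrt (t - a) * (M * N * exp (\<mu> * (t - a)) * integral {0..1} (\<lambda>y. exp (- \<mu> * (t - a) * y\<^sup>2)))"
    using t by (simp add: volterra_def abs_mult mult_left_mono)
  also have "\<dots> = M * N * exp (\<mu> * (t - a)) * (sqrt (t - a) * integral {0..1} (\<lambda>y. exp (- \<mu> * (t - a) * y\<^sup>2)))"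
    by simp
  also have "\<dots> \<le> M * N * exp (\<mu> * (t - a)) * (pi / 2 / sqrt \<mu>)"
    using t \<mu>0 N0 \<open>M > 0\<close> by (intro mult_left_mono sqrt_mult_integral_exp_le) auto
  also have "\<dots> = N / 4 * exp (\<mu> * (t - a))" using \<open>M > 0\<close> by (simp add: s\<mu>)
  finally show ?thesis .
qed

lemma continuous_on_volterra:
  fixes K :: "real \<Rightarrow> real \<Rightarrow> real" and q :: "real \<Rightarrow> real"
  assumes "continuous_on ({a..T} \<times> {0..1}) (\<lambda>p. K (fst p) (snd p))" "continuous_on {a..T} q"
  shows "continuous_on {a..T} (volterra a K q)"
proof -
  let ?B = "\<lambda>t (p::real\<times>real). K t (snd p) * q (a + (t - a) * (1 - (snd p)\<^sup>2))"
  have "continuous_on ({a..T} \<times> ({0::real} \<times> {0..1})) (\<lambda>p. ?B (fst p) (snd p))"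
    by (rule continuous_on_compose2[OF continuous_on_volterra_integrand[OF assms], of _ "\<lambda>p. (fst p, snd (snd p))", simplified])
      (auto intro!: continuous_intros)
  from continuous_on_integral_param[OF this]
  have "continuous_on {a..T} (\<lambda>t. integral {0..1} (\<lambda>y. K t y * q (a + (t - a) * (1 - y\<^sup>2))))"
    by (subst continuous_on_fun_iff[symmetric]) simp
  then show ?thesis unfolding volterra_def by (intro continuous_intros)
qed

lemma cdiff_volterra:
  assumes "cdiff n (\<lambda>t. t - a) {a..T} {0..1} K" "cdiff_fun n (\<lambda>t. t - a) {a..T} q"
  shows "cdiff_fun n (\<lambda>t. t - a) {a..T} (volterra a K q)"
proof -
  have "cdiff n (\<lambda>t. t - a) {a..T} {0..1} (\<lambda>t y. K t y * q (a + (t - a) * (1 - y\<^sup>2)))"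
    by (rule cdiff_mult[OF assms(1) cdiff_scale_comp[OF assms(2) _ lag_range]])
      (intro continuous_intros)
  then have "cdiff n (\<lambda>t. t - a) {a..T} ({0::real} \<times> {0..1}) (\<lambda>t p. K t (snd p) * q (a + (t - a) * (1 - (snd p)\<^sup>2)))"
    by (rule cdiff_param) (auto intro!: continuous_intros)
  then have "cdiff_fun n (\<lambda>t. t - a) {a..T} (\<lambda>t. integral {0..1} (\<lambda>y. K t y * q (a + (t - a) * (1 - y\<^sup>2))))"
    by (drule_tac cdiff_integral) (auto intro!: continuous_intros)
  moreover have "cdiff_fun n (\<lambda>t. t - a) {a..T} (\<lambda>t. sqrt (t - a))"
    by (rule cdiff_sqrt) auto
  ultimately show ?thesis unfolding volterra_def by (intro cdiff_mult)
qed

text \<open>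
  The term \<open>K / 2\<close> comes from the prefactor \<open>sqrt (t - a)\<close>.
\<close>

lemma volterra_deriv:
  fixes K :: "real \<Rightarrow> real \<Rightarrow> real" and q :: "real \<Rightarrow> real"
  assumes K: "continuous_on ({a..T} \<times> {0..1}) (\<lambda>p. K (fst p) (snd p))" "deriv_along (\<lambda>t. t - a) {a..T} {0..1} K K'"
      "continuous_on ({a..T} \<times> {0..1}) (\<lambda>p. K' (fst p) (snd p))"
    and q: "continuous_on {a..T} q" "continuous_on {a..T} q'" "q' a = 0"
     "\<And>t. t \<in> {a..T} \<Longrightarrow> t - a \<noteq> 0 \<Longrightarrow> (q has_real_derivative q' t / (t - a)) (at t within {a..T})"
    and t: "t \<in> {a..T}" "t - a \<noteq> 0"
  shows "(volterra a K q has_real_derivative (volterra a (\<lambda>t y. K t y / 2 + K' t y) q t + volterra a K q' t) / (t - a)) (at t within {a..T})"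
proof -
  let ?B = "\<lambda>t y. K t y * q (a + (t - a) * (1 - y\<^sup>2))"
  let ?B' = "\<lambda>t y. K' t y * q (a + (t - a) * (1 - y\<^sup>2)) + K t y * q' (a + (t - a) * (1 - y\<^sup>2))"
  have d: "deriv_along (\<lambda>t. t - a) {a..T} {0..1} ?B ?B'"
    by (rule deriv_along_mult[OF K(2) deriv_along_scale_comp[OF q(4,3) lag_range]])
  have cB: "continuous_on ({a..T} \<times> {0..1}) (\<lambda>p. ?B (fst p) (snd p))"
    by (rule continuous_on_volterra_integrand[OF K(1) q(1)])
  have cB': "continuous_on ({a..T} \<times> {0..1}) (\<lambda>p. ?B' (fst p) (snd p))"
    by (intro continuous_on_add continuous_on_volterra_integrand K q)
  have lift: "continuous_on ({a..T} \<times> ({0::real} \<times> {0..1})) (\<lambda>p. B (fst p) (snd (snd p)))"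
    if "continuous_on ({a..T} \<times> {0..1}) (\<lambda>p. B (fst p) (snd p))" for B :: "real \<Rightarrow> real \<Rightarrow> real"
    by (rule continuous_on_compose2[OF that, of _ "\<lambda>p. (fst p, snd (snd p))", simplified])
      (auto intro!: continuous_intros)
  have "deriv_along (\<lambda>t. t - a) {a..T} ({0::real} \<times> {0..1}) (\<lambda>t p. ?B t (snd p)) (\<lambda>t p. ?B' t (snd p))"
  proof (intro ballI)
    fix r and p :: "real \<times> real" assume "r \<in> {a..T}" "p \<in> {0} \<times> {0..1}"
    then show "(r - a \<noteq> 0 \<longrightarrow> ((\<lambda>t. ?B t (snd p)) has_real_derivative ?B' r (snd p) / (r - a)) (at r within {a..T})) \<and>
       (r - a = 0 \<longrightarrow> ?B' r (snd p) = 0)"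
      by (intro bspec[OF bspec[OF d]]) auto
  qed
  from deriv_along_integral[OF this lift[OF cB] lift[OF cB'] convex_real_interval(5)
    continuous_on_diff[OF continuous_on_id continuous_on_const]] t
  have "((\<lambda>t. integral {0..1} (?B t)) has_real_derivative integral {0..1} (?B' t) / (t - a)) (at t within {a..T})"
    by auto
  moreover have "((\<lambda>t. sqrt (t - a)) has_real_derivative 1 / (2 * sqrt (t - a))) (at t within {a..T})"
    using t by (auto intro!: derivative_eq_intros simp: field_simps)
  ultimately have "(volterra a K q has_real_derivative 1 / (2 * sqrt (t - a)) * integral {0..1} (?B t) +
      integral {0..1} (?B' t) / (t - a) * sqrt (t - a)) (at t within {a..T})"
    unfolding volterra_def by (rule DERIV_mult[rotated])
  also have "1 / (2 * sqrt (t - a)) * integral {0..1} (?B t) + integral {0..1} (?B' t) / (t - a) * sqrt (t - a) =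
     (sqrt (t - a) * (integral {0..1} (?B t) / 2 + integral {0..1} (?B' t))) / (t - a)"
  proof -
    obtain R where R: "R > 0" "t - a = R\<^sup>2" using t by (intro that[of "sqrt (t - a)"]) auto
    show ?thesis unfolding R(2) using R(1) by (simp add: field_simps power2_eq_square)
  qed
  also have "integral {0..1} (?B t) / 2 + integral {0..1} (?B' t) = integral {0..1} (\<lambda>y. ?B t y / 2 + ?B' t y)"
    using integrable_on_section[OF cB t(1)] integrable_on_section[OF cB' t(1)]
    by (subst integral_add) (auto intro: integrable_on_divide)
  also have "(\<lambda>y. ?B t y / 2 + ?B' t y) = (\<lambda>y. (K t y / 2 + K' t y) * q (a + (t - a) * (1 - y\<^sup>2)) + K t y * q' (a + (t - a) * (1 - y\<^sup>2)))"
    by (intro ext) (simp add: algebra_simps)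
  also have "integral {0..1} \<dots> = integral {0..1} (\<lambda>y. (K t y / 2 + K' t y) * q (a + (t - a) * (1 - y\<^sup>2))) +
       integral {0..1} (\<lambda>y. K t y * q' (a + (t - a) * (1 - y\<^sup>2)))"
    by (intro integral_add integrable_on_section[OF continuous_on_volterra_integrand t(1), of "\<lambda>t y. K t y / 2 + K' t y"]
       integrable_on_section[OF continuous_on_volterra_integrand t(1), of K] continuous_intros K q) auto
  finally show ?thesis by (simp add: volterra_def[abs_def] distrib_left)
qed

lemma volterra_add:
  assumes "continuous_on ({a..T} \<times> {0..1}) (\<lambda>p. K (fst p) (snd p))" "continuous_on {a..T} q" "continuous_on {a..T} r"
    and t: "t \<in> {a..T}"
  shows "volterra a K (\<lambda>t. q t + r t) t = volterra a K q t + volterra a K r t"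
proof -
  have "integral {0..1} (\<lambda>y. K t y * q (a + (t - a) * (1 - y\<^sup>2)) + K t y * r (a + (t - a) * (1 - y\<^sup>2))) =
    integral {0..1} (\<lambda>y. K t y * q (a + (t - a) * (1 - y\<^sup>2))) + integral {0..1} (\<lambda>y. K t y * r (a + (t - a) * (1 - y\<^sup>2)))"
    by (intro integral_add integrable_on_section[OF continuous_on_volterra_integrand[OF assms(1)] t] assms)
  then show ?thesis by (simp add: volterra_def distrib_left)
qed

lemma volterra_cong:
  assumes "\<And>t. t \<in> {a..T} \<Longrightarrow> q t = r t" "t \<in> {a..T}"
  shows "volterra a K q t = volterra a K r t"
proof -
  have "q (a + (t - a) * (1 - y\<^sup>2)) = r (a + (t - a) * (1 - y\<^sup>2))" if "y \<in> {0..1}" for y :: real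
    using that by (intro assms(1) scale_mem[OF assms(2)]) (auto simp: power_le_one)
  then show ?thesis unfolding volterra_def by (intro arg_cong[of _ _ "\<lambda>x. sqrt (t - a) * x"] integral_cong) simp
qed

text \<open>
  One derivative along the scaling field. The solution is the Neumann series of the iterates \<open>d n\<close> of \<open>F\<close>. Their
  derivatives \<open>d' n\<close> satisfy \<open>d' (n + 1) = V d' n + V' (d n)\<close>, where \<open>V'\<close> has the differentiated kernel, so they
  decay geometrically as well and the series may be differentiated term by term. The derivative of \<open>q\<close> solves an
  equation with the same kernel, which allows induction on the order.
\<close>

lemma volterra_C1:
  fixes K K' :: "real \<Rightarrow> real \<Rightarrow> real" and q F F' :: "real \<Rightarrow> real"
  assumes "a < T"
    and K: "continuous_on ({a..T} \<times> {0..1}) (\<lambda>p. K (fst p) (snd p))" "deriv_along (\<lambda>t. t - a) {a..T} {0..1} K K'"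
      "continuous_on ({a..T} \<times> {0..1}) (\<lambda>p. K' (fst p) (snd p))"
    and F: "continuous_on {a..T} F" "continuous_on {a..T} F'" "F' a = 0"
     "\<And>t. t \<in> {a..T} \<Longrightarrow> t - a \<noteq> 0 \<Longrightarrow> (F has_real_derivative F' t / (t - a)) (at t within {a..T})"
    and q: "continuous_on {a..T} q" "\<And>t. t \<in> {a..T} \<Longrightarrow> q t = volterra a K q t + F t"
  obtains q' where "continuous_on {a..T} q'" "q' a = 0"
    "\<And>t. t \<in> {a..T} \<Longrightarrow> t - a \<noteq> 0 \<Longrightarrow> (q has_real_derivative q' t / (t - a)) (at t within {a..T})"
    "\<And>t. t \<in> {a..T} \<Longrightarrow> q' t = volterra a K q' t + (volterra a (\<lambda>t y. K t y / 2 + K' t y) q t + F' t)"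
proof -
  define H where "H = (\<lambda>t y. K t y / 2 + K' t y)"
  have H: "continuous_on ({a..T} \<times> {0..1}) (\<lambda>p. H (fst p) (snd p))"
    unfolding H_def by (intro continuous_intros K) auto
  have bounded: "\<exists>B. \<forall>x\<in>S. \<bar>f x\<bar> \<le> B" if "compact S" "continuous_on S f" for S :: "'z::topological_space set" and f :: "'z \<Rightarrow> real"
    using compact_imp_bounded[OF compact_continuous_image[OF that(2,1)]] by (auto simp: bounded_iff)
  have cp: "compact ({a..T} \<times> {0..1::real})" by (intro compact_Times compact_Icc)
  obtain M1 where M1: "\<forall>p\<in>{a..T} \<times> {0..1}. \<bar>K (fst p) (snd p)\<bar> \<le> M1" using bounded[OF cp K(1)] by blast
  obtain M2 where M2: "\<forall>p\<in>{a..T} \<times> {0..1}. \<bar>H (fst p) (snd p)\<bar> \<le> M2" using bounded[OF cp H] by blast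
  define M where "M = max 1 (max M1 M2)"
  have M1': "\<bar>K t y\<bar> \<le> M1" and M2': "\<bar>H t y\<bar> \<le> M2" if "t \<in> {a..T}" "y \<in> {0..1}" for t y
    using that bspec[OF M1, of "(t, y)"] bspec[OF M2, of "(t, y)"] by auto
  have M: "M > 0" "\<And>t y. t \<in> {a..T} \<Longrightarrow> y \<in> {0..1} \<Longrightarrow> \<bar>K t y\<bar> \<le> M"
      "\<And>t y. t \<in> {a..T} \<Longrightarrow> y \<in> {0..1} \<Longrightarrow> \<bar>H t y\<bar> \<le> M"
    unfolding M_def using M1' M2' by (auto simp: le_max_iff_disj)
  obtain N1 where N1: "\<forall>t\<in>{a..T}. \<bar>F t\<bar> \<le> N1" using bounded[OF compact_Icc F(1)] by blast
  obtain N2 where N2: "\<forall>t\<in>{a..T}. \<bar>F' t\<bar> \<le> N2" using bounded[OF compact_Icc F(2)] by blast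
  obtain N3 where N3: "\<forall>t\<in>{a..T}. \<bar>q t\<bar> \<le> N3" using bounded[OF compact_Icc q(1)] by blast
  define N where "N = max 0 (max N1 (max N2 N3))"
  have N: "N \<ge> 0" "\<And>t. t \<in> {a..T} \<Longrightarrow> \<bar>F t\<bar> \<le> N" "\<And>t. t \<in> {a..T} \<Longrightarrow> \<bar>F' t\<bar> \<le> N" "\<And>t. t \<in> {a..T} \<Longrightarrow> \<bar>q t\<bar> \<le> N"
    using N1 N2 N3 by (fastforce simp: N_def)+
  define \<mu> where "\<mu> = (2 * pi * M)\<^sup>2"
  have \<mu>0: "\<mu> > 0" using M(1) by (simp add: \<mu>_def)
  define E where "E = (\<lambda>t. exp (\<mu> * (t - a)))"
  have E1: "1 \<le> E t" if "t \<in> {a..T}" for t using that \<mu>0 by (simp add: E_def)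
  have E2: "E t \<le> E T" if "t \<in> {a..T}" for t using that \<mu>0 by (simp add: E_def)
  have bK: "\<bar>volterra a K f t\<bar> \<le> B / 4 * E t" and bH: "\<bar>volterra a H f t\<bar> \<le> B / 4 * E t"
    if "continuous_on {a..T} f" "\<And>t. t \<in> {a..T} \<Longrightarrow> \<bar>f t\<bar> \<le> B * E t" "t \<in> {a..T}" for f B t
    unfolding E_def
    using that \<open>a < T\<close> M by (intro volterra_bound[OF _ _ that(1)] K H; auto simp: E_def \<mu>_def)+
  \<comment> \<open>\<open>d n\<close> and \<open>d' n\<close> are the terms of the series and their derivatives; \<open>e n\<close> is the remainder \<open>V\<^sup>n q\<close>.\<close>
  define d where "d = rec_nat F (\<lambda>_. volterra a K)"
  have d_simps: "d 0 = F" "d (Suc n) = volterra a K (d n)" for n by (simp_all add: d_def)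
  define d' where "d' = rec_nat F' (\<lambda>n f t. volterra a H (d n) t + volterra a K f t)"
  have d'_simps: "d' 0 = F'" "d' (Suc n) = (\<lambda>t. volterra a H (d n) t + volterra a K (d' n) t)" for n by (simp_all add: d'_def)
  define e where "e = rec_nat q (\<lambda>_. volterra a K)"
  have e_simps: "e 0 = q" "e (Suc n) = volterra a K (e n)" for n by (simp_all add: e_def)
  have cd: "continuous_on {a..T} (d n)" for n
    by (induction n) (auto simp: d_simps intro: F continuous_on_volterra K)
  have ce: "continuous_on {a..T} (e n)" for n
    by (induction n) (auto simp: e_simps intro: q continuous_on_volterra K)
  have cd': "continuous_on {a..T} (d' n)" for n
    by (induction n) (auto simp: d'_simps intro!: F continuous_on_volterra K H cd continuous_on_add)
  have d'a: "d' n a = 0" for n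
    by (cases n) (simp_all add: d'_simps F volterra_def)
  have dd: "(d n has_real_derivative d' n t / (t - a)) (at t within {a..T})" if "t \<in> {a..T}" "t - a \<noteq> 0" for n t
    using that
  proof (induction n arbitrary: t)
    case 0
    then show ?case by (simp add: d_simps d'_simps F)
  next
    case (Suc n)
    show ?case unfolding d_simps d'_simps H_def
      by (rule volterra_deriv[OF K cd cd' d'a Suc.IH Suc.prems])
  qed
  have bd: "\<bar>d n t\<bar> \<le> N * (1/4) ^ n * E t" if "t \<in> {a..T}" for n t
    using that
  proof (induction n arbitrary: t)
    case 0
    have "N * 1 \<le> N * E t" using E1[OF 0] N(1) by (intro mult_left_mono)
    with N(2)[OF 0] show ?case by (simp add: d_simps)
  next
    case (Suc n)
    from bK[OF cd Suc.IH Suc.prems] show ?case by (simp add: d_simps)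
  qed
  have be: "\<bar>e n t\<bar> \<le> N * (1/4) ^ n * E t" if "t \<in> {a..T}" for n t
    using that
  proof (induction n arbitrary: t)
    case 0
    have "N * 1 \<le> N * E t" using E1[OF 0] N(1) by (intro mult_left_mono)
    with N(4)[OF 0] show ?case by (simp add: e_simps)
  next
    case (Suc n)
    from bK[OF ce Suc.IH Suc.prems] show ?case by (simp add: e_simps)
  qed
  have bd': "\<bar>d' n t\<bar> \<le> N * (1/2) ^ n * E t" if "t \<in> {a..T}" for n t
    using that
  proof (induction n arbitrary: t)
    case 0
    have "N * 1 \<le> N * E t" using E1[OF 0] N(1) by (intro mult_left_mono)
    with N(3)[OF 0] show ?case by (simp add: d'_simps)
  next
    case (Suc n)
    have "\<bar>d' (Suc n) t\<bar> \<le> N * (1/4) ^ n / 4 * E t + N * (1/2) ^ n / 4 * E t"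
      using bK[OF cd' Suc.IH Suc.prems] bH[OF cd bd Suc.prems, of n] by (simp add: d'_simps)
    also have "N * (1/4) ^ n / 4 * E t \<le> N * (1/2) ^ n / 4 * E t"
      using N(1) E1[OF Suc.prems] by (intro mult_right_mono divide_right_mono mult_left_mono power_mono) auto
    finally show ?case by (simp add: mult_ac)
  qed
  have split: "q t = (\<Sum>i<n. d i t) + e n t" if "t \<in> {a..T}" for n t
    using that
  proof (induction n arbitrary: t)
    case 0
    then show ?case by (simp add: e_simps)
  next
    case (Suc n)
    have "e n t = e (Suc n) t + d n t" if "t \<in> {a..T}" for t
      using that
    proof (induction n arbitrary: t)
      case 0
      then show ?case using q(2) by (simp add: e_simps d_simps)
    next
      case (Suc n)
      have "e (Suc n) t = volterra a K (\<lambda>t. e (Suc n) t + d n t) t"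
        unfolding e_simps(2)[of n] by (rule volterra_cong[OF _ Suc.prems]) (use Suc.IH in \<open>simp add: e_simps\<close>)
      also have "\<dots> = e (Suc (Suc n)) t + d (Suc n) t"
        by (subst volterra_add[OF K(1) ce cd Suc.prems]) (simp add: e_simps(2)[of "Suc n"] d_simps(2)[of n])
      finally show ?case .
    qed
    from this[OF Suc.prems] Suc.IH[OF Suc.prems] show ?case by simp
  qed
  have sums: "(\<lambda>n. d n t) sums q t" if "t \<in> {a..T}" for t
  proof -
    have "(\<lambda>n. N * E t * (1/4) ^ n) \<longlonglongrightarrow> 0"
      by (intro tendsto_mult_right_zero LIMSEQ_power_zero) simp
    then have "(\<lambda>n. e n t) \<longlonglongrightarrow> 0"
      by (rule Lim_null_comparison[rotated]) (use be[OF that] in \<open>simp add: mult_ac\<close>)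
    then have "(\<lambda>n. q t - e n t) \<longlonglongrightarrow> q t - 0" by (intro tendsto_intros)
    moreover have "(\<lambda>n. q t - e n t) = (\<lambda>n. \<Sum>i<n. d i t)"
    proof
      fix n show "q t - e n t = (\<Sum>i<n. d i t)" using split[OF that, of n] by linarith
    qed
    ultimately show ?thesis by (simp add: sums_def)
  qed
  define q' where "q' = (\<lambda>t. \<Sum>n. d' n t)"
  have summ: "summable (\<lambda>n. N * (1/2) ^ n * C)" for C :: real
    by (intro summable_mult summable_mult2 summable_geometric) simp
  have bd'T: "norm (d' n t) \<le> N * (1/2) ^ n * E T" if "t \<in> {a..T}" for n t
    using bd'[OF that, of n] mult_left_mono[OF E2[OF that], of "N * (1/2) ^ n"] N(1) by simp
  have ul: "uniform_limit {a..T} (\<lambda>n t. \<Sum>i<n. d' i t) q' sequentially"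
    unfolding q'_def by (rule Weierstrass_m_test[OF bd'T summ])
  have cq': "continuous_on {a..T} q'"
    by (rule uniform_limit_theorem[OF _ ul]) (auto intro!: always_eventually continuous_on_sum cd')
  have q'a: "q' a = 0" by (simp add: q'_def d'a)
  \<comment> \<open>The true derivatives \<open>d' n t / (t - a)\<close> converge uniformly only away from \<open>a\<close>, hence the cut at \<open>c\<close>.\<close>
  have dq: "(q has_real_derivative q' t / (t - a)) (at t within {a..T})" if t: "t \<in> {a..T}" "t - a \<noteq> 0" for t
  proof -
    define c where "c = (a + t) / 2"
    have c: "a < c" "c < t" using t by (auto simp: c_def)
    have S: "{c..T} \<subseteq> {a..T}" using c by auto
    have "uniform_limit {c..T} (\<lambda>n x. \<Sum>i<n. d' i x / (x - a)) (\<lambda>x. \<Sum>i. d' i x / (x - a)) sequentially"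
    proof (rule Weierstrass_m_test[OF _ summ])
      fix n x assume x: "x \<in> {c..T}"
      have "norm (d' n x) / (x - a) \<le> (N * (1/2) ^ n * E T) / (c - a)"
        using bd'T[of x n] x S c N(1) by (intro frac_le) (auto simp: E_def)
      then show "norm (d' n x / (x - a)) \<le> N * (1/2) ^ n * (E T / (c - a))"
        using x c by simp
    qed
    also have "?this \<longleftrightarrow> uniform_limit {c..T} (\<lambda>n x. \<Sum>i<n. d' i x / (x - a)) (\<lambda>x. q' x / (x - a)) sequentially"
    proof (rule uniform_limit_cong'[OF refl])
      show "(\<Sum>i. d' i x / (x - a)) = q' x / (x - a)" if "x \<in> {c..T}" for x
    proof -
      have "summable (\<lambda>n. d' n x)"
        by (rule summable_comparison_test'[OF summ bd'T]) (use that S in auto)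
      then show ?thesis unfolding q'_def by (rule suminf_divide)
    qed
    qed
    finally have "uniform_limit {c..T} (\<lambda>n x. \<Sum>i<n. d' i x / (x - a)) (\<lambda>x. q' x / (x - a)) sequentially" .
    moreover have "(d n has_real_derivative d' n x / (x - a)) (at x within {c..T})" if "x \<in> {c..T}" for n x
      by (rule DERIV_subset[OF dd S]) (use that c in auto)
    ultimately have "\<exists>g. \<forall>x\<in>{c..T}. (\<lambda>n. d n x) sums g x \<and> (g has_real_derivative q' x / (x - a)) (at x within {c..T})"
      using sums[of t] t c by (intro has_field_derivative_series[of _ _ _ _ t]) (auto intro: sums_summable)
    then obtain g where g: "\<And>x. x \<in> {c..T} \<Longrightarrow> (\<lambda>n. d n x) sums g x"
       "\<And>x. x \<in> {c..T} \<Longrightarrow> (g has_real_derivative q' x / (x - a)) (at x within {c..T})" by blast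
    have "g x = q x" if "x \<in> {c..T}" for x using g(1)[OF that] sums[of x] that S sums_unique2 by blast
    then have "(q has_real_derivative q' t / (t - a)) (at t within {c..T})"
      using t c by (intro has_field_derivative_transform_within[OF g(2), of t 1]) auto
    moreover have "at t within {c..T} = at t within {a..T}"
      using c by (intro at_within_nhd[of _ "{c<..}"]) auto
    ultimately show ?thesis by simp
  qed
  have eq: "q' t = volterra a K q' t + (volterra a H q t + F' t)" if t: "t \<in> {a..T}" for t
  proof (cases "t = a")
    case True
    then show ?thesis by (simp add: q'a F volterra_def)
  next
    case False
    then have nz: "t - a \<noteq> 0" by simp
    have "((\<lambda>t. volterra a K q t + F t) has_real_derivative (volterra a H q t + volterra a K q' t) / (t - a) + F' t / (t - a)) (at t within {a..T})"
      unfolding H_def by (intro DERIV_add volterra_deriv[OF K q(1) cq' q'a dq t nz] F(4) t nz)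
    then have "(q has_real_derivative (volterra a H q t + volterra a K q' t) / (t - a) + F' t / (t - a)) (at t within {a..T})"
      by (rule has_field_derivative_transform_within[of _ _ _ _ 1]) (use t q(2) in auto)
    moreover have "at t within {a..T} \<noteq> bot" using t \<open>a < T\<close> by (simp add: trivial_limit_within)
    ultimately have "q' t / (t - a) = (volterra a H q t + volterra a K q' t) / (t - a) + F' t / (t - a)"
      using has_field_derivative_unique[OF dq[OF t nz]] by blast
    then have "q' t / (t - a) = (volterra a H q t + volterra a K q' t + F' t) / (t - a)"
      by (simp only: add_divide_distrib)
    then show ?thesis using nz by simp
  qed
  show ?thesis using that[OF cq' q'a dq] eq unfolding H_def by blast
qed

theorem volterra_regularity:
  assumes "a < T" "cdiff n (\<lambda>t. t - a) {a..T} {0..1} K" "cdiff_fun n (\<lambda>t. t - a) {a..T} F"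
    "continuous_on {a..T} q" "\<And>t. t \<in> {a..T} \<Longrightarrow> q t = volterra a K q t + F t"
  shows "cdiff_fun n (\<lambda>t. t - a) {a..T} q"
  using assms(2-)
proof (induction n arbitrary: q F)
  case 0
  then show ?case by (simp add: continuous_on_fun_iff)
next
  case (Suc n)
  from Suc.prems(1) obtain K' where K': "deriv_along (\<lambda>t. t - a) {a..T} {0..1} K K'"
     "continuous_on ({a..T} \<times> {0..1}) (\<lambda>p. K (fst p) (snd p))" "cdiff n (\<lambda>t. t - a) {a..T} {0..1} K'"
    by (rule cdiff_SucE)
  from cdiff_fun_SucE[OF Suc.prems(2)] obtain F' where F': "\<And>t. t \<in> {a..T} \<Longrightarrow> t - a \<noteq> 0 \<Longrightarrow> (F has_real_derivative F' t / (t - a)) (at t within {a..T})"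
    "\<And>t. t \<in> {a..T} \<Longrightarrow> t - a = 0 \<Longrightarrow> F' t = 0" "cdiff_fun n (\<lambda>t. t - a) {a..T} F'" by blast
  have F'a: "F' a = 0" using F'(2)[of a] \<open>a < T\<close> by simp
  note Kn = cdiff_Suc_imp[OF Suc.prems(1)] and Fn = cdiff_Suc_imp[OF Suc.prems(2)]
  obtain q' where q': "continuous_on {a..T} q'" "q' a = 0"
    "\<And>t. t \<in> {a..T} \<Longrightarrow> t - a \<noteq> 0 \<Longrightarrow> (q has_real_derivative q' t / (t - a)) (at t within {a..T})"
    "\<And>t. t \<in> {a..T} \<Longrightarrow> q' t = volterra a K q' t + (volterra a (\<lambda>t y. K t y / 2 + K' t y) q t + F' t)"
    using volterra_C1[OF \<open>a < T\<close> K'(2,1) cdiff_cont[OF K'(3)] cdiff_fun_cont[OF Suc.prems(2)] cdiff_fun_cont[OF F'(3)] F'a F'(1) Suc.prems(3,4)]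
    by blast
  have "cdiff n (\<lambda>t. t - a) {a..T} {0..1} (\<lambda>t y. 1/2 * K t y + K' t y)"
    by (intro cdiff_add cdiff_cmult Kn K')
  then have "cdiff n (\<lambda>t. t - a) {a..T} {0..1} (\<lambda>t y. K t y / 2 + K' t y)" by simp
  moreover have "cdiff_fun n (\<lambda>t. t - a) {a..T} q" by (rule Suc.IH[OF Kn Fn Suc.prems(3,4)])
  ultimately have "cdiff_fun n (\<lambda>t. t - a) {a..T} (\<lambda>t. volterra a (\<lambda>t y. K t y / 2 + K' t y) q t + F' t)"
    by (rule cdiff_add[OF cdiff_volterra F'(3)])
  then have "cdiff_fun n (\<lambda>t. t - a) {a..T} q'"
    using Suc.IH[OF Kn _ q'(1,4)] by blast
  then show ?case using q'(2,3) Suc.prems(3) by (intro cdiff_fun_SucI[where q'=q']) auto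
qed

section \<open>Concentration of Gaussian kernels\<close>

text \<open>
  The self-similar profiles of the kernels of degree \<open>-1\<close>, that is of \<open>gauss i (i + 1)\<close>.
\<close>

definition psi :: "nat \<Rightarrow> real \<Rightarrow> real" where "psi i z = z ^ i * exp (- z\<^sup>2 / 4)"

lemma gauss_eq_psi: "r > 0 \<Longrightarrow> gauss i (i + 1) x r = psi i (x / sqrt r) / sqrt r"
  by (simp add: gauss_def psi_def power_divide mult_ac)

text \<open>
  A bound by the Cauchy density: its antiderivative is the arctangent, so Gaussian mass can be estimated on any
  interval without the value of the Gaussian integral.
\<close>

lemma psi_le: "\<bar>psi i z\<bar> \<le> (2 * 4 ^ (i + 1) * fact (i + 1)) / (1 + z\<^sup>2)"
proof -
  let ?N = "i + 1"
  have pos: "1 + z\<^sup>2 > 0" by (simp add: add_pos_nonneg)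
  have "\<bar>z\<bar> ^ i * (1 + z\<^sup>2) * exp (- z\<^sup>2 / 4) \<le> 2 * 4 ^ ?N * fact ?N"
  proof (cases "\<bar>z\<bar> \<le> 1")
    case True
    have "\<bar>z\<bar> ^ i * (1 + z\<^sup>2) * exp (- z\<^sup>2 / 4) \<le> 1 * (1 + 1) * 1"
    proof (intro mult_mono)
      show "\<bar>z\<bar> ^ i \<le> 1" using True by (simp add: power_le_one)
      show "1 + z\<^sup>2 \<le> 1 + 1" using True by (simp add: abs_square_le_1)
    qed auto
    also have "\<dots> \<le> 2 * 4 ^ ?N * fact ?N"
      using mult_mono[of 1 "4 ^ ?N" 1 "fact ?N :: real"] by (simp del: fact_Suc power_Suc add: fact_ge_1)
    finally show ?thesis .
  next
    case False
    then have "z\<^sup>2 > 0" by auto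
    then have e: "exp (- (z\<^sup>2 / 4)) \<le> fact ?N / (z\<^sup>2 / 4) ^ ?N"
      by (intro exp_minus_le_fact_over_power) simp
    have "\<bar>z\<bar> ^ i * (1 + z\<^sup>2) \<le> \<bar>z\<bar> ^ i * (2 * z\<^sup>2)"
      using False one_le_power[of "\<bar>z\<bar>" 2] by (intro mult_left_mono) auto
    also have "\<dots> = 2 * \<bar>z\<bar> ^ (i + 2)" by (simp add: power_add power2_eq_square)
    also have "\<dots> \<le> 2 * \<bar>z\<bar> ^ (2 * ?N)" using False by (intro mult_left_mono power_increasing) auto
    also have "\<dots> = 2 * (z\<^sup>2) ^ ?N" by (simp only: power_mult power2_abs)
    finally have le: "\<bar>z\<bar> ^ i * (1 + z\<^sup>2) \<le> 2 * (z\<^sup>2) ^ ?N" .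
    have "\<bar>z\<bar> ^ i * (1 + z\<^sup>2) * exp (- z\<^sup>2 / 4) \<le> 2 * (z\<^sup>2) ^ ?N * (fact ?N / (z\<^sup>2 / 4) ^ ?N)"
      unfolding minus_divide_left[symmetric] by (rule mult_mono[OF le e]) auto
    also have "\<dots> = 2 * 4 ^ ?N * fact ?N"
      using \<open>z\<^sup>2 > 0\<close> by (simp add: power_divide del: fact_Suc power_Suc)
    finally show ?thesis .
  qed
  then show ?thesis
    using pos by (simp add: psi_def abs_mult power_abs pos_le_divide_eq mult_ac del: fact_Suc power_Suc)
qed

lemma psi_antiderivative: "\<exists>G. G 0 = 0 \<and> (\<forall>z. (G has_real_derivative psi i z) (at z))"
proof -
  have "\<exists>F. \<forall>x::real. - \<infinity> < ereal x \<longrightarrow> ereal x < \<infinity> \<longrightarrow> (F has_vector_derivative psi i x) (at x)"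
    unfolding psi_def by (rule einterval_antiderivative) (auto intro!: continuous_intros)
  then obtain F where "\<And>x. (F has_vector_derivative psi i x) (at x)" by auto
  then have "((\<lambda>z. F z - F 0) has_real_derivative psi i x) (at x)" for x
    by (auto intro!: derivative_eq_intros simp: has_real_derivative_iff_has_vector_derivative)
  then show ?thesis by (intro exI[of _ "\<lambda>z. F z - F 0"]) auto
qed

definition Psi :: "nat \<Rightarrow> real \<Rightarrow> real" where
  "Psi i = (SOME G. G 0 = 0 \<and> (\<forall>z. (G has_real_derivative psi i z) (at z)))"

lemma Psi_0 [simp]: "Psi i 0 = 0" and Psi_deriv: "(Psi i has_real_derivative psi i z) (at z)"
  using someI_ex[OF psi_antiderivative[of i]] by (auto simp: Psi_def)

lemma Psi_deriv_comp:
  assumes "(g has_real_derivative g') (at x within S)"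
  shows "((\<lambda>x. Psi i (g x)) has_real_derivative psi i (g x) * g') (at x within S)"
  by (rule DERIV_chain2[OF Psi_deriv assms])

lemma isCont_Psi: "isCont (Psi i) z"
  using Psi_deriv DERIV_isCont by blast

text \<open>
  The integral of \<open>psi i\<close> over the half-line. Only its existence and, for \<open>i = 0\<close>, its positivity matter.
\<close>

definition Psi_lim :: "nat \<Rightarrow> real" where "Psi_lim i = Sup (Psi i ` {0..})"

lemma Psi_mono: "0 \<le> x \<Longrightarrow> x \<le> y \<Longrightarrow> Psi i x \<le> Psi i y"
  by (rule DERIV_nonneg_imp_nondecreasing) (auto intro!: exI Psi_deriv simp: psi_def)

lemma Psi_upper: "0 \<le> z \<Longrightarrow> Psi i z \<le> (2 * 4 ^ (i + 1) * fact (i + 1)) * pi / 2"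
proof -
  assume z: "0 \<le> z"
  let ?C = "2 * 4 ^ (i + 1) * fact (i + 1) :: real"
  have "?C * arctan 0 - Psi i 0 \<le> ?C * arctan z - Psi i z"
  proof (rule DERIV_nonneg_imp_nondecreasing[OF z])
    fix x :: real
    have "((\<lambda>x. ?C * arctan x - Psi i x) has_real_derivative ?C * inverse (1 + x\<^sup>2) - psi i x) (at x)"
      by (intro DERIV_diff DERIV_cmult DERIV_arctan Psi_deriv)
    moreover have "0 \<le> ?C * inverse (1 + x\<^sup>2) - psi i x"
      using psi_le[of i x] by (simp add: divide_inverse abs_le_iff del: fact_Suc power_Suc)
    ultimately show "\<exists>y. ((\<lambda>x. ?C * arctan x - Psi i x) has_real_derivative y) (at x) \<and> 0 \<le> y" by blast
  qed
  then have "Psi i z \<le> ?C * arctan z" by simp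
  also have "\<dots> \<le> ?C * (pi / 2)" using arctan_ubound[of z] by (intro mult_left_mono) auto
  finally show ?thesis by simp
qed

lemma bdd_above_Psi: "bdd_above (Psi i ` {0..})"
  using Psi_upper by (intro bdd_aboveI) auto

lemma Psi_le_lim: "0 \<le> z \<Longrightarrow> Psi i z \<le> Psi_lim i"
  unfolding Psi_lim_def by (intro cSup_upper bdd_above_Psi) auto

lemma Psi_tendsto: "(Psi i \<longlongrightarrow> Psi_lim i) at_top"
proof (rule increasing_tendsto)
  show "eventually (\<lambda>z. Psi i z \<le> Psi_lim i) at_top"
    using eventually_ge_at_top[of 0] by eventually_elim (rule Psi_le_lim)
  fix x assume "x < Psi_lim i"
  then obtain z where z: "z \<ge> 0" "x < Psi i z"
    unfolding Psi_lim_def using less_cSup_iff[OF _ bdd_above_Psi] by auto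
  show "eventually (\<lambda>z. x < Psi i z) at_top"
    using eventually_ge_at_top[of z] by eventually_elim (use z Psi_mono in \<open>meson less_le_trans\<close>)
qed

lemma Psi_lim_0_pos: "Psi_lim 0 > 0"
proof -
  have "Psi 0 0 < Psi 0 1"
    by (rule DERIV_pos_imp_increasing) (auto intro!: exI Psi_deriv simp: psi_def)
  then show ?thesis using Psi_le_lim[of 1 0] by simp
qed

text \<open>
  For \<open>z \<ge> 1\<close> the function \<open>Psi 0 z + 2 exp (- z\<^sup>2 / 4)\<close> decreases to its limit.
\<close>

lemma Psi_tail:
  assumes "z \<ge> 1" shows "Psi_lim 0 - Psi 0 z \<le> 2 * exp (- z\<^sup>2 / 4)"
proof -
  let ?f = "\<lambda>z. Psi 0 z + 2 * exp (- z\<^sup>2 / 4)"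
  have "filterlim (\<lambda>z::real. z\<^sup>2 / 4) at_top at_top"
    by (intro filterlim_tendsto_pos_mult_at_top[OF tendsto_const, of "1/4", simplified] filterlim_pow_at_top filterlim_ident) auto
  then have "((\<lambda>z::real. exp (- (z\<^sup>2 / 4))) \<longlongrightarrow> 0) at_top"
    by (intro filterlim_compose[OF exp_at_bot]) (simp add: filterlim_uminus_at_bot)
  then have lim: "(?f \<longlongrightarrow> Psi_lim 0 + 2 * 0) at_top" by (intro tendsto_intros Psi_tendsto) simp
  have "eventually (\<lambda>y. ?f y \<le> ?f z) at_top"
    using eventually_ge_at_top[of z]
  proof eventually_elim
    fix y assume "z \<le> y"
    show "?f y \<le> ?f z"
    proof (rule DERIV_nonpos_imp_nonincreasing[OF \<open>z \<le> y\<close>])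
      fix x assume "z \<le> x"
      have "(?f has_real_derivative psi 0 x + 2 * (exp (- x\<^sup>2 / 4) * (- x / 2))) (at x)"
        by (rule derivative_eq_intros Psi_deriv refl | simp)+
      moreover have "psi 0 x + 2 * (exp (- x\<^sup>2 / 4) * (- x / 2)) \<le> 0"
        using \<open>z \<le> x\<close> assms by (simp add: psi_def)
      ultimately show "\<exists>d. (?f has_real_derivative d) (at x) \<and> d \<le> 0" by blast
    qed
  qed
  from tendsto_upperbound[OF lim this] show ?thesis by simp
qed

lemma integral_gauss:
  assumes "r > 0" "0 \<le> \<sigma>"
  shows "((\<lambda>\<xi>. gauss i (i + 1) (x - \<xi>) r) has_integral (Psi i (x / sqrt r) - Psi i ((x - \<sigma>) / sqrt r))) {0..\<sigma>}"
proof -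
  have "((\<lambda>\<xi>. gauss i (i + 1) (x - \<xi>) r) has_integral (- Psi i ((x - \<sigma>) / sqrt r) - - Psi i ((x - 0) / sqrt r))) {0..\<sigma>}"
  proof (rule fundamental_theorem_of_calculus[OF assms(2)])
    fix \<xi>
    have "((\<lambda>\<xi>. (x - \<xi>) / sqrt r) has_real_derivative - 1 / sqrt r) (at \<xi> within {0..\<sigma>})"
      by (rule DERIV_cdivide) (auto intro!: derivative_eq_intros)
    from DERIV_minus[OF Psi_deriv_comp[OF this]]
    show "((\<lambda>\<xi>. - Psi i ((x - \<xi>) / sqrt r)) has_vector_derivative gauss i (i + 1) (x - \<xi>) r) (at \<xi> within {0..\<sigma>})"
      using gauss_eq_psi[OF assms(1), of i "x - \<xi>"] by (simp add: has_real_derivative_iff_has_vector_derivative[symmetric])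
  qed
  then show ?thesis by simp
qed

lemma integral_Cauchy_kernel:
  assumes "r > 0" "0 \<le> \<sigma>"
  shows "((\<lambda>\<xi>. sqrt r / (r + (x - \<xi>)\<^sup>2)) has_integral (arctan (x / sqrt r) - arctan ((x - \<sigma>) / sqrt r))) {0..\<sigma>}"
proof -
  have "((\<lambda>\<xi>. sqrt r / (r + (x - \<xi>)\<^sup>2)) has_integral (- arctan ((x - \<sigma>) / sqrt r) - - arctan ((x - 0) / sqrt r))) {0..\<sigma>}"
  proof (rule fundamental_theorem_of_calculus[OF assms(2)])
    fix \<xi>
    have "((\<lambda>\<xi>. (x - \<xi>) / sqrt r) has_real_derivative - 1 / sqrt r) (at \<xi> within {0..\<sigma>})"
      by (rule DERIV_cdivide) (auto intro!: derivative_eq_intros)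
    from DERIV_minus[OF DERIV_chain2[OF DERIV_arctan this]]
    have "((\<lambda>\<xi>. - arctan ((x - \<xi>) / sqrt r)) has_real_derivative inverse (1 + ((x - \<xi>) / sqrt r)\<^sup>2) / sqrt r) (at \<xi> within {0..\<sigma>})"
      by simp
    also have "inverse (1 + ((x - \<xi>) / sqrt r)\<^sup>2) / sqrt r = sqrt r / (r + (x - \<xi>)\<^sup>2)"
    proof -
      obtain R where R: "R > 0" "r = R\<^sup>2" using assms by (intro that[of "sqrt r"]) auto
      have "R\<^sup>2 + (x - \<xi>)\<^sup>2 > 0" using R by (simp add: add_pos_nonneg)
      then show ?thesis using R by (simp add: power_divide divide_simps power2_eq_square)
    qed
    finally show "((\<lambda>\<xi>. - arctan ((x - \<xi>) / sqrt r)) has_vector_derivative sqrt r / (r + (x - \<xi>)\<^sup>2)) (at \<xi> within {0..\<sigma>})"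
      by (simp add: has_real_derivative_iff_has_vector_derivative)
  qed
  then show ?thesis by simp
qed

lemma gauss_le_Cauchy_kernel:
  assumes "r > 0"
  shows "\<bar>gauss i (i + 1) x r\<bar> \<le> (2 * 4 ^ (i + 1) * fact (i + 1)) * (sqrt r / (r + x\<^sup>2))"
proof -
  obtain R where R: "R > 0" "r = R\<^sup>2" using assms by (intro that[of "sqrt r"]) auto
  let ?C = "2 * 4 ^ (i + 1) * fact (i + 1) :: real"
  have "\<bar>gauss i (i + 1) x r\<bar> = \<bar>psi i (x / R)\<bar> / R"
    using R gauss_eq_psi[of "R\<^sup>2" i x] by simp
  also have "\<dots> \<le> ?C / (1 + (x / R)\<^sup>2) / R"
    using R by (intro divide_right_mono psi_le) auto
  also have "\<dots> = ?C * (R / (R\<^sup>2 + x\<^sup>2))"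
  proof -
    have "R\<^sup>2 + x\<^sup>2 > 0" "1 + (x / R)\<^sup>2 > 0" using R by (simp_all add: add_pos_nonneg)
    then have "1 / (1 + (x / R)\<^sup>2) / R = R / (R\<^sup>2 + x\<^sup>2)"
      using R by (simp add: power_divide divide_simps) (simp add: algebra_simps power2_eq_square)
    then have "?C * (1 / (1 + (x / R)\<^sup>2) / R) = ?C * (R / (R\<^sup>2 + x\<^sup>2))" by (simp only:)
    then show ?thesis by (simp del: fact_Suc power_Suc)
  qed
  finally show ?thesis using R by simp
qed

text \<open>
  The jump relation of potential theory in a form that covers a moving end point: as \<open>r\<close> tends to 0 the kernel
  concentrates at \<open>x\<close>, and an interval whose right end is \<open>O(r)\<close> away from the pole \<open>X p\<close> catches exactly the part of the
  kernel to the left of the pole, since \<open>O(r)\<close> is negligible on the scale \<open>sqrt r\<close> of the kernel.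
\<close>

lemma gauss_concentrates:
  fixes W :: "'a \<Rightarrow> real \<Rightarrow> real" and r X \<sigma> :: "'a \<Rightarrow> real"
  assumes r: "eventually (\<lambda>p. r p > 0) F" "(r \<longlongrightarrow> 0) F"
    and \<sigma>: "eventually (\<lambda>p. 0 \<le> \<sigma> p \<and> \<sigma> p \<le> S \<and> \<bar>X p - \<sigma> p\<bar> \<le> C * r p) F"
    and X: "(X \<longlongrightarrow> x) F" "x > 0"
    and W: "eventually (\<lambda>p. continuous_on {0..\<sigma> p} (W p) \<and> (\<forall>\<xi>\<in>{0..\<sigma> p}. \<bar>W p \<xi>\<bar> \<le> B)) F"
    and near: "\<And>\<epsilon>. \<epsilon> > 0 \<Longrightarrow> \<exists>\<delta>>0. eventually (\<lambda>p. \<forall>\<xi>\<in>{0..\<sigma> p}. \<bar>\<xi> - x\<bar> < \<delta> \<longrightarrow> \<bar>W p \<xi> - l\<bar> \<le> \<epsilon>) F"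
  shows "((\<lambda>p. integral {0..\<sigma> p} (\<lambda>\<xi>. W p \<xi> * gauss i (i + 1) (X p - \<xi>) (r p))) \<longlongrightarrow> l * Psi_lim i) F"
proof -
  define D where "D = (2 * 4 ^ (i + 1) * fact (i + 1) :: real)"
  have D: "D > 0" by (simp add: D_def)
  let ?G = "\<lambda>p \<xi>. gauss i (i + 1) (X p - \<xi>) (r p)"
  let ?m = "\<lambda>p. Psi i (X p / sqrt (r p)) - Psi i ((X p - \<sigma> p) / sqrt (r p))"
  have sr: "((\<lambda>p. sqrt (r p)) \<longlongrightarrow> 0) F" using tendsto_real_sqrt[OF r(2)] by simp
  have sr': "filterlim (\<lambda>p. sqrt (r p)) (at_right 0) F"
    unfolding filterlim_at using sr r(1) by (auto elim: eventually_mono)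
  have "filterlim (\<lambda>p. X p * inverse (sqrt (r p))) at_top F"
    by (rule filterlim_tendsto_pos_mult_at_top[OF X]) (rule filterlim_compose[OF filterlim_inverse_at_top_right sr'])
  then have "((\<lambda>p. Psi i (X p / sqrt (r p))) \<longlongrightarrow> Psi_lim i) F"
    unfolding divide_inverse by (rule filterlim_compose[OF Psi_tendsto])
  moreover have "((\<lambda>p. (X p - \<sigma> p) / sqrt (r p)) \<longlongrightarrow> 0) F"
  proof (rule Lim_null_comparison)
    show "eventually (\<lambda>p. norm ((X p - \<sigma> p) / sqrt (r p)) \<le> C * sqrt (r p)) F"
      using r(1) \<sigma>
    proof eventually_elim
      fix p assume "0 < r p" "0 \<le> \<sigma> p \<and> \<sigma> p \<le> S \<and> \<bar>X p - \<sigma> p\<bar> \<le> C * r p"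
      then show "norm ((X p - \<sigma> p) / sqrt (r p)) \<le> C * sqrt (r p)"
        by (simp add: pos_divide_le_eq mult.assoc)
    qed
    show "((\<lambda>p. C * sqrt (r p)) \<longlongrightarrow> 0) F" using sr by (rule tendsto_mult_right_zero)
  qed
  then have "((\<lambda>p. Psi i ((X p - \<sigma> p) / sqrt (r p))) \<longlongrightarrow> Psi i 0) F"
    by (rule isCont_tendsto_compose[OF isCont_Psi])
  ultimately have "(?m \<longlongrightarrow> Psi_lim i - Psi i 0) F" by (rule tendsto_diff)
  then have main: "((\<lambda>p. l * ?m p) \<longlongrightarrow> l * Psi_lim i) F"
    by (intro tendsto_mult_left) simp
  \<comment> \<open>Near \<open>x\<close> the factor \<open>W - l\<close> is small and the kernel has bounded mass; far from \<open>x\<close> the kernel is \<open>O(sqrt r)\<close>.\<close>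
  have err: "((\<lambda>p. integral {0..\<sigma> p} (\<lambda>\<xi>. (W p \<xi> - l) * ?G p \<xi>)) \<longlongrightarrow> 0) F"
  proof (rule tendstoI)
    fix e :: real assume e: "e > 0"
    define \<epsilon> where "\<epsilon> = e / (4 * D * pi)"
    have \<epsilon>: "\<epsilon> > 0" using e D by (simp add: \<epsilon>_def)
    from near[OF this] obtain \<delta> where \<delta>: "\<delta> > 0"
      and ev: "eventually (\<lambda>p. \<forall>\<xi>\<in>{0..\<sigma> p}. \<bar>\<xi> - x\<bar> < \<delta> \<longrightarrow> \<bar>W p \<xi> - l\<bar> \<le> \<epsilon>) F" by blast
    define A where "A = \<bar>B\<bar> + \<bar>l\<bar>"
    have "((\<lambda>p. \<bar>S\<bar> * (A * D * 4 / \<delta>\<^sup>2) * sqrt (r p)) \<longlongrightarrow> 0) F"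
      using sr by (rule tendsto_mult_right_zero)
    from order_tendstoD(2)[OF this, of "e / 2"] e
    have ev1: "eventually (\<lambda>p. \<bar>S\<bar> * (A * D * 4 / \<delta>\<^sup>2) * sqrt (r p) < e / 2) F" by simp
    have ev2: "eventually (\<lambda>p. \<bar>X p - x\<bar> < \<delta> / 2) F"
      using tendstoD[OF X(1), of "\<delta> / 2"] \<delta> by (simp add: dist_real_def)
    show "eventually (\<lambda>p. dist (integral {0..\<sigma> p} (\<lambda>\<xi>. (W p \<xi> - l) * ?G p \<xi>)) 0 < e) F"
      using ev ev1 ev2 r(1) \<sigma> W
    proof eventually_elim
      fix p
      assume H: "\<forall>\<xi>\<in>{0..\<sigma> p}. \<bar>\<xi> - x\<bar> < \<delta> \<longrightarrow> \<bar>W p \<xi> - l\<bar> \<le> \<epsilon>"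
         "\<bar>S\<bar> * (A * D * 4 / \<delta>\<^sup>2) * sqrt (r p) < e / 2" "\<bar>X p - x\<bar> < \<delta> / 2" "0 < r p"
         "0 \<le> \<sigma> p \<and> \<sigma> p \<le> S \<and> \<bar>X p - \<sigma> p\<bar> \<le> C * r p"
         "continuous_on {0..\<sigma> p} (W p) \<and> (\<forall>\<xi>\<in>{0..\<sigma> p}. \<bar>W p \<xi>\<bar> \<le> B)"
      let ?c = "\<lambda>\<xi>. sqrt (r p) / (r p + (X p - \<xi>)\<^sup>2)"
      let ?k = "A * D * 4 / \<delta>\<^sup>2 * sqrt (r p)"
      have ci: "(?c has_integral (arctan (X p / sqrt (r p)) - arctan ((X p - \<sigma> p) / sqrt (r p)))) {0..\<sigma> p}"
        using H by (intro integral_Cauchy_kernel) auto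
      have bi: "((\<lambda>\<xi>. \<epsilon> * D * ?c \<xi> + ?k) has_integral
           (\<epsilon> * D * (arctan (X p / sqrt (r p)) - arctan ((X p - \<sigma> p) / sqrt (r p))) + \<sigma> p * ?k)) {0..\<sigma> p}"
        using H by (intro has_integral_add has_integral_mult_right ci) (use has_integral_const_real[of ?k 0 "\<sigma> p"] in auto)
      have "norm (integral {0..\<sigma> p} (\<lambda>\<xi>. (W p \<xi> - l) * ?G p \<xi>)) \<le> integral {0..\<sigma> p} (\<lambda>\<xi>. \<epsilon> * D * ?c \<xi> + ?k)"
      proof (rule integral_norm_bound_integral)
        show "(\<lambda>\<xi>. (W p \<xi> - l) * ?G p \<xi>) integrable_on {0..\<sigma> p}"
          using H by (intro integrable_continuous_interval continuous_intros continuous_on_gauss) auto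
        show "(\<lambda>\<xi>. \<epsilon> * D * ?c \<xi> + ?k) integrable_on {0..\<sigma> p}" by (rule has_integral_integrable[OF bi])
        fix \<xi> assume \<xi>: "\<xi> \<in> {0..\<sigma> p}"
        have G: "\<bar>?G p \<xi>\<bar> \<le> D * ?c \<xi>" unfolding D_def by (rule gauss_le_Cauchy_kernel) (use H in auto)
        have c0: "?c \<xi> \<ge> 0" using H by simp
        have k0: "?k \<ge> 0" using D H by (simp add: A_def)
        show "norm ((W p \<xi> - l) * ?G p \<xi>) \<le> \<epsilon> * D * ?c \<xi> + ?k"
        proof (cases "\<bar>\<xi> - x\<bar> < \<delta>")
          case True
          then have "\<bar>W p \<xi> - l\<bar> * \<bar>?G p \<xi>\<bar> \<le> \<epsilon> * (D * ?c \<xi>)"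
            using H \<xi> G \<epsilon> by (intro mult_mono) auto
          then show ?thesis using k0 by (simp add: abs_mult mult_ac)
        next
          case False
          then have "\<delta> / 2 \<le> \<bar>X p - \<xi>\<bar>" using H(3) by linarith
          then have "(\<delta> / 2)\<^sup>2 \<le> (X p - \<xi>)\<^sup>2" using \<delta> by (metis abs_le_square_iff abs_of_pos half_gt_zero)
          then have "?c \<xi> \<le> sqrt (r p) / (\<delta> / 2)\<^sup>2" using \<delta> H by (intro divide_left_mono mult_pos_pos add_pos_nonneg) auto
          then have "?c \<xi> \<le> 4 / \<delta>\<^sup>2 * sqrt (r p)" by (simp add: power_divide mult_ac)
          then have G2: "\<bar>?G p \<xi>\<bar> \<le> D * (4 / \<delta>\<^sup>2 * sqrt (r p))" using G D by (meson mult_left_mono less_imp_le order_trans)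
          have "\<bar>W p \<xi>\<bar> \<le> \<bar>B\<bar>" using H(6) \<xi> by (meson abs_ge_self order_trans)
          then have "\<bar>W p \<xi> - l\<bar> \<le> A" by (simp add: A_def)
          then have "\<bar>W p \<xi> - l\<bar> * \<bar>?G p \<xi>\<bar> \<le> A * (D * (4 / \<delta>\<^sup>2 * sqrt (r p)))"
            using G2 by (intro mult_mono) (auto simp: A_def)
          moreover have "0 \<le> \<epsilon> * D * ?c \<xi>" using \<epsilon> D c0 by (intro mult_nonneg_nonneg) auto
          ultimately show ?thesis by (simp add: abs_mult mult_ac)
        qed
      qed
      also have "\<dots> = \<epsilon> * D * (arctan (X p / sqrt (r p)) - arctan ((X p - \<sigma> p) / sqrt (r p))) + \<sigma> p * ?k"
        using bi by (rule integral_unique)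
      also have "\<dots> \<le> \<epsilon> * D * pi + \<bar>S\<bar> * ?k"
      proof (intro add_mono mult_left_mono mult_right_mono)
        show "arctan (X p / sqrt (r p)) - arctan ((X p - \<sigma> p) / sqrt (r p)) \<le> pi"
          using arctan_ubound[of "X p / sqrt (r p)"] arctan_lbound[of "(X p - \<sigma> p) / sqrt (r p)"] by linarith
        show "0 \<le> ?k" using D H by (simp add: A_def)
      qed (use \<epsilon> D H in auto)
      also have "\<epsilon> * D * pi = e / 4" using D by (simp add: \<epsilon>_def)
      finally show "dist (integral {0..\<sigma> p} (\<lambda>\<xi>. (W p \<xi> - l) * ?G p \<xi>)) 0 < e"
        using H(2) e by (simp add: dist_real_def mult_ac)
    qed
  qed
  have "eventually (\<lambda>p. l * ?m p + integral {0..\<sigma> p} (\<lambda>\<xi>. (W p \<xi> - l) * ?G p \<xi>) =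
      integral {0..\<sigma> p} (\<lambda>\<xi>. W p \<xi> * ?G p \<xi>)) F"
    using r(1) \<sigma> W
  proof eventually_elim
    fix p assume H: "0 < r p" "0 \<le> \<sigma> p \<and> \<sigma> p \<le> S \<and> \<bar>X p - \<sigma> p\<bar> \<le> C * r p"
         "continuous_on {0..\<sigma> p} (W p) \<and> (\<forall>\<xi>\<in>{0..\<sigma> p}. \<bar>W p \<xi>\<bar> \<le> B)"
    have "((\<lambda>\<xi>. l * ?G p \<xi>) has_integral l * ?m p) {0..\<sigma> p}"
      using H by (intro has_integral_mult_right integral_gauss) auto
    moreover have "((\<lambda>\<xi>. (W p \<xi> - l) * ?G p \<xi>) has_integral integral {0..\<sigma> p} (\<lambda>\<xi>. (W p \<xi> - l) * ?G p \<xi>)) {0..\<sigma> p}"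
      using H by (intro integrable_integral integrable_continuous_interval continuous_intros continuous_on_gauss) auto
    ultimately have "((\<lambda>\<xi>. l * ?G p \<xi> + (W p \<xi> - l) * ?G p \<xi>) has_integral
       (l * ?m p + integral {0..\<sigma> p} (\<lambda>\<xi>. (W p \<xi> - l) * ?G p \<xi>))) {0..\<sigma> p}"
      by (rule has_integral_add)
    then have "((\<lambda>\<xi>. W p \<xi> * ?G p \<xi>) has_integral
       (l * ?m p + integral {0..\<sigma> p} (\<lambda>\<xi>. (W p \<xi> - l) * ?G p \<xi>))) {0..\<sigma> p}"
      by (simp add: algebra_simps)
    then show "l * ?m p + integral {0..\<sigma> p} (\<lambda>\<xi>. (W p \<xi> - l) * ?G p \<xi>) = integral {0..\<sigma> p} (\<lambda>\<xi>. W p \<xi> * ?G p \<xi>)"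
      by (simp add: integral_unique)
  qed
  from filterlim_cong[OF refl refl this] tendsto_add[OF main err] show ?thesis by simp
qed

section \<open>The initial layer\<close>

text \<open>
  If \<open>(t - a) g'\<close> had a nonzero limit at \<open>a\<close>, then \<open>g\<close> would grow like a logarithm.
\<close>

lemma scaling_derivative_vanishes:
  fixes g g1 :: "real \<Rightarrow> real"
  assumes "a < T" "continuous_on {a..T} g" "continuous_on {a..T} g1"
    and d: "\<And>t. t \<in> {a<..T} \<Longrightarrow> (g has_real_derivative g1 t / (t - a)) (at t within {a..T})"
  shows "g1 a = 0"
proof (rule ccontr)
  have no_pos: False if pos: "g1 a > 0" and gc: "continuous_on {a..T} g" and g1c: "continuous_on {a..T} g1"
     and gd: "\<And>t. t \<in> {a<..T} \<Longrightarrow> (g has_real_derivative g1 t / (t - a)) (at t within {a..T})" for g g1 :: "real \<Rightarrow> real"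
  proof -
    define c where "c = g1 a / 2"
    have c: "c > 0" using pos by (simp add: c_def)
    have "(g1 \<longlongrightarrow> g1 a) (at a within {a..T})"
      using g1c \<open>a < T\<close> by (auto simp: continuous_on_def)
    then have "eventually (\<lambda>t. g1 t > c) (at a within {a..T})"
      by (rule order_tendstoD) (use pos in \<open>simp add: c_def\<close>)
    then obtain e where e: "e > 0" "\<And>t. t \<in> {a..T} \<Longrightarrow> t \<noteq> a \<Longrightarrow> dist t a < e \<Longrightarrow> g1 t > c"
      unfolding eventually_at by auto
    define t1 where "t1 = a + min (e / 2) (T - a)"
    have t1: "a < t1" "t1 \<le> T" using e(1) \<open>a < T\<close> by (auto simp: t1_def)
    have big: "g1 t > c" if "t \<in> {a<..t1}" for t
      using that e t1 by (auto simp: dist_real_def t1_def min_def split: if_splits)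
    have le: "g t - c * ln (t - a) \<le> g t1 - c * ln (t1 - a)" if t: "t \<in> {a<..<t1}" for t
    proof (rule DERIV_nonneg_imp_increasing_open[of t t1])
      show "t \<le> t1" using t by simp
      fix x assume x: "t < x" "x < t1"
      have "(g has_real_derivative g1 x / (x - a)) (at x)"
        using gd[of x] x t t1 by (simp add: at_within_Icc_at)
      then have "((\<lambda>t. g t - c * ln (t - a)) has_real_derivative g1 x / (x - a) - c * (1 / (x - a))) (at x)"
        using x t by (auto intro!: derivative_eq_intros simp: divide_inverse)
      moreover have "0 \<le> g1 x / (x - a) - c * (1 / (x - a))"
        using big[of x] x t by (simp add: diff_divide_distrib[symmetric])
      ultimately show "\<exists>y. ((\<lambda>t. g t - c * ln (t - a)) has_real_derivative y) (at x) \<and> 0 \<le> y" by blast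
    next
      show "continuous_on {t..t1} (\<lambda>t. g t - c * ln (t - a))"
        using t t1 by (intro continuous_intros continuous_on_subset[OF gc]) auto
    qed
    have ra: "(g \<longlongrightarrow> g a) (at_right a)"
      using gc \<open>a < T\<close> by (auto simp: continuous_on_Icc_at_rightD)
    have "filterlim (\<lambda>t. t - a) (at_right 0) (at_right a)"
      by (rule filterlim_at_withinI) (auto intro!: tendsto_eq_intros simp: eventually_at_right_less eventually_at_filter)
    then have "filterlim (\<lambda>t. ln (t - a)) at_bot (at_right a)"
      by (rule filterlim_compose[OF ln_at_0])
    then have ev: "eventually (\<lambda>t. ln (t - a) < (g a - 1 - (g t1 - c * ln (t1 - a))) / c) (at_right a)"
      by (simp add: filterlim_at_bot_dense)
    have ev2: "eventually (\<lambda>t. g t > g a - 1) (at_right a)" by (rule order_tendstoD[OF ra]) simp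
    have ev3: "eventually (\<lambda>t. t \<in> {a<..<t1}) (at_right a)" by (rule eventually_at_right_real[OF t1(1)])
    have "eventually (\<lambda>t. False) (at_right a)"
      using ev ev2 ev3
    proof eventually_elim
      fix t assume H: "ln (t - a) < (g a - 1 - (g t1 - c * ln (t1 - a))) / c" "g t > g a - 1" "t \<in> {a<..<t1}"
      from H(1) c have "c * ln (t - a) < g a - 1 - (g t1 - c * ln (t1 - a))" by (simp add: pos_less_divide_eq mult.commute)
      with le[OF H(3)] H(2) show False by linarith
    qed
    then show False by simp
  qed
  assume "g1 a \<noteq> 0"
  then consider "g1 a > 0" | "- g1 a > 0" by linarith
  then show False
  proof cases
    case 1
    then show False using no_pos[OF _ assms(2,3) d] by blast
  next
    case 2
    have "((\<lambda>t. - g t) has_real_derivative (- g1 t) / (t - a)) (at t within {a..T})" if "t \<in> {a<..T}" for t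
      using DERIV_minus[OF d[OF that]] by simp
    then show False using no_pos[of "\<lambda>t. - g1 t" "\<lambda>t. - g t"] 2 assms(2,3) by (auto intro: continuous_intros)
  qed
qed

lemma gauss_sqrt_factor:
  assumes "r > 0" shows "sqrt r * gauss i (Suc j) x r = gauss i j x r"
  using assms by (simp add: gauss_def)

text \<open>
  The contribution of initial values \<open>w0\<close> on \<open>[0, s a]\<close>, seen from the moving point \<open>s t\<close>. In \<open>t\<close> it is not even
  once differentiable at \<open>t = a\<close> in general, but it is smooth along the scaling field because the kernels are
  self-similar.
\<close>

locale initial_layer =
  fixes w0 s s' :: "real \<Rightarrow> real" and a T :: real
  assumes aT: "a < T"
    and w0: "continuous_on {0..s a} w0"
    and s: "\<And>t. t \<in> {a..T} \<Longrightarrow> (s has_real_derivative s' t) (at t within {a..T})"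
    and s': "continuous_on {a..T} s'"
    and sa: "s a > 0"
begin

text \<open>
  The value at \<open>t = a\<close> is the limit given by the jump relation.
\<close>

definition layer :: "nat \<Rightarrow> real \<Rightarrow> real" where
  "layer i t = (if t = a then w0 (s a) * Psi_lim i else integral {0..s a} (\<lambda>\<xi>. w0 \<xi> * gauss i (i + 1) (s t - \<xi>) (t - a)))"

definition layer' :: "nat \<Rightarrow> real \<Rightarrow> real" where
  "layer' i t = sqrt (t - a) * s' t * (real i * layer (i - 1) t - 1/2 * layer (i + 1) t)
      + (1/4 * layer (i + 2) t - (real i + 1) / 2 * layer i t)"

lemma s_cont: "continuous_on {a..T} s"
  using s by (rule DERIV_continuous_on)

lemma s_Lipschitz: "\<exists>C. \<forall>t\<in>{a..T}. \<bar>s t - s a\<bar> \<le> C * (t - a)"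
proof -
  have "bounded (s' ` {a..T})" by (intro compact_imp_bounded compact_continuous_image s' compact_Icc)
  then obtain C where C: "\<forall>t\<in>{a..T}. \<bar>s' t\<bar> \<le> C" by (auto simp: bounded_iff)
  have "norm (s t - s a) \<le> C * norm (t - a)" if "t \<in> {a..T}" for t
    by (rule field_differentiable_bound[of "{a..T}" s s' C]) (use s C that aT in auto)
  then show ?thesis by (intro exI[of _ C]) auto
qed

lemma layer_tendsto: "(layer i \<longlongrightarrow> layer i a) (at a within {a..T})"
proof -
  let ?F = "at a within {a..T}"
  obtain C where C: "\<forall>t\<in>{a..T}. \<bar>s t - s a\<bar> \<le> C * (t - a)" using s_Lipschitz by blast
  have "bounded (w0 ` {0..s a})" by (intro compact_imp_bounded compact_continuous_image w0 compact_Icc)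
  then obtain B where B: "\<forall>\<xi>\<in>{0..s a}. \<bar>w0 \<xi>\<bar> \<le> B" by (auto simp: bounded_iff)
  have dom: "eventually (\<lambda>t. t \<in> {a<..T}) ?F" by (auto simp: eventually_at_filter)
  have "((\<lambda>t. integral {0..s a} (\<lambda>\<xi>. w0 \<xi> * gauss i (i + 1) (s t - \<xi>) (t - a))) \<longlongrightarrow> w0 (s a) * Psi_lim i) ?F"
  proof (rule gauss_concentrates[where S="s a" and C=C and B=B and x="s a"])
    show "eventually (\<lambda>t. 0 < t - a) ?F" using dom by eventually_elim simp
    show "((\<lambda>t. t - a) \<longlongrightarrow> 0) ?F" by (auto intro!: tendsto_eq_intros)
    show "eventually (\<lambda>t. 0 \<le> s a \<and> s a \<le> s a \<and> \<bar>s t - s a\<bar> \<le> C * (t - a)) ?F"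
      using dom by eventually_elim (use C sa in auto)
    show "(s \<longlongrightarrow> s a) ?F" using s_cont aT by (auto simp: continuous_on_def)
    show "eventually (\<lambda>t. continuous_on {0..s a} w0 \<and> (\<forall>\<xi>\<in>{0..s a}. \<bar>w0 \<xi>\<bar> \<le> B)) ?F"
      using w0 B by simp
    fix \<epsilon> :: real assume "\<epsilon> > 0"
    then obtain \<delta> where "\<delta> > 0" "\<And>\<xi>. \<xi> \<in> {0..s a} \<Longrightarrow> dist \<xi> (s a) < \<delta> \<Longrightarrow> dist (w0 \<xi>) (w0 (s a)) < \<epsilon>"
      using w0 sa unfolding continuous_on_iff by (metis atLeastAtMost_iff less_imp_le order_refl)
    then show "\<exists>\<delta>>0. eventually (\<lambda>t. \<forall>\<xi>\<in>{0..s a}. \<bar>\<xi> - s a\<bar> < \<delta> \<longrightarrow> \<bar>w0 \<xi> - w0 (s a)\<bar> \<le> \<epsilon>) ?F"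
      by (intro exI[of _ \<delta>]) (auto simp: dist_real_def less_imp_le)
  qed (rule sa)
  moreover have "eventually (\<lambda>t. integral {0..s a} (\<lambda>\<xi>. w0 \<xi> * gauss i (i + 1) (s t - \<xi>) (t - a)) = layer i t) ?F"
    using dom by eventually_elim (simp add: layer_def)
  ultimately have "(layer i \<longlongrightarrow> w0 (s a) * Psi_lim i) ?F" by (rule Lim_transform_eventually)
  then show ?thesis by (simp add: layer_def)
qed

text \<open>
  Differentiation in \<open>t\<close> costs a factor \<open>1 / (t - a)\<close> for the time argument of the kernel and only
  \<open>1 / sqrt (t - a)\<close> for the moving pole. Multiplied by \<open>t - a\<close>, everything is again a combination of layers.
\<close>

lemma layer_deriv:
  assumes t: "t \<in> {a<..T}"
  shows "(layer i has_real_derivative layer' i t / (t - a)) (at t within {a..T})"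
proof -
  let ?B = "\<lambda>t (p::real\<times>real). w0 (snd p) * gauss i (i + 1) (s t - snd p) (t - a)"
  let ?B' = "\<lambda>t (p::real\<times>real). w0 (snd p) * (s' t * gauss_x i (i + 1) (s t - snd p) (t - a) + gauss_r i (i + 1) (s t - snd p) (t - a))"
  have c1: "continuous_on ({a<..T} \<times> ({0::real} \<times> {0..s a})) (\<lambda>p. w0 (snd (snd p)))"
    by (rule continuous_on_compose2[OF w0]) (auto intro!: continuous_intros)
  have c2: "continuous_on ({a<..T} \<times> ({0::real} \<times> {0..s a})) (\<lambda>p. s (fst p))"
    by (rule continuous_on_compose2[OF s_cont]) (auto intro!: continuous_intros)
  have c3: "continuous_on ({a<..T} \<times> ({0::real} \<times> {0..s a})) (\<lambda>p. s' (fst p))"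
    by (rule continuous_on_compose2[OF s']) (auto intro!: continuous_intros)
  have "deriv_along (\<lambda>_. 1) {a<..T} {0::real} (\<lambda>t y. integral {0..s a} (\<lambda>z. ?B t (y, z))) (\<lambda>t y. integral {0..s a} (\<lambda>z. ?B' t (y, z)))"
  proof (rule deriv_along_integral)
    show "deriv_along (\<lambda>_. 1) {a<..T} ({0::real} \<times> {0..s a}) ?B ?B'"
    proof (intro ballI conjI impI)
      fix t and p :: "real \<times> real" assume t: "t \<in> {a<..T}"
      have "((\<lambda>t. gauss i (i + 1) (s t - snd p) (t - a)) has_real_derivative
          s' t * gauss_x i (i + 1) (s t - snd p) (t - a) + 1 * gauss_r i (i + 1) (s t - snd p) (t - a)) (at t within {a<..T})"
      proof (rule gauss_has_derivative)
        have "(s has_real_derivative s' t) (at t within {a<..T})"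
          by (rule DERIV_subset[OF s]) (use t in auto)
        then show "((\<lambda>t. s t - snd p) has_real_derivative s' t) (at t within {a<..T})"
          by (auto intro!: derivative_eq_intros)
      qed (use t in \<open>auto intro!: derivative_eq_intros\<close>)
      from DERIV_cmult[OF this, of "w0 (snd p)"]
      show "((\<lambda>t. ?B t p) has_real_derivative ?B' t p / 1) (at t within {a<..T})" by simp
    qed auto
    show "continuous_on ({a<..T} \<times> ({0::real} \<times> {0..s a})) (\<lambda>p. ?B (fst p) (snd p))"
      by (intro continuous_intros continuous_on_gauss c1 c2) auto
    show "continuous_on ({a<..T} \<times> ({0::real} \<times> {0..s a})) (\<lambda>p. ?B' (fst p) (snd p))"
      unfolding gauss_x_def gauss_r_def by (intro continuous_intros continuous_on_gauss c1 c2 c3) auto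
  qed auto
  then have D: "((\<lambda>t. integral {0..s a} (\<lambda>z. ?B t (0, z))) has_real_derivative integral {0..s a} (\<lambda>z. ?B' t (0, z))) (at t within {a<..T})"
    using t by auto
  have int: "(\<lambda>z. w0 z * gauss k l (s t - z) (t - a)) integrable_on {0..s a}" for k l
    using t by (intro integrable_continuous_interval continuous_intros continuous_on_gauss w0) auto
  define R where "R = sqrt (t - a)"
  have R: "R > 0" "t - a = R * R" using t by (auto simp: R_def)
  have G: "gauss k (Suc (Suc l)) x (R * R) * (R * R) = gauss k l x (R * R)" "gauss k (Suc l) x (R * R) * R = gauss k l x (R * R)" for k l x
    using gauss_sqrt_factor[of "R * R" k l x] gauss_sqrt_factor[of "R * R" k "Suc l" x] R by (simp_all add: mult_ac)
  have B': "(t - a) * ?B' t (0, z) =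
      (R * s' t * real i) * (w0 z * gauss (i - 1) i (s t - z) (t - a)) - (R * s' t / 2) * (w0 z * gauss (i + 1) (i + 2) (s t - z) (t - a))
     + 1/4 * (w0 z * gauss (i + 2) (i + 3) (s t - z) (t - a)) - (real i + 1) / 2 * (w0 z * gauss i (i + 1) (s t - z) (t - a))" for z
  proof -
    have gx: "(t - a) * gauss_x i (i + 1) (s t - z) (t - a) = R * (real i * gauss (i - 1) i (s t - z) (t - a)) - R * (1/2 * gauss (i + 1) (i + 2) (s t - z) (t - a))"
      unfolding R(2) gauss_x_def
      using G(2)[of "i - 1" i "s t - z"] G(2)[of "i + 1" "i + 2" "s t - z"]
      by (simp add: algebra_simps numeral_2_eq_2 numeral_3_eq_3)
    have gr: "(t - a) * gauss_r i (i + 1) (s t - z) (t - a) = 1/4 * gauss (i + 2) (i + 3) (s t - z) (t - a) - (real i + 1) / 2 * gauss i (i + 1) (s t - z) (t - a)"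
      unfolding R(2) gauss_r_def
      using G(1)[of "i + 2" "i + 3" "s t - z"] G(1)[of i "i + 1" "s t - z"]
      by (simp add: algebra_simps eval_nat_numeral)
    have "(t - a) * ?B' t (0, z) = w0 z * (s' t * ((t - a) * gauss_x i (i + 1) (s t - z) (t - a)) + (t - a) * gauss_r i (i + 1) (s t - z) (t - a))"
      by (simp add: algebra_simps)
    note this[unfolded gx gr]
    then show ?thesis by (simp add: algebra_simps)
  qed
  have "(t - a) * integral {0..s a} (\<lambda>z. ?B' t (0, z)) = integral {0..s a} (\<lambda>z. (t - a) * ?B' t (0, z))"
    by (rule integral_mult_right[symmetric])
  also have "\<dots> = (R * s' t * real i) * integral {0..s a} (\<lambda>z. w0 z * gauss (i - 1) i (s t - z) (t - a))
     - (R * s' t / 2) * integral {0..s a} (\<lambda>z. w0 z * gauss (i + 1) (i + 2) (s t - z) (t - a))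
     + 1/4 * integral {0..s a} (\<lambda>z. w0 z * gauss (i + 2) (i + 3) (s t - z) (t - a))
     - (real i + 1) / 2 * integral {0..s a} (\<lambda>z. w0 z * gauss i (i + 1) (s t - z) (t - a))"
    unfolding B'
    by (intro integral_unique has_integral_add has_integral_diff has_integral_mult_right integrable_integral int)
  also have "\<dots> = layer' i t"
    using t by (cases i) (simp_all add: layer'_def layer_def R_def algebra_simps eval_nat_numeral)
  finally have "integral {0..s a} (\<lambda>z. ?B' t (0, z)) = layer' i t / (t - a)" using t by (simp add: field_simps)
  with D have "((\<lambda>t. integral {0..s a} (\<lambda>z. ?B t (0, z))) has_real_derivative layer' i t / (t - a)) (at t within {a<..T})"
    by simp
  then have "(layer i has_real_derivative layer' i t / (t - a)) (at t within {a<..T})"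
    by (rule has_field_derivative_transform_within[of _ _ _ _ 1]) (use t in \<open>auto simp: layer_def\<close>)
  moreover have "at t within {a<..T} = at t within {a..T}"
    using t by (intro at_within_nhd[of _ "{a<..}"]) auto
  ultimately show ?thesis by simp
qed

lemma layer_cont: "continuous_on {a..T} (layer i)"
proof -
  have "continuous (at t within {a..T}) (layer i)" if "t \<in> {a..T}" for t
    using layer_tendsto layer_deriv[of t i, THEN DERIV_continuous] that
    by (cases "t = a") (auto simp: continuous_within)
  then show ?thesis by (simp add: continuous_on_eq_continuous_within)
qed

lemma layer'_cont: "continuous_on {a..T} (layer' i)"
  unfolding layer'_def[abs_def] by (intro continuous_intros layer_cont s')

lemma cdiff_layer:
  assumes "cdiff_fun n (\<lambda>t. t - a) {a..T} s'"
  shows "cdiff_fun n (\<lambda>t. t - a) {a..T} (layer i)"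
  using assms
proof (induction n arbitrary: i)
  case 0
  then show ?case using layer_cont by (simp add: continuous_on_fun_iff)
next
  case (Suc n)
  note IH = Suc.IH[OF cdiff_Suc_imp[OF Suc.prems]]
  have "cdiff_fun n (\<lambda>t. t - a) {a..T} (\<lambda>t. sqrt (t - a))" by (rule cdiff_sqrt) auto
  then have "cdiff_fun n (\<lambda>t. t - a) {a..T} (layer' i)"
    unfolding layer'_def
    by (intro cdiff_add cdiff_diff cdiff_mult[of n _ _ _ "\<lambda>t _. sqrt (t - a)"]
          cdiff_mult[of n _ _ _ "\<lambda>t _. sqrt (t - a) * s' t"] cdiff_cmult IH cdiff_Suc_imp[OF Suc.prems])
  moreover have "layer' i a = 0"
    by (rule scaling_derivative_vanishes[OF aT layer_cont layer'_cont layer_deriv])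
  ultimately show ?case
    using layer_deriv layer_cont by (intro cdiff_fun_SucI[where q'="layer' i"]) auto
qed

end

section \<open>Green's identity below a moving curve\<close>

lemma integral_stretch:
  fixes f :: "real \<Rightarrow> real"
  assumes "continuous_on {0..c} f" "c > 0"
  shows "integral {0..c} f = c * integral {0..1} (\<lambda>y. f (y * c))"
proof -
  let ?F = "\<lambda>x. integral {0..x} f"
  have im: "(\<lambda>y. y * c) ` {0..1} \<subseteq> {0..c}" using assms(2) mult_right_mono[of _ 1 c] by auto
  have "((\<lambda>y. f (y * c) * c) has_integral (?F (1 * c) - ?F (0 * c))) {0..1}"
  proof (rule fundamental_theorem_of_calculus)
    fix y :: real assume y: "y \<in> {0..1}"
    have "(?F has_real_derivative f (y * c)) (at (y * c) within (\<lambda>y. y * c) ` {0..1})"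
      by (rule DERIV_subset[OF integral_has_real_derivative[OF assms(1)] im]) (rule subsetD[OF im imageI[OF y]])
    moreover have "((\<lambda>y. y * c) has_real_derivative c) (at y within {0..1})"
      by (auto intro!: derivative_eq_intros)
    ultimately have "((?F \<circ> (\<lambda>y. y * c)) has_real_derivative f (y * c) * c) (at y within {0..1})"
      by (rule DERIV_image_chain)
    then have "((\<lambda>y. ?F (y * c)) has_real_derivative f (y * c) * c) (at y within {0..1})"
      by (simp add: o_def)
    then show "((\<lambda>y. ?F (y * c)) has_vector_derivative f (y * c) * c) (at y within {0..1})"
      by (simp add: has_real_derivative_iff_has_vector_derivative)
  qed simp
  from integral_unique[OF this] have "integral {0..1} (\<lambda>y. f (y * c) * c) = integral {0..c} f" by simp
  then show ?thesis by (simp add: mult.commute)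
qed

text \<open>
  A solution of the heat equation on \<open>0 < x < s t\<close> with the homogeneous Neumann condition on the curve. It is continuous up to
  the boundary together with \<open>w\<^sub>x\<close> and \<open>w\<^sub>x\<^sub>x\<close>. The time derivative exists inside the domain, where it equals \<open>w\<^sub>x\<^sub>x\<close>:
  at a boundary point the domain may contain no nearby point with the same \<open>x\<close> at another time.
\<close>

locale heat_below_curve =
  fixes w wx wxx :: "real \<Rightarrow> real \<Rightarrow> real" and s s' :: "real \<Rightarrow> real"
  assumes s_deriv: "\<And>t. t > 0 \<Longrightarrow> (s has_real_derivative s' t) (at t)"
    and s'_cont: "continuous_on {0<..} s'"
    and s_pos: "\<And>t. t > 0 \<Longrightarrow> s t > 0"
    and w_cont: "continuous_on {(x, t). 0 \<le> x \<and> x \<le> s t \<and> 0 < t} (\<lambda>(x, t). w x t)"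
    and wx_cont: "continuous_on {(x, t). 0 \<le> x \<and> x \<le> s t \<and> 0 < t} (\<lambda>(x, t). wx x t)"
    and wxx_cont: "continuous_on {(x, t). 0 \<le> x \<and> x \<le> s t \<and> 0 < t} (\<lambda>(x, t). wxx x t)"
    and w_dx: "\<And>x t. 0 < t \<Longrightarrow> 0 \<le> x \<Longrightarrow> x \<le> s t \<Longrightarrow> ((\<lambda>y. w y t) has_real_derivative wx x t) (at x within {0..s t})"
    and wx_dx: "\<And>x t. 0 < t \<Longrightarrow> 0 \<le> x \<Longrightarrow> x \<le> s t \<Longrightarrow> ((\<lambda>y. wx y t) has_real_derivative wxx x t) (at x within {0..s t})"
    and w_dt: "\<And>x t. 0 < t \<Longrightarrow> 0 < x \<Longrightarrow> x < s t \<Longrightarrow> ((\<lambda>r. w x r) has_real_derivative wxx x t) (at t)"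
    and neumann: "\<And>t. 0 < t \<Longrightarrow> wx (s t) t = 0"
begin

lemma s_cont: "continuous_on {0<..} s"
  by (rule DERIV_continuous_on[where D=s']) (auto intro: DERIV_subset[OF s_deriv])

lemma scaled_point: "0 < t \<Longrightarrow> y \<in> {0..1} \<Longrightarrow> 0 \<le> y * s t \<and> y * s t \<le> s t"
  using s_pos[of t] mult_right_mono[of y 1 "s t"] by auto

lemma continuous_on_below:
  assumes "continuous_on {(x, t). 0 \<le> x \<and> x \<le> s t \<and> 0 < t} (\<lambda>(x, t). v x t)"
    and "continuous_on A f" "continuous_on A g" "\<And>a. a \<in> A \<Longrightarrow> 0 \<le> f a \<and> f a \<le> s (g a) \<and> 0 < g a"
  shows "continuous_on A (\<lambda>a. v (f a) (g a) :: real)"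
proof -
  have "continuous_on A (\<lambda>a. (\<lambda>(x, t). v x t) (f a, g a))"
    by (rule continuous_on_compose2[OF assms(1)]) (use assms in \<open>auto intro!: continuous_intros\<close>)
  then show ?thesis by simp
qed

lemma continuous_on_s_comp: "continuous_on A g \<Longrightarrow> (\<And>a. a \<in> A \<Longrightarrow> 0 < g a) \<Longrightarrow> continuous_on A (\<lambda>a. s (g a))"
  by (rule continuous_on_compose2[OF s_cont]) auto

lemma continuous_on_s'_comp: "continuous_on A g \<Longrightarrow> (\<And>a. a \<in> A \<Longrightarrow> 0 < g a) \<Longrightarrow> continuous_on A (\<lambda>a. s' (g a))"
  by (rule continuous_on_compose2[OF s'_cont]) auto

text \<open>
  With \<open>x = y s(t)\<close>, \<open>0 \<le> y \<le> 1\<close>, the moving domain becomes a fixed one.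
\<close>

lemma continuous_on_scaled:
  assumes "continuous_on {(x, t). 0 \<le> x \<and> x \<le> s t \<and> 0 < t} (\<lambda>(x, t). v x t)"
    and "continuous_on A f" "continuous_on A g" "\<And>a. a \<in> A \<Longrightarrow> f a \<in> {0..1} \<and> 0 < g a"
  shows "continuous_on A (\<lambda>a. v (f a * s (g a)) (g a) :: real)"
proof (rule continuous_on_below[OF assms(1)])
  show "continuous_on A (\<lambda>a. f a * s (g a))"
    using assms by (intro continuous_intros continuous_on_s_comp) auto
  show "0 \<le> f a * s (g a) \<and> f a * s (g a) \<le> s (g a) \<and> 0 < g a" if "a \<in> A" for a
    using scaled_point[of "g a" "f a"] assms(4)[OF that] by auto
qed (rule assms)

lemma w_curve_deriv_interior:
  assumes t: "t > 0" and y: "0 < y" "y < 1"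
  shows "((\<lambda>r. w (y * s r) r) has_real_derivative wxx (y * s t) t + y * s' t * wx (y * s t) t) (at t)"
proof -
  let ?x = "y * s t"
  have x: "0 < ?x" "?x < s t" using y s_pos[OF t] by auto
  define m where "m = (?x + s t) / 2"
  have m: "?x < m" "m < s t" using x by (auto simp: m_def)
  have "isCont s t" using s_deriv[OF t] by (rule DERIV_isCont)
  then have "(s \<longlongrightarrow> s t) (nhds t)" by (simp add: isCont_def tendsto_at_iff_tendsto_nhds)
  then have "eventually (\<lambda>r. m < s r) (nhds t)" using m(2) by (rule order_tendstoD(1))
  moreover have "eventually (\<lambda>r. 0 < r) (nhds t)" using t eventually_nhds_in_open[of "{0<..}" t] by auto
  ultimately have "eventually (\<lambda>r. m < s r \<and> 0 < r) (nhds t)" by eventually_elim simp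
  then obtain e where e: "e > 0" "\<And>r. dist r t < e \<Longrightarrow> m < s r \<and> 0 < r"
    unfolding eventually_nhds_metric by auto
  let ?X = "{0<..<m}" and ?Y = "ball t e"
  have Y: "m < s r" "0 < r" if "r \<in> ?Y" for r using e(2)[of r] that by (auto simp: dist_commute)
  have "((\<lambda>(x, r). w x r) has_derivative (\<lambda>(tx, tr). wx ?x t * tx + blinfun_apply (blinfun_mult_right (wxx ?x t)) tr)) (at (?x, t) within ?X \<times> ?Y)"
  proof (rule has_derivative_partialsI)
    have "((\<lambda>y. w y t) has_real_derivative wx ?x t) (at ?x within ?X)"
      by (rule DERIV_subset[OF w_dx]) (use t x m in auto)
    then show "((\<lambda>x. w x t) has_derivative (\<lambda>tx. wx ?x t * tx)) (at ?x within ?X)"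
      by (simp add: has_field_derivative_def)
    show "((\<lambda>r. w x r) has_derivative blinfun_apply (blinfun_mult_right (wxx x r))) (at r within ?Y)"
      if "x \<in> ?X" "r \<in> ?Y" for x r
    proof -
      have "((\<lambda>r. w x r) has_real_derivative wxx x r) (at r within ?Y)"
        by (rule DERIV_subset[OF w_dt]) (use that Y[OF that(2)] in auto)
      then show ?thesis by (simp add: has_field_derivative_eq_has_derivative_blinfun)
    qed
    have "continuous_on (?X \<times> ?Y) (\<lambda>p. wxx (fst p) (snd p))"
      using Y by (intro continuous_on_below[OF wxx_cont] continuous_intros) (force simp: less_imp_le)+
    then have "continuous_on (?X \<times> ?Y) (\<lambda>p. blinfun_mult_right (wxx (fst p) (snd p)))"
      by (intro continuous_intros)
    then show "continuous (at (?x, t) within ?X \<times> ?Y) (\<lambda>(x, y). blinfun_mult_right (wxx x y))"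
      using x m e by (auto simp: continuous_on_eq_continuous_within case_prod_beta')
  qed (use e in auto)
  moreover have "at (?x, t) within ?X \<times> ?Y = at (?x, t)"
    using x m e by (intro at_within_open open_Times) auto
  ultimately have D: "((\<lambda>p. w (fst p) (snd p)) has_derivative (\<lambda>p. wx ?x t * fst p + wxx ?x t * snd p)) (at (?x, t))"
    by (simp add: case_prod_beta')
  have "((\<lambda>r. (y * s r, r)) has_derivative (\<lambda>h. (y * (s' t * h), h))) (at t)"
    using s_deriv[OF t] by (auto intro!: derivative_eq_intros simp: has_field_derivative_def)
  from has_derivative_compose[OF this D]
  have "((\<lambda>r. w (y * s r) r) has_derivative (\<lambda>h. wx ?x t * (y * (s' t * h)) + wxx ?x t * h)) (at t)" by simp
  moreover have "(\<lambda>h. wx ?x t * (y * (s' t * h)) + wxx ?x t * h) = (\<lambda>h. (wxx ?x t + y * s' t * wx ?x t) * h)"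
    by (simp add: fun_eq_iff algebra_simps)
  ultimately show ?thesis by (simp add: has_field_derivative_def)
qed

text \<open>
  The derivative along \<open>x = y s(t)\<close> is found by the chain rule for \<open>0 < y < 1\<close>. In integrated form the formula is
  continuous in \<open>y\<close> and so extends to \<open>y = 0\<close> and \<open>y = 1\<close>, where the interior chain rule does not apply.
\<close>

lemma w_curve_deriv:
  assumes t: "t > 0" and y: "y \<in> {0..1}"
  shows "((\<lambda>r. w (y * s r) r) has_real_derivative wxx (y * s t) t + y * s' t * wx (y * s t) t) (at t)"
proof -
  define c where "c = t / 2"
  define d where "d = t + 1"
  have cd: "0 < c" "c < t" "t < d" using t by (auto simp: c_def d_def)
  let ?V = "\<lambda>y r. wxx (y * s r) r + y * s' r * wx (y * s r) r"
  have Vc: "continuous_on ({0..1} \<times> {c..d}) (\<lambda>p. ?V (fst p) (snd p))"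
    using cd by (intro continuous_intros continuous_on_scaled[OF wxx_cont] continuous_on_scaled[OF wx_cont] continuous_on_s'_comp) auto
  have eq: "w (y * s r) r = w (y * s c) c + integral {c..r} (?V y)" if r: "r \<in> {c..d}" for r
  proof -
    let ?f = "\<lambda>y. w (y * s r) r - w (y * s c) c - integral {c..r} (?V y)"
    have "?f y = 0"
    proof (rule continuous_constant_on_closure[where S="{0<..<1}" and f="?f"])
      have "continuous_on ({0..1} \<times> cbox c r) (\<lambda>(y, r). ?V y r)"
        unfolding case_prod_beta' by (rule continuous_on_subset[OF Vc]) (use r in auto)
      from integral_continuous_on_param[OF this]
      have "continuous_on {0..1} (\<lambda>y. integral {c..r} (?V y))" by simp
      moreover have "continuous_on {0..1} (\<lambda>y. w (y * s r) r)" "continuous_on {0..1} (\<lambda>y. w (y * s c) c)"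
        using cd r by (auto intro!: continuous_on_scaled[OF w_cont] continuous_intros)
      ultimately show "continuous_on (closure {0<..<1}) ?f"
        by (simp add: closure_greaterThanLessThan) (intro continuous_intros)
      show "?f y = 0" if "y \<in> {0<..<1}" for y
      proof -
        have "(?V y has_integral (w (y * s r) r - w (y * s c) c)) {c..r}"
        proof (rule fundamental_theorem_of_calculus)
          fix \<tau> assume "\<tau> \<in> {c..r}"
          then have "((\<lambda>r. w (y * s r) r) has_real_derivative ?V y \<tau>) (at \<tau>)"
            using that cd by (intro w_curve_deriv_interior) auto
          then show "((\<lambda>r. w (y * s r) r) has_vector_derivative ?V y \<tau>) (at \<tau> within {c..r})"
            using has_real_derivative_iff_has_vector_derivative has_vector_derivative_at_within by blast
        qed (use r in auto)
        then show ?thesis by (simp add: integral_unique)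
      qed
      show "y \<in> closure {0<..<1}" using y by (simp add: closure_greaterThanLessThan)
    qed
    then show ?thesis by simp
  qed
  have Vy: "continuous_on {c..d} (?V y)"
    using cd y by (intro continuous_intros continuous_on_scaled[OF wxx_cont] continuous_on_scaled[OF wx_cont] continuous_on_s'_comp) auto
  have "((\<lambda>r. integral {c..r} (?V y)) has_real_derivative ?V y t) (at t within {c..d})"
    using cd by (intro integral_has_real_derivative Vy) auto
  from DERIV_add[OF DERIV_const[of "w (y * s c) c"] this]
  have "((\<lambda>r. w (y * s c) c + integral {c..r} (?V y)) has_real_derivative ?V y t) (at t within {c..d})"
    by (simp only: add_0)
  then have "((\<lambda>r. w (y * s r) r) has_real_derivative ?V y t) (at t within {c..d})"
    by (rule has_field_derivative_transform_within[where d=1]; use cd eq[symmetric] in \<open>simp only: atLeastAtMost_iff less_imp_le zero_less_one\<close>)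
  then show ?thesis using cd by (simp add: at_within_Icc_at)
qed

lemma w_scaled_dx:
  assumes t: "t > 0" and y: "y \<in> {0..1}"
    and v: "\<And>x. 0 \<le> x \<Longrightarrow> x \<le> s t \<Longrightarrow> ((\<lambda>y. v y) has_real_derivative vx x) (at x within {0..s t})"
  shows "((\<lambda>y. v (y * s t)) has_real_derivative vx (y * s t) * s t) (at y within {0..1})"
proof -
  have im: "(\<lambda>y. y * s t) ` {0..1} \<subseteq> {0..s t}" using scaled_point[OF t] by auto
  have "(v has_real_derivative vx (y * s t)) (at (y * s t) within (\<lambda>y. y * s t) ` {0..1})"
    by (rule DERIV_subset[OF v im]) (use scaled_point[OF t y] in auto)
  moreover have "((\<lambda>y. y * s t) has_real_derivative s t) (at y within {0..1})"
    by (auto intro!: derivative_eq_intros)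
  ultimately have "((v \<circ> (\<lambda>y. y * s t)) has_real_derivative vx (y * s t) * s t) (at y within {0..1})"
    by (rule DERIV_image_chain)
  then show ?thesis by (simp add: o_def)
qed

text \<open>
  Green's identity for a solution \<open>p\<close> of the backward heat equation, \<open>p\<^sub>\<tau> = - p\<^sub>x\<^sub>x\<close>; the first assumption on \<open>p\<close>
  states it together with the chain rule. After the substitution \<open>x = y s(\<tau>)\<close> the differentiated integrand is the
  \<open>y\<close>-derivative of \<open>s' y w p + w\<^sub>x p - w p\<^sub>x\<close>, so only boundary terms remain, and \<open>w\<^sub>x\<close> vanishes on the curve.
\<close>

lemma green_deriv:
  fixes p px pxx :: "real \<Rightarrow> real \<Rightarrow> real"
  assumes \<tau>: "0 < \<tau>" "\<tau> < T"
    and p_comp: "\<And>X X' \<tau>. \<tau> < T \<Longrightarrow> (X has_real_derivative X') (at \<tau>) \<Longrightarrow>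
       ((\<lambda>\<tau>. p (X \<tau>) \<tau>) has_real_derivative px (X \<tau>) \<tau> * X' - pxx (X \<tau>) \<tau>) (at \<tau>)"
    and p_x: "\<And>x \<tau>. \<tau> < T \<Longrightarrow> ((\<lambda>x. p x \<tau>) has_real_derivative px x \<tau>) (at x)"
    and px_x: "\<And>x \<tau>. \<tau> < T \<Longrightarrow> ((\<lambda>x. px x \<tau>) has_real_derivative pxx x \<tau>) (at x)"
    and cont: "continuous_on (UNIV \<times> {..<T}) (\<lambda>q. p (fst q) (snd q))"
      "continuous_on (UNIV \<times> {..<T}) (\<lambda>q. px (fst q) (snd q))"
      "continuous_on (UNIV \<times> {..<T}) (\<lambda>q. pxx (fst q) (snd q))"
  shows "((\<lambda>\<tau>. integral {0..s \<tau>} (\<lambda>\<xi>. w \<xi> \<tau> * p \<xi> \<tau>)) has_real_derivative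
     w (s \<tau>) \<tau> * (s' \<tau> * p (s \<tau>) \<tau> - px (s \<tau>) \<tau>) - (wx 0 \<tau> * p 0 \<tau> - w 0 \<tau> * px 0 \<tau>)) (at \<tau>)"
proof -
  let ?W = "\<lambda>t y. w (y * s t) t" and ?Wx = "\<lambda>t y. wx (y * s t) t" and ?Wxx = "\<lambda>t y. wxx (y * s t) t"
  let ?P = "\<lambda>t y. p (y * s t) t" and ?Px = "\<lambda>t y. px (y * s t) t" and ?Pxx = "\<lambda>t y. pxx (y * s t) t"
  let ?B = "\<lambda>t y. s t * (?W t y * ?P t y)"
  let ?B' = "\<lambda>t y. s' t * (?W t y * ?P t y) + s t * ((?Wxx t y + y * s' t * ?Wx t y) * ?P t y + ?W t y * (?Px t y * (y * s' t) - ?Pxx t y))"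
  let ?U = "{0<..<T}"
  have cP: "continuous_on (?U \<times> cbox 0 1) (\<lambda>q. f (snd q * s (fst q)) (fst q))"
    if "continuous_on (UNIV \<times> {..<T}) (\<lambda>q. f (fst q) (snd q))" for f :: "real \<Rightarrow> real \<Rightarrow> real"
  proof -
    have "continuous_on (?U \<times> cbox 0 1) (\<lambda>q. (\<lambda>q. f (fst q) (snd q)) (snd q * s (fst q), fst q))"
      by (rule continuous_on_compose2[OF that]) (auto intro!: continuous_intros continuous_on_s_comp)
    then show ?thesis by simp
  qed
  have cW: "continuous_on (?U \<times> cbox 0 1) (\<lambda>q. v (snd q * s (fst q)) (fst q))"
    if "continuous_on {(x, t). 0 \<le> x \<and> x \<le> s t \<and> 0 < t} (\<lambda>(x, t). v x t)" for v :: "real \<Rightarrow> real \<Rightarrow> real"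
    by (rule continuous_on_scaled[OF that]) (auto intro!: continuous_intros)
  note cWs = cW[OF w_cont] cW[OF wx_cont] cW[OF wxx_cont] and cPs = cont[THEN cP]
  have cs: "continuous_on (?U \<times> cbox 0 (1::real)) (\<lambda>q. s (fst q))" "continuous_on (?U \<times> cbox 0 (1::real)) (\<lambda>q. s' (fst q))"
    by (auto intro!: continuous_on_s_comp continuous_on_s'_comp continuous_intros)
  have D: "((\<lambda>t. integral (cbox 0 1) (?B t)) has_real_derivative integral (cbox 0 1) (?B' \<tau>)) (at \<tau> within ?U)"
  proof (rule leibniz_rule_field_derivative)
    fix t y :: real assume t: "t \<in> ?U" and y: "y \<in> cbox 0 1"
    have "((\<lambda>t. y * s t) has_real_derivative y * s' t) (at t)"
      using s_deriv[of t] t by (auto intro!: derivative_eq_intros)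
    from p_comp[OF _ this] t have dp: "((\<lambda>t. ?P t y) has_real_derivative ?Px t y * (y * s' t) - ?Pxx t y) (at t)" by simp
    have dw: "((\<lambda>t. ?W t y) has_real_derivative ?Wxx t y + y * s' t * ?Wx t y) (at t)"
      using t y by (intro w_curve_deriv) auto
    have "((\<lambda>t. ?B t y) has_real_derivative s' t * (?W t y * ?P t y) +
       ((?Wxx t y + y * s' t * ?Wx t y) * ?P t y + (?Px t y * (y * s' t) - ?Pxx t y) * ?W t y) * s t) (at t)"
      using t by (intro DERIV_mult s_deriv dw dp) auto
    also have "s' t * (?W t y * ?P t y) + ((?Wxx t y + y * s' t * ?Wx t y) * ?P t y + (?Px t y * (y * s' t) - ?Pxx t y) * ?W t y) * s t = ?B' t y"
      by (simp add: mult_ac)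
    finally show "((\<lambda>t. ?B t y) has_real_derivative ?B' t y) (at t within ?U)" by (rule has_field_derivative_at_within)
  next
    fix t assume t: "t \<in> ?U"
    have "continuous_on (cbox 0 1) (\<lambda>y. ?B (fst (t, y)) (snd (t, y)))"
    proof (rule continuous_on_compose2[where f="\<lambda>y. (t, y)"])
      show "continuous_on (?U \<times> cbox 0 1) (\<lambda>q. ?B (fst q) (snd q))"
        by (intro continuous_intros cWs cPs cs)
    qed (use t in \<open>auto intro!: continuous_intros\<close>)
    then show "?B t integrable_on cbox 0 1" by (intro integrable_continuous) simp
  next
    show "continuous_on (?U \<times> cbox 0 1) (\<lambda>(t, y). ?B' t y)"
      unfolding case_prod_beta' by (intro continuous_intros cWs cPs cs)
  qed (use \<tau> in auto)
  have "(?B' \<tau> has_integral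
     (s' \<tau> * 1 * (?W \<tau> 1 * ?P \<tau> 1) + (?Wx \<tau> 1 * ?P \<tau> 1 - ?W \<tau> 1 * ?Px \<tau> 1)) -
     (s' \<tau> * 0 * (?W \<tau> 0 * ?P \<tau> 0) + (?Wx \<tau> 0 * ?P \<tau> 0 - ?W \<tau> 0 * ?Px \<tau> 0))) {0..1}"
  proof (rule fundamental_theorem_of_calculus)
    fix y :: real assume y: "y \<in> {0..1}"
    have dw: "(?W \<tau> has_real_derivative ?Wx \<tau> y * s \<tau>) (at y within {0..1})"
      using \<tau> by (intro w_scaled_dx y w_dx) auto
    have dwx: "(?Wx \<tau> has_real_derivative ?Wxx \<tau> y * s \<tau>) (at y within {0..1})"
      using \<tau> by (intro w_scaled_dx y wx_dx) auto
    have dp: "(?P \<tau> has_real_derivative ?Px \<tau> y * s \<tau>) (at y within {0..1})"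
      using \<tau> by (intro w_scaled_dx y has_field_derivative_at_within[OF p_x]) auto
    have dpx: "(?Px \<tau> has_real_derivative ?Pxx \<tau> y * s \<tau>) (at y within {0..1})"
      using \<tau> by (intro w_scaled_dx y has_field_derivative_at_within[OF px_x]) auto
    have "((\<lambda>y. s' \<tau> * y * (?W \<tau> y * ?P \<tau> y) + (?Wx \<tau> y * ?P \<tau> y - ?W \<tau> y * ?Px \<tau> y)) has_real_derivative ?B' \<tau> y) (at y within {0..1})"
      by (rule derivative_eq_intros dw dwx dp dpx refl | simp add: algebra_simps)+
    then show "((\<lambda>y. s' \<tau> * y * (?W \<tau> y * ?P \<tau> y) + (?Wx \<tau> y * ?P \<tau> y - ?W \<tau> y * ?Px \<tau> y)) has_vector_derivative ?B' \<tau> y) (at y within {0..1})"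
      by (simp add: has_real_derivative_iff_has_vector_derivative)
  qed simp
  then have I: "integral (cbox 0 1) (?B' \<tau>) = w (s \<tau>) \<tau> * (s' \<tau> * p (s \<tau>) \<tau> - px (s \<tau>) \<tau>) - (wx 0 \<tau> * p 0 \<tau> - w 0 \<tau> * px 0 \<tau>)"
    using neumann[OF \<tau>(1)] by (simp add: integral_unique algebra_simps)
  have "((\<lambda>t. integral {0..1} (?B t)) has_real_derivative integral (cbox 0 1) (?B' \<tau>)) (at \<tau>)"
    using D \<tau> by (simp add: at_within_open[of \<tau> ?U])
  then have "((\<lambda>t. integral {0..s t} (\<lambda>\<xi>. w \<xi> t * p \<xi> t)) has_real_derivative integral (cbox 0 1) (?B' \<tau>)) (at \<tau>)"
  proof (rule has_field_derivative_transform_within_open[of _ _ _ ?U])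
    fix t assume t: "t \<in> ?U"
    have "continuous_on {0..s t} (\<lambda>x. w x t)"
      using t by (intro continuous_on_below[OF w_cont] continuous_intros) auto
    moreover have "continuous_on {0..s t} (\<lambda>x. p x t)"
      using t by (intro DERIV_continuous_on[where D="\<lambda>x. px x t"] has_field_derivative_at_within[OF p_x]) auto
    ultimately have "integral {0..s t} (\<lambda>\<xi>. w \<xi> t * p \<xi> t) = s t * integral {0..1} (\<lambda>y. ?W t y * ?P t y)"
      using t s_pos[of t] by (intro integral_stretch continuous_intros) auto
    then show "integral {0..1} (?B t) = integral {0..s t} (\<lambda>\<xi>. w \<xi> t * p \<xi> t)" by simp
  qed (use \<tau> in auto)
  then show ?thesis by (simp only: I)
qed

end

section \<open>The error function kernel and the limit at the final time\<close>

text \<open>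
  The solution \<open>erf (x / (2 sqrt r))\<close> of the heat equation with zero boundary value and initial value 1. The value 1
  for \<open>r \<le> 0\<close> makes it smooth in \<open>r\<close> for each \<open>x > 0\<close>.
\<close>

definition erfk :: "real \<Rightarrow> real \<Rightarrow> real" where
  "erfk x r = (if r > 0 then Psi 0 (x / sqrt r) / Psi_lim 0 else 1)"

lemma erfk_zero: "r > 0 \<Longrightarrow> erfk 0 r = 0"
  by (simp add: erfk_def)

lemma erfk_le_1: "0 \<le> x \<Longrightarrow> erfk x r \<le> 1"
  using Psi_lim_0_pos Psi_le_lim[of "x / sqrt r" 0] by (simp add: erfk_def)

lemma erfk_tail:
  assumes "x > 0" "r < x\<^sup>2"
  shows "\<bar>erfk x r - 1\<bar> \<le> 2 / Psi_lim 0 * gauss 0 0 x r"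
proof (cases "r > 0")
  case True
  then have "sqrt r \<le> x" using assms by (intro real_le_lsqrt) auto
  then have z: "x / sqrt r \<ge> 1" using True by simp
  have "1 - erfk x r = (Psi_lim 0 - Psi 0 (x / sqrt r)) / Psi_lim 0"
    using True Psi_lim_0_pos by (simp add: erfk_def diff_divide_distrib)
  also have "\<dots> \<le> 2 * exp (- (x / sqrt r)\<^sup>2 / 4) / Psi_lim 0"
    using Psi_tail[OF z] Psi_lim_0_pos by (intro divide_right_mono) auto
  also have "\<dots> = 2 / Psi_lim 0 * gauss 0 0 x r" using True by (simp add: gauss_def power_divide mult.commute)
  finally show ?thesis using erfk_le_1[of x r] assms by simp
qed (simp add: erfk_def gauss_def)

text \<open>
  The bound is written with a Cauchy kernel so that its integral over \<open>x\<close> is visibly \<open>O(sqrt r)\<close>.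
\<close>

lemma erfk_Cauchy_bound: "\<exists>C. \<forall>x\<ge>0. \<forall>r>0. \<bar>erfk x r - 1\<bar> \<le> C * (sqrt r * (sqrt r / (r + x\<^sup>2)))"
proof -
  define C where "C = 16 / Psi_lim 0 + 2"
  have "\<bar>erfk x r - 1\<bar> \<le> C * (sqrt r * (sqrt r / (r + x\<^sup>2)))" if x: "x \<ge> 0" and r: "r > 0" for x r
  proof -
    have pos: "r + x\<^sup>2 > 0" using r by (simp add: add_pos_nonneg)
    have sr: "sqrt r * (sqrt r / (r + x\<^sup>2)) = r / (r + x\<^sup>2)" using r by simp
    have L: "Psi_lim 0 > 0" by (rule Psi_lim_0_pos)
    show ?thesis
    proof (cases "r < x\<^sup>2")
      case True
      then have "x > 0" using x r by (cases "x = 0") auto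
      have G: "gauss 0 0 x r \<le> 8 * (r / (r + x\<^sup>2))"
      proof -
        have "psi 0 (x / sqrt r) \<le> 8 / (1 + (x / sqrt r)\<^sup>2)" using psi_le[of 0 "x / sqrt r"] by simp
        moreover have "1 + (x / sqrt r)\<^sup>2 = (r + x\<^sup>2) / r" using r by (simp add: power_divide field_simps)
        ultimately show ?thesis using r by (simp add: gauss_def psi_def power_divide mult.commute[of 4])
      qed
      have "\<bar>erfk x r - 1\<bar> \<le> 2 / Psi_lim 0 * gauss 0 0 x r" by (rule erfk_tail[OF \<open>x > 0\<close> True])
      also have "\<dots> \<le> 2 / Psi_lim 0 * (8 * (r / (r + x\<^sup>2)))"
        using L by (intro mult_left_mono G) simp
      also have "2 / Psi_lim 0 * (8 * (r / (r + x\<^sup>2))) = 16 / Psi_lim 0 * (r / (r + x\<^sup>2))" by simp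
      also have "\<dots> \<le> C * (r / (r + x\<^sup>2))" using r pos by (intro mult_right_mono) (auto simp: C_def)
      finally show ?thesis unfolding sr .
    next
      case False
      have "0 \<le> erfk x r" using r x L Psi_mono[of 0 "x / sqrt r" 0] by (simp add: erfk_def)
      then have "\<bar>erfk x r - 1\<bar> \<le> 1" using erfk_le_1[OF x, of r] by simp
      also have "1 \<le> 2 * (r / (r + x\<^sup>2))" using False pos by (simp add: field_simps)
      also have "\<dots> \<le> C * (r / (r + x\<^sup>2))" using r pos L by (intro mult_right_mono) (auto simp: C_def)
      finally show ?thesis unfolding sr .
    qed
  qed
  then show ?thesis by blast
qed

lemma isCont_erfk:
  assumes "x > 0 \<or> r > 0"
  shows "isCont (\<lambda>p. erfk (fst p) (snd p)) (x, r)"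
proof -
  consider "r > 0" | "r < 0" | "r = 0" "x > 0" using assms by linarith
  then show ?thesis
  proof cases
    case 1
    have "open {p::real \<times> real. snd p > 0}" by (intro open_Collect_less continuous_intros)
    then have ev: "eventually (\<lambda>p. Psi 0 (fst p / sqrt (snd p)) / Psi_lim 0 = erfk (fst p) (snd p)) (nhds (x, r))"
      unfolding eventually_nhds using 1 by (intro exI[of _ "{p. snd p > 0}"]) (auto simp: erfk_def)
    have "isCont (\<lambda>p. fst p / sqrt (snd p)) (x, r)"
      using 1 by (intro continuous_intros) auto
    from isCont_o2[OF this isCont_Psi]
    have "isCont (\<lambda>p. Psi 0 (fst p / sqrt (snd p)) / Psi_lim 0) (x, r)"
      using Psi_lim_0_pos by (intro continuous_intros) auto
    then show ?thesis by (subst (asm) isCont_cong[OF ev])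
  next
    case 2
    have "open {p::real \<times> real. snd p < 0}" by (intro open_Collect_less continuous_intros)
    then have ev: "eventually (\<lambda>p. 1 = erfk (fst p) (snd p)) (nhds (x, r))"
      unfolding eventually_nhds using 2 by (intro exI[of _ "{p. snd p < 0}"]) (auto simp: erfk_def)
    have "isCont (\<lambda>p. 1::real) (x, r)" by simp
    then show ?thesis by (subst (asm) isCont_cong[OF ev])
  next
    case 3
    let ?b = "\<lambda>p::real\<times>real. 2 / Psi_lim 0 * gauss 0 0 (fst p) (snd p)"
    have "isCont ?b (x, r)" using 3 by (intro continuous_intros isCont_gauss) auto
    then have b0: "(?b \<longlongrightarrow> 0) (at (x, r))" using 3 by (simp add: isCont_def gauss_def[of 0 0 x 0])
    have "open ({p::real \<times> real. snd p < (fst p)\<^sup>2} \<inter> {p. 0 < fst p})"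
      by (intro open_Int open_Collect_less continuous_intros)
    then have "eventually (\<lambda>p. p \<in> {p::real \<times> real. snd p < (fst p)\<^sup>2} \<inter> {p. 0 < fst p}) (nhds (x, r))"
      using 3 by (intro eventually_nhds_in_open) auto
    then have "eventually (\<lambda>p. norm (erfk (fst p) (snd p) - 1) \<le> ?b p) (at (x, r))"
      unfolding real_norm_def
      by (intro filter_leD[OF at_within_le_nhds]) (elim eventually_mono, rule erfk_tail, auto)
    from Lim_null_comparison[OF this b0] have "((\<lambda>p. erfk (fst p) (snd p)) \<longlongrightarrow> 1) (at (x, r))"
      by (simp add: LIM_zero_iff)
    then show ?thesis using 3 by (simp add: isCont_def erfk_def[of x 0])
  qed
qed

lemma continuous_on_erfk:
  assumes "continuous_on A f" "continuous_on A g" "\<And>a. a \<in> A \<Longrightarrow> f a > 0 \<or> g a > 0"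
  shows "continuous_on A (\<lambda>a. erfk (f a) (g a))"
proof -
  have "continuous_on {p. fst p > 0 \<or> snd p > 0} (\<lambda>p. erfk (fst p) (snd p))"
    by (intro continuous_at_imp_continuous_on) (auto intro: isCont_erfk)
  then have "continuous_on A (\<lambda>a. erfk (fst (f a, g a)) (snd (f a, g a)))"
  proof (rule continuous_on_compose2[where f="\<lambda>a. (f a, g a)"])
    show "continuous_on A (\<lambda>a. (f a, g a))" using assms(1,2) by (intro continuous_intros)
    show "(\<lambda>a. (f a, g a)) ` A \<subseteq> {p. fst p > 0 \<or> snd p > 0}" using assms(3) by fastforce
  qed
  then show ?thesis by simp
qed

lemma erfk_deriv_pos:
  assumes x: "(x has_real_derivative x') (at t within U)" and r: "(r has_real_derivative r') (at t within U)" "r t > 0"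
  shows "((\<lambda>t. erfk (x t) (r t)) has_real_derivative
     x' * (gauss 0 1 (x t) (r t) / Psi_lim 0) - r' * (gauss 1 3 (x t) (r t) / (2 * Psi_lim 0))) (at t within U)"
proof -
  define R where "R = sqrt (r t)"
  have R: "R > 0" "r t = R\<^sup>2" using r(2) by (auto simp: R_def)
  have "((\<lambda>t. x t / sqrt (r t)) has_real_derivative x' / R - r' * x t / (2 * R ^ 3)) (at t within U)"
    using r(2) R by (auto intro!: derivative_eq_intros x r(1) simp: R_def[symmetric] field_simps power2_eq_square power3_eq_cube)
  from DERIV_cdivide[OF Psi_deriv_comp[OF this, of 0], of "Psi_lim 0"]
  have "((\<lambda>t. Psi 0 (x t / sqrt (r t)) / Psi_lim 0) has_real_derivative
     psi 0 (x t / R) * (x' / R - r' * x t / (2 * R ^ 3)) / Psi_lim 0) (at t within U)"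
    by (simp add: R_def)
  also have "psi 0 (x t / R) * (x' / R - r' * x t / (2 * R ^ 3)) / Psi_lim 0 =
     x' * (gauss 0 1 (x t) (r t) / Psi_lim 0) - r' * (gauss 1 3 (x t) (r t) / (2 * Psi_lim 0))"
    using R by (simp add: gauss_def psi_def power_divide diff_divide_distrib left_diff_distrib right_diff_distrib mult_ac)
  finally have D: "((\<lambda>t. Psi 0 (x t / sqrt (r t)) / Psi_lim 0) has_real_derivative
     x' * (gauss 0 1 (x t) (r t) / Psi_lim 0) - r' * (gauss 1 3 (x t) (r t) / (2 * Psi_lim 0))) (at t within U)" .
  have "(r \<longlongrightarrow> r t) (at t within U)" using r(1) DERIV_continuous continuous_within by blast
  from order_tendstoD(1)[OF this r(2)]
  have "eventually (\<lambda>s. Psi 0 (x s / sqrt (r s)) / Psi_lim 0 = erfk (x s) (r s)) (at t within U)"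
    by eventually_elim (simp add: erfk_def)
  from has_field_derivative_cong_eventually[OF this] D show ?thesis using r(2) by (simp add: erfk_def)
qed

text \<open>
  At \<open>r = 0\<close> the deviation from 1 is dominated by a Gaussian kernel, which is flat there.
\<close>

lemma erfk_deriv:
  assumes r: "(r has_real_derivative r') (at t within U)" and nz: "x > 0 \<or> r t > 0"
  shows "((\<lambda>t. erfk x (r t)) has_real_derivative - 1 / (2 * Psi_lim 0) * (r' * gauss 1 3 x (r t))) (at t within U)"
proof -
  have cr: "(r \<longlongrightarrow> r t) (at t within U)" using r DERIV_continuous continuous_within by blast
  consider "r t > 0" | "r t < 0" | "r t = 0" "x > 0" using nz by linarith
  then show ?thesis
  proof cases
    case 1
    from erfk_deriv_pos[OF DERIV_const r this, of x] show ?thesis by (simp add: mult_ac)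
  next
    case 2
    have "eventually (\<lambda>s. 1 = erfk x (r s)) (at t within U)"
      using order_tendstoD(2)[OF cr 2] by eventually_elim (simp add: erfk_def)
    then have "((\<lambda>t. erfk x (r t)) has_real_derivative 0) (at t within U)"
      using has_field_derivative_cong_eventually[of "\<lambda>_. 1"] 2 by (fastforce simp: erfk_def)
    then show ?thesis using 2 by (simp add: gauss_def)
  next
    case 3
    have "((\<lambda>t. gauss 0 0 x (r t)) has_real_derivative 0 * gauss_x 0 0 x (r t) + r' * gauss_r 0 0 x (r t)) (at t within U)"
      using 3 by (intro gauss_has_derivative[of "\<lambda>_. x"] r) auto
    then have "((\<lambda>s. (gauss 0 0 x (r s) - 0) / (s - t)) \<longlongrightarrow> 0) (at t within U)"
      using 3 by (simp add: has_field_derivative_iff gauss_r_def gauss_def[of _ _ x 0])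
    then have lim: "((\<lambda>s. 2 / Psi_lim 0 * \<bar>(gauss 0 0 x (r s) - 0) / (s - t)\<bar>) \<longlongrightarrow> 0) (at t within U)"
      by (intro tendsto_mult_right_zero tendsto_rabs_zero)
    have "r t < x\<^sup>2" using 3 by simp
    from order_tendstoD(2)[OF cr this]
    have "eventually (\<lambda>s. norm ((erfk x (r s) - 1) / (s - t)) \<le> 2 / Psi_lim 0 * \<bar>(gauss 0 0 x (r s) - 0) / (s - t)\<bar>) (at t within U)"
    proof eventually_elim
      fix s assume "r s < x\<^sup>2"
      from erfk_tail[OF 3(2) this] have "\<bar>erfk x (r s) - 1\<bar> / \<bar>s - t\<bar> \<le> 2 / Psi_lim 0 * gauss 0 0 x (r s) / \<bar>s - t\<bar>"
        by (rule divide_right_mono) simp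
      moreover have "gauss 0 0 x (r s) \<ge> 0" by (simp add: gauss_def)
      ultimately show "norm ((erfk x (r s) - 1) / (s - t)) \<le> 2 / Psi_lim 0 * \<bar>(gauss 0 0 x (r s) - 0) / (s - t)\<bar>"
        by (simp add: abs_divide)
    qed
    from Lim_null_comparison[OF this lim] show ?thesis
      using 3 by (simp add: has_field_derivative_iff gauss_def erfk_def[of x 0])
  qed
qed

lemma cdiff_erfk:
  assumes X: "continuous_on Y X" and R: "cdiff n (\<lambda>_. 1) U Y R"
    and nz: "\<And>t y. t \<in> U \<Longrightarrow> y \<in> Y \<Longrightarrow> X y > 0 \<or> R t y > 0"
  shows "cdiff n (\<lambda>_. 1) U Y (\<lambda>t y. erfk (X y) (R t y))"
proof -
  have cX: "continuous_on (U \<times> Y) (\<lambda>p. X (snd p))"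
    by (rule continuous_on_compose2[OF X]) (auto intro!: continuous_intros)
  have c: "continuous_on (U \<times> Y) (\<lambda>p. erfk (X (snd p)) (R (fst p) (snd p)))"
    by (intro continuous_on_erfk cX cdiff_cont[OF R] nz) auto
  show ?thesis
  proof (cases n)
    case 0
    then show ?thesis using c by simp
  next
    case (Suc m)
    with R obtain R' where R': "deriv_along (\<lambda>_. 1) U Y R R'" "continuous_on (U \<times> Y) (\<lambda>p. R (fst p) (snd p))" "cdiff m (\<lambda>_. 1) U Y R'"
      by (auto elim: cdiff_SucE)
    have d: "deriv_along (\<lambda>_. 1) U Y (\<lambda>t y. erfk (X y) (R t y)) (\<lambda>t y. - 1 / (2 * Psi_lim 0) * (R' t y * gauss 1 3 (X y) (R t y)))"
    proof (intro ballI conjI impI)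
      fix t y assume "t \<in> U" "y \<in> Y"
      then show "((\<lambda>t. erfk (X y) (R t y)) has_real_derivative
        - 1 / (2 * Psi_lim 0) * (R' t y * gauss 1 3 (X y) (R t y)) / 1) (at t within U)"
        unfolding div_by_1 using R'(1) by (intro erfk_deriv nz) auto
    qed auto
    have e: "cdiff m (\<lambda>_. 1) U Y (\<lambda>t y. - 1 / (2 * Psi_lim 0) * (R' t y * gauss 1 3 (X y) (R t y)))"
    proof (intro cdiff_cmult cdiff_mult R' cdiff_gauss cdiff_const_t X)
      show "cdiff m (\<lambda>_. 1) U Y R" using R Suc cdiff_Suc_imp by blast
      show "X y \<noteq> 0 \<or> R t y \<noteq> 0" if "t \<in> U" "y \<in> Y" for t y using nz[OF that] by auto
    qed
    show ?thesis unfolding Suc by (rule cdiff_SucI[OF d c e])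
  qed
qed

text \<open>
  Integration of a derivative up to a final time where it may blow up like \<open>(T - \<tau>) powr (-1/2)\<close>: in the variable
  \<open>\<rho> = sqrt (T - \<tau>)\<close> the integrand \<open>b\<close> has no singularity.
\<close>

lemma parabolic_FTC:
  fixes E E' b :: "real \<Rightarrow> real"
  assumes a: "0 < a" "a < T"
    and E: "\<And>\<tau>. 0 < \<tau> \<Longrightarrow> \<tau> < T \<Longrightarrow> (E has_real_derivative E' \<tau>) (at \<tau>)"
    and b: "\<And>\<rho>. 0 < \<rho> \<Longrightarrow> \<rho> < sqrt (T - a) \<Longrightarrow> b \<rho> = 2 * \<rho> * E' (T - \<rho>\<^sup>2)"
    and lim: "(E \<longlongrightarrow> e0) (at_left T)"
  shows "e0 = E a + integral {0..sqrt (T - a)} b"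
proof -
  let ?R = "sqrt (T - a)"
  have R: "?R > 0" "?R\<^sup>2 = T - a" using a by auto
  define H where "H = (\<lambda>\<rho>. if \<rho> = 0 then e0 else E (T - \<rho>\<^sup>2))"
  have sq: "0 < T - \<rho>\<^sup>2" "T - \<rho>\<^sup>2 < T" if "0 < \<rho>" "\<rho> \<le> ?R" for \<rho>
  proof -
    have "\<rho>\<^sup>2 \<le> ?R\<^sup>2" using that by (intro power_mono) auto
    then show "0 < T - \<rho>\<^sup>2" using a R(2) by linarith
    show "T - \<rho>\<^sup>2 < T" using that by simp
  qed
  have dE: "((\<lambda>\<rho>. E (T - \<rho>\<^sup>2)) has_real_derivative E' (T - \<rho>\<^sup>2) * (- (2 * \<rho>))) (at \<rho>)" if "0 < \<rho>" "\<rho> \<le> ?R" for \<rho>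
    by (rule DERIV_chain2[where g="\<lambda>\<rho>. T - \<rho>\<^sup>2" and x=\<rho>, OF E[OF sq[OF that]]]) (auto intro!: derivative_eq_intros)
  have H_eq: "eventually (\<lambda>r. E (T - r\<^sup>2) = H r) (nhds \<rho>)" if "0 < \<rho>" for \<rho>
  proof -
    have "eventually (\<lambda>r. r \<in> {0<..}) (nhds \<rho>)" using that by (intro eventually_nhds_in_open) auto
    then show ?thesis by eventually_elim (simp add: H_def)
  qed
  have dH: "(H has_real_derivative - b \<rho>) (at \<rho>)" if "0 < \<rho>" "\<rho> < ?R" for \<rho>
  proof -
    have "(H has_real_derivative E' (T - \<rho>\<^sup>2) * (- (2 * \<rho>))) (at \<rho>)"
      using dE[of \<rho>] that DERIV_cong_ev[OF refl H_eq[OF that(1)] refl] by simp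
    then show ?thesis using b[OF that] by (simp add: mult_ac)
  qed
  have "continuous (at \<rho> within {0..?R}) H" if "\<rho> \<in> {0..?R}" for \<rho>
  proof (cases "\<rho> = 0")
    case True
    have "filterlim (\<lambda>\<rho>. T - \<rho>\<^sup>2) (at_left T) (at_right 0)"
      by (rule filterlim_at_withinI) (auto intro!: tendsto_eq_intros simp: eventually_at_filter)
    then have "((\<lambda>\<rho>. E (T - \<rho>\<^sup>2)) \<longlongrightarrow> e0) (at_right 0)"
      by (rule filterlim_compose[OF lim])
    then have "(H \<longlongrightarrow> e0) (at_right 0)"
      by (rule Lim_transform_eventually) (auto simp: H_def eventually_at_filter)
    moreover have "at 0 within {0..?R} = at_right 0" by (rule at_within_Icc_at_right[OF R(1)])
    ultimately show ?thesis using True by (simp add: continuous_within H_def)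
  next
    case False
    then have "isCont H \<rho>"
      using dE[of \<rho>] that DERIV_cong_ev[OF refl H_eq refl] by (auto intro: DERIV_isCont)
    then show ?thesis by (rule continuous_at_imp_continuous_at_within)
  qed
  then have cH: "continuous_on {0..?R} H" by (simp add: continuous_on_eq_continuous_within)
  have "((\<lambda>\<rho>. - b \<rho>) has_integral (H ?R - H 0)) {0..?R}"
    using R(1) dH by (intro fundamental_theorem_of_calculus_interior cH)
       (auto simp: has_real_derivative_iff_has_vector_derivative[symmetric])
  from has_integral_neg[OF this] have "integral {0..?R} b = H 0 - H ?R"
    by (simp add: integral_unique)
  moreover have "H ?R = E a" "H 0 = e0" using R by (auto simp: H_def)
  ultimately show ?thesis by simp
qed

lemma integral_lag_substitution:
  fixes f :: "real \<Rightarrow> real"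
  assumes "a \<le> T" "continuous_on {a..T} f"
  shows "integral {0..sqrt (T - a)} (\<lambda>\<rho>. 2 * \<rho> * f (T - \<rho>\<^sup>2)) = integral {a..T} f"
proof -
  let ?R = "sqrt (T - a)" and ?F = "\<lambda>x. integral {a..x} f"
  have R: "?R \<ge> 0" "?R\<^sup>2 = T - a" using assms(1) by auto
  have sq: "\<rho>\<^sup>2 \<le> T - a" if "\<rho> \<in> {0..?R}" for \<rho>
    using that R power_mono[of \<rho> ?R 2] by auto
  have im: "(\<lambda>\<rho>. T - \<rho>\<^sup>2) ` {0..?R} \<subseteq> {a..T}" using sq by fastforce
  have "((\<lambda>\<rho>. 2 * \<rho> * f (T - \<rho>\<^sup>2)) has_integral (- ?F (T - ?R\<^sup>2) - - ?F (T - 0\<^sup>2))) {0..?R}"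
  proof (rule fundamental_theorem_of_calculus[OF R(1)])
    fix \<rho> assume \<rho>: "\<rho> \<in> {0..?R}"
    have "(?F has_real_derivative f (T - \<rho>\<^sup>2)) (at (T - \<rho>\<^sup>2) within (\<lambda>\<rho>. T - \<rho>\<^sup>2) ` {0..?R})"
      by (rule DERIV_subset[OF integral_has_real_derivative[OF assms(2)] im]) (rule subsetD[OF im imageI[OF \<rho>]])
    moreover have "((\<lambda>\<rho>. T - \<rho>\<^sup>2) has_real_derivative - (2 * \<rho>)) (at \<rho> within {0..?R})"
      by (auto intro!: derivative_eq_intros)
    ultimately have "((?F \<circ> (\<lambda>\<rho>. T - \<rho>\<^sup>2)) has_real_derivative f (T - \<rho>\<^sup>2) * - (2 * \<rho>)) (at \<rho> within {0..?R})"
      by (rule DERIV_image_chain)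
    from DERIV_minus[OF this] show "((\<lambda>\<rho>. - ?F (T - \<rho>\<^sup>2)) has_vector_derivative 2 * \<rho> * f (T - \<rho>\<^sup>2)) (at \<rho> within {0..?R})"
      by (simp add: o_def has_real_derivative_iff_has_vector_derivative[symmetric] mult_ac)
  qed
  from integral_unique[OF this] show ?thesis using R by simp
qed

section \<open>The mass and the boundary trace of the solution\<close>

lemma cdiff_ident: "cdiff n (\<lambda>_. 1) U Y (\<lambda>t y. t)"
proof -
  have "cdiff_fun n (\<lambda>_. 1) U (\<lambda>t. t)"
  proof (cases n)
    case 0
    then show ?thesis by (auto intro: continuous_intros)
  next
    case (Suc m)
    have "cdiff_fun (Suc m) (\<lambda>_. 1) U (\<lambda>t. t)"
      by (rule cdiff_fun_antiderivative[OF _ cdiff_const[of m _ _ _ 1]]) simp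
    then show ?thesis using Suc by simp
  qed
  then show ?thesis by (rule cdiff_fun_param)
qed

lemma cdiff_lag: "cdiff n (\<lambda>_. 1) U Y (\<lambda>t y. t - y)"
  by (intro cdiff_diff cdiff_ident cdiff_const_t continuous_on_id)

lemma cdiff_fun_integral:
  fixes B :: "real \<Rightarrow> real \<Rightarrow> real"
  assumes "cdiff n \<omega> U {a..b} B" "convex U" "continuous_on U \<omega>"
  shows "cdiff_fun n \<omega> U (\<lambda>t. integral {a..b} (B t))"
proof -
  have "cdiff n \<omega> U ({0::real} \<times> {a..b}) (\<lambda>t p. B t (snd p))"
    by (rule cdiff_param[OF assms(1)]) (auto intro!: continuous_intros)
  from cdiff_integral[OF this assms(2,3)] show ?thesis by simp
qed

context heat_below_curve
begin

definition trace :: "real \<Rightarrow> real" where "trace t = w (s t) t"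

definition mass :: "real \<Rightarrow> real" where "mass t = integral {0..s t} (\<lambda>\<xi>. w \<xi> t)"

lemma trace_cont: "continuous_on {0<..} trace"
  unfolding trace_def
  by (intro continuous_on_below[OF w_cont] s_cont continuous_intros) (use s_pos in \<open>auto intro: less_imp_le\<close>)

lemma left_cont: "continuous_on {0<..} (w 0)" "continuous_on {0<..} (wx 0)"
  by (intro continuous_on_below[OF w_cont] continuous_on_below[OF wx_cont] continuous_intros;
      use s_pos in \<open>auto intro: less_imp_le\<close>)+

lemma section_cont: "t > 0 \<Longrightarrow> continuous_on {0..s t} (\<lambda>\<xi>. w \<xi> t)"
  by (intro continuous_on_below[OF w_cont] continuous_intros) auto

lemma w_bounded:
  assumes "0 < a"
  shows "\<exists>B. \<forall>\<tau>\<in>{a..T}. \<forall>\<xi>\<in>{0..s \<tau>}. \<bar>w \<xi> \<tau>\<bar> \<le> B"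
proof -
  have "continuous_on ({0..1} \<times> {a..T}) (\<lambda>p. w (fst p * s (snd p)) (snd p))"
    using assms by (intro continuous_on_scaled[OF w_cont] continuous_intros) auto
  then have "bounded ((\<lambda>p. w (fst p * s (snd p)) (snd p)) ` ({0..1} \<times> {a..T}))"
    by (intro compact_imp_bounded compact_continuous_image compact_Times compact_Icc)
  then obtain B where B: "\<forall>p\<in>{0..1} \<times> {a..T}. \<bar>w (fst p * s (snd p)) (snd p)\<bar> \<le> B"
    by (auto simp: bounded_iff)
  have "\<bar>w \<xi> \<tau>\<bar> \<le> B" if "\<tau> \<in> {a..T}" "\<xi> \<in> {0..s \<tau>}" for \<tau> \<xi>
  proof -
    have "s \<tau> > 0" using that assms by (intro s_pos) auto
    then have "\<xi> / s \<tau> \<in> {0..1}" "\<xi> / s \<tau> * s \<tau> = \<xi>" using that by auto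
    then show ?thesis using bspec[OF B, of "(\<xi> / s \<tau>, \<tau>)"] that by auto
  qed
  then show ?thesis by blast
qed

text \<open>
  Green's identity with \<open>p = 1\<close>.
\<close>

lemma mass_deriv:
  assumes "0 < t" shows "(mass has_real_derivative trace t * s' t - wx 0 t) (at t)"
proof -
  have "((\<lambda>\<tau>. integral {0..s \<tau>} (\<lambda>\<xi>. w \<xi> \<tau> * 1)) has_real_derivative
     w (s t) t * (s' t * 1 - 0) - (wx 0 t * 1 - w 0 t * 0)) (at t)"
    by (rule green_deriv[where T="t + 1" and pxx="\<lambda>_ _. 0"]) (use assms in auto)
  then show ?thesis by (simp add: mass_def[abs_def] trace_def)
qed

lemma mass_kernel_limit:
  assumes "0 < T"
  shows "((\<lambda>\<tau>. integral {0..s \<tau>} (\<lambda>\<xi>. w \<xi> \<tau> * erfk \<xi> (T - \<tau>))) \<longlongrightarrow> mass T) (at_left T)"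
proof -
  obtain C where C: "\<forall>x\<ge>0. \<forall>r>0. \<bar>erfk x r - 1\<bar> \<le> C * (sqrt r * (sqrt r / (r + x\<^sup>2)))"
    using erfk_Cauchy_bound by blast
  have C0: "C \<ge> 0"
  proof -
    have "\<bar>erfk 0 1 - 1\<bar> \<le> C * (sqrt 1 * (sqrt 1 / (1 + 0\<^sup>2)))" using C by (metis order_refl zero_less_one)
    then show ?thesis by simp
  qed
  obtain B where B: "\<forall>\<tau>\<in>{T/2..T}. \<forall>\<xi>\<in>{0..s \<tau>}. \<bar>w \<xi> \<tau>\<bar> \<le> B"
    using w_bounded[of "T/2" T] assms by auto
  have ev: "eventually (\<lambda>\<tau>. \<tau> \<in> {T/2<..<T}) (at_left T)"
    using assms by (intro eventually_at_left_real) simp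
  have bound: "norm (integral {0..s \<tau>} (\<lambda>\<xi>. w \<xi> \<tau> * erfk \<xi> (T - \<tau>)) - mass \<tau>) \<le> \<bar>B\<bar> * C * pi * sqrt (T - \<tau>)"
    if \<tau>: "\<tau> \<in> {T/2<..<T}" for \<tau>
  proof -
    define r where "r = T - \<tau>"
    have r: "r > 0" "0 < \<tau>" using \<tau> assms by (auto simp: r_def)
    have s0: "0 \<le> s \<tau>" using s_pos[OF r(2)] by simp
    have cw: "continuous_on {0..s \<tau>} (\<lambda>\<xi>. w \<xi> \<tau>)" using r by (intro section_cont) 
    have cQ: "continuous_on {0..s \<tau>} (\<lambda>\<xi>. erfk \<xi> r)" using r by (intro continuous_on_erfk continuous_intros) auto
    have "integral {0..s \<tau>} (\<lambda>\<xi>. w \<xi> \<tau> * erfk \<xi> r) - mass \<tau> = integral {0..s \<tau>} (\<lambda>\<xi>. w \<xi> \<tau> * erfk \<xi> r - w \<xi> \<tau>)"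
      unfolding mass_def by (intro integral_diff[symmetric] integrable_continuous_interval continuous_intros cw cQ)
    also have "norm \<dots> \<le> integral {0..s \<tau>} (\<lambda>\<xi>. \<bar>B\<bar> * (C * sqrt r) * (sqrt r / (r + (0 - \<xi>)\<^sup>2)))"
    proof (rule integral_norm_bound_integral)
      show "(\<lambda>\<xi>. w \<xi> \<tau> * erfk \<xi> r - w \<xi> \<tau>) integrable_on {0..s \<tau>}"
        by (intro integrable_continuous_interval continuous_intros cw cQ)
      show "(\<lambda>\<xi>. \<bar>B\<bar> * (C * sqrt r) * (sqrt r / (r + (0 - \<xi>)\<^sup>2))) integrable_on {0..s \<tau>}"
        by (rule has_integral_integrable[OF has_integral_mult_right[OF integral_Cauchy_kernel[OF r(1) s0]]])
      fix \<xi> assume \<xi>: "\<xi> \<in> {0..s \<tau>}"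
      have "\<bar>w \<xi> \<tau>\<bar> \<le> \<bar>B\<bar>" using bspec[OF bspec[OF B], of \<tau> \<xi>] \<tau> \<xi> by auto
      moreover have "\<bar>erfk \<xi> r - 1\<bar> \<le> C * (sqrt r * (sqrt r / (r + \<xi>\<^sup>2)))" using C \<xi> r by auto
      ultimately have "\<bar>w \<xi> \<tau>\<bar> * \<bar>erfk \<xi> r - 1\<bar> \<le> \<bar>B\<bar> * (C * (sqrt r * (sqrt r / (r + \<xi>\<^sup>2))))"
        by (intro mult_mono) auto
      moreover have "w \<xi> \<tau> * erfk \<xi> r - w \<xi> \<tau> = w \<xi> \<tau> * (erfk \<xi> r - 1)" by (simp add: algebra_simps)
      ultimately show "norm (w \<xi> \<tau> * erfk \<xi> r - w \<xi> \<tau>) \<le> \<bar>B\<bar> * (C * sqrt r) * (sqrt r / (r + (0 - \<xi>)\<^sup>2))"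
        by (simp only: real_norm_def abs_mult mult.assoc diff_0 power2_minus)
    qed
    also have "\<dots> = \<bar>B\<bar> * (C * sqrt r) * (arctan (0 / sqrt r) - arctan ((0 - s \<tau>) / sqrt r))"
      by (rule integral_unique[OF has_integral_mult_right[OF integral_Cauchy_kernel[OF r(1) s0]]])
    also have "\<dots> \<le> \<bar>B\<bar> * (C * sqrt r) * pi"
      using C0 r arctan_ubound[of "0 / sqrt r"] arctan_lbound[of "(0 - s \<tau>) / sqrt r"]
      by (intro mult_left_mono) (linarith, simp)
    finally show ?thesis by (simp add: r_def mult_ac)
  qed
  have "((\<lambda>\<tau>. \<bar>B\<bar> * C * pi * sqrt (T - \<tau>)) \<longlongrightarrow> \<bar>B\<bar> * C * pi * sqrt (T - T)) (at_left T)"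
    by (intro tendsto_intros)
  then have lim0: "((\<lambda>\<tau>. \<bar>B\<bar> * C * pi * sqrt (T - \<tau>)) \<longlongrightarrow> 0) (at_left T)" by simp
  have "eventually (\<lambda>\<tau>. norm (integral {0..s \<tau>} (\<lambda>\<xi>. w \<xi> \<tau> * erfk \<xi> (T - \<tau>)) - mass \<tau>) \<le> \<bar>B\<bar> * C * pi * sqrt (T - \<tau>)) (at_left T)"
    using ev by eventually_elim (rule bound)
  from Lim_null_comparison[OF this lim0]
  have 1: "((\<lambda>\<tau>. integral {0..s \<tau>} (\<lambda>\<xi>. w \<xi> \<tau> * erfk \<xi> (T - \<tau>)) - mass \<tau>) \<longlongrightarrow> 0) (at_left T)" .
  have "isCont mass T" using mass_deriv[OF assms] by (rule DERIV_isCont)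
  then have 2: "(mass \<longlongrightarrow> mass T) (at_left T)" by (simp add: isCont_def filterlim_at_split)
  from tendsto_add[OF 1 2] show ?thesis by simp
qed

text \<open>
  Green's identity with \<open>p = erfk x (t - \<tau>)\<close>. As \<open>p\<close> vanishes at \<open>x = 0\<close>, the flux \<open>wx 0\<close> drops out and the boundary values
  \<open>w 0\<close> enter through an Abel integral. The third summand is kept apart because its kernel is flat at \<open>\<tau> = t\<close>;
  its integrand vanishes for \<open>\<tau> \<ge> t\<close>, so the upper limit may be the fixed time \<open>T\<close>.
\<close>

lemma mass_formula:
  assumes a: "0 < a" "a < t" "t \<le> T"
  shows "mass t = integral {0..s a} (\<lambda>\<xi>. w \<xi> a * erfk \<xi> (t - a)) + integral {a..t} (\<lambda>\<tau>. trace \<tau> * s' \<tau>)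
     + integral {a..T} (\<lambda>\<tau>. trace \<tau> * (s' \<tau> * (erfk (s \<tau>) (t - \<tau>) - 1) - gauss 0 1 (s \<tau>) (t - \<tau>) / Psi_lim 0))
     + 2 / Psi_lim 0 * volterra a (\<lambda>_ _. 1) (w 0) t"
proof -
  let ?L = "Psi_lim 0"
  have L: "?L > 0" by (rule Psi_lim_0_pos)
  let ?p = "\<lambda>\<xi> \<tau>. erfk \<xi> (t - \<tau>)"
  let ?px = "\<lambda>\<xi> \<tau>. gauss 0 1 \<xi> (t - \<tau>) / ?L"
  let ?pxx = "\<lambda>\<xi> \<tau>. - (gauss 1 3 \<xi> (t - \<tau>) / (2 * ?L))"
  let ?E = "\<lambda>\<tau>. integral {0..s \<tau>} (\<lambda>\<xi>. w \<xi> \<tau> * ?p \<xi> \<tau>)"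
  let ?E' = "\<lambda>\<tau>. w (s \<tau>) \<tau> * (s' \<tau> * ?p (s \<tau>) \<tau> - ?px (s \<tau>) \<tau>) - (wx 0 \<tau> * ?p 0 \<tau> - w 0 \<tau> * ?px 0 \<tau>)"
  let ?\<phi> = "\<lambda>\<tau>. trace \<tau> * (s' \<tau> * erfk (s \<tau>) (t - \<tau>) - gauss 0 1 (s \<tau>) (t - \<tau>) / ?L)"
  let ?b = "\<lambda>\<rho>. 2 * \<rho> * ?\<phi> (t - \<rho>\<^sup>2) + 2 / ?L * w 0 (t - \<rho>\<^sup>2)"
  let ?R = "sqrt (t - a)"
  have cs: "continuous_on {a..T} s" "continuous_on {a..T} s'" "continuous_on {a..T} trace"
    using a by (auto intro: continuous_on_subset[OF s_cont] continuous_on_subset[OF s'_cont] continuous_on_subset[OF trace_cont])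
  have sp: "s \<tau> > 0" "s \<tau> \<noteq> 0" if "a \<le> \<tau>" for \<tau>
    using s_pos[of \<tau>] a that by auto
  have E: "(?E has_real_derivative ?E' \<tau>) (at \<tau>)" if "0 < \<tau>" "\<tau> < t" for \<tau>
  proof (rule green_deriv[where T=t and pxx="?pxx", OF that])
    fix X X' \<tau> assume "\<tau> < t" "(X has_real_derivative X') (at \<tau>)"
    then have "((\<lambda>\<tau>. erfk (X \<tau>) (t - \<tau>)) has_real_derivative X' * (gauss 0 1 (X \<tau>) (t - \<tau>) / ?L) - (-1) * (gauss 1 3 (X \<tau>) (t - \<tau>) / (2 * ?L))) (at \<tau>)"
      by (intro erfk_deriv_pos) (auto intro!: derivative_eq_intros)
    then show "((\<lambda>\<tau>. ?p (X \<tau>) \<tau>) has_real_derivative ?px (X \<tau>) \<tau> * X' - ?pxx (X \<tau>) \<tau>) (at \<tau>)"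
      by (simp add: mult.commute)
  next
    fix x \<tau> assume \<tau>: "\<tau> < t"
    have "((\<lambda>x. erfk x (t - \<tau>)) has_real_derivative 1 * (gauss 0 1 x (t - \<tau>) / ?L) - 0 * (gauss 1 3 x (t - \<tau>) / (2 * ?L))) (at x)"
      using \<tau> by (intro erfk_deriv_pos) auto
    then show "((\<lambda>x. ?p x \<tau>) has_real_derivative ?px x \<tau>) (at x)" by simp
    have "((\<lambda>x. gauss 0 1 x (t - \<tau>)) has_real_derivative 1 * gauss_x 0 1 x (t - \<tau>) + 0 * gauss_r 0 1 x (t - \<tau>)) (at x)"
      using \<tau> by (intro gauss_has_derivative[of "\<lambda>x. x"]) auto
    from DERIV_cdivide[OF this, of ?L]
    show "((\<lambda>x. ?px x \<tau>) has_real_derivative ?pxx x \<tau>) (at x)"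
      by (simp add: gauss_x_def numeral_3_eq_3 numeral_2_eq_2)
  next
    show "continuous_on (UNIV \<times> {..<t}) (\<lambda>q. ?p (fst q) (snd q))" by (intro continuous_on_erfk continuous_intros) auto
    show "continuous_on (UNIV \<times> {..<t}) (\<lambda>q. ?px (fst q) (snd q))" using L by (intro continuous_intros continuous_on_gauss) auto
    show "continuous_on (UNIV \<times> {..<t}) (\<lambda>q. ?pxx (fst q) (snd q))" using L by (intro continuous_intros continuous_on_gauss) auto
  qed
  have "mass t = ?E a + integral {0..?R} ?b"
  proof (rule parabolic_FTC[OF a(1,2) E])
    fix \<rho> assume \<rho>: "0 < \<rho>" "\<rho> < ?R"
    have "erfk 0 (\<rho>\<^sup>2) = 0" using \<rho> by (intro erfk_zero) auto
    moreover have "2 * \<rho> * (w 0 (t - \<rho>\<^sup>2) * (gauss 0 1 0 (\<rho>\<^sup>2) / ?L)) = 2 / ?L * w 0 (t - \<rho>\<^sup>2)"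
      using \<rho> by (simp add: gauss_def)
    ultimately show "?b \<rho> = 2 * \<rho> * ?E' (t - \<rho>\<^sup>2)"
      by (simp add: trace_def algebra_simps)
  qed (use mass_kernel_limit[of t] a in auto)
  moreover have "integral {0..?R} ?b = integral {0..?R} (\<lambda>\<rho>. 2 * \<rho> * ?\<phi> (t - \<rho>\<^sup>2)) + 2 / ?L * integral {0..?R} (\<lambda>\<rho>. w 0 (t - \<rho>\<^sup>2))"
  proof -
    have pos: "0 < t - \<rho>\<^sup>2" if "\<rho> \<in> {0..?R}" for \<rho>
    proof -
      have "\<rho>\<^sup>2 \<le> ?R\<^sup>2" using that by (intro power_mono) auto
      then show ?thesis using a by simp
    qed
    have c1: "continuous_on {0..?R} (\<lambda>\<rho>. w 0 (t - \<rho>\<^sup>2))"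
      by (rule continuous_on_compose2[OF left_cont(1)]) (use pos in \<open>auto intro!: continuous_intros\<close>)
    have c2: "continuous_on {0..?R} (\<lambda>\<rho>. trace (t - \<rho>\<^sup>2))"
      by (rule continuous_on_compose2[OF trace_cont]) (use pos in \<open>auto intro!: continuous_intros\<close>)
    have c3: "continuous_on {0..?R} (\<lambda>\<rho>. s (t - \<rho>\<^sup>2))"
      by (rule continuous_on_s_comp) (use pos in \<open>auto intro!: continuous_intros\<close>)
    have c4: "continuous_on {0..?R} (\<lambda>\<rho>. s' (t - \<rho>\<^sup>2))"
      by (rule continuous_on_s'_comp) (use pos in \<open>auto intro!: continuous_intros\<close>)
    have cb: "continuous_on {0..?R} (\<lambda>\<rho>. 2 * \<rho> * ?\<phi> (t - \<rho>\<^sup>2))"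
      using pos s_pos L by (intro continuous_intros c2 c3 c4 continuous_on_erfk continuous_on_gauss) (auto simp: less_imp_neq[symmetric])
    show ?thesis
      using integral_add[OF integrable_continuous_interval[OF cb] integrable_continuous_interval[OF continuous_on_mult_left[OF c1, of "2 / ?L"]]]
      by simp
  qed
  moreover have "integral {0..?R} (\<lambda>\<rho>. w 0 (t - \<rho>\<^sup>2)) = volterra a (\<lambda>_ _. 1) (w 0) t"
  proof -
    have "continuous_on {0..?R} (\<lambda>\<rho>. w 0 (t - \<rho>\<^sup>2))"
    proof (rule continuous_on_compose2[OF left_cont(1)])
      show "(\<lambda>\<rho>. t - \<rho>\<^sup>2) ` {0..?R} \<subseteq> {0<..}"
      proof (rule image_subsetI)
        fix \<rho> assume "\<rho> \<in> {0..?R}"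
        then have "\<rho>\<^sup>2 \<le> ?R\<^sup>2" by (intro power_mono) auto
        then show "t - \<rho>\<^sup>2 \<in> {0<..}" using a by simp
      qed
    qed (intro continuous_intros)
    from integral_stretch[OF this] a
    have "integral {0..?R} (\<lambda>\<rho>. w 0 (t - \<rho>\<^sup>2)) = ?R * integral {0..1} (\<lambda>y. w 0 (t - (y * ?R)\<^sup>2))" by simp
    moreover have "t - (y * ?R)\<^sup>2 = a + (t - a) * (1 - y\<^sup>2)" for y
      using a by (simp add: power_mult_distrib algebra_simps)
    ultimately show ?thesis by (simp only: volterra_def mult_1)
  qed
  moreover have "integral {0..?R} (\<lambda>\<rho>. 2 * \<rho> * ?\<phi> (t - \<rho>\<^sup>2)) = integral {a..t} ?\<phi>"
  proof (rule integral_lag_substitution[where f="?\<phi>"])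
    have "continuous_on {a..T} ?\<phi>"
      by (intro continuous_on_mult continuous_on_diff continuous_on_divide continuous_on_const continuous_on_id continuous_on_erfk continuous_on_gauss cs)
        (use sp L in auto)
    then show "continuous_on {a..t} ?\<phi>" by (rule continuous_on_subset) (use a in auto)
  qed (use a in auto)
  moreover have "integral {a..t} ?\<phi> = integral {a..t} (\<lambda>\<tau>. trace \<tau> * s' \<tau>)
     + integral {a..T} (\<lambda>\<tau>. trace \<tau> * (s' \<tau> * (erfk (s \<tau>) (t - \<tau>) - 1) - gauss 0 1 (s \<tau>) (t - \<tau>) / ?L))"
  proof -
    let ?\<psi> = "\<lambda>\<tau>. trace \<tau> * (s' \<tau> * (erfk (s \<tau>) (t - \<tau>) - 1) - gauss 0 1 (s \<tau>) (t - \<tau>) / ?L)"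
    have c: "continuous_on {a..T} ?\<psi>"
      by (intro continuous_on_mult continuous_on_diff continuous_on_divide continuous_on_const continuous_on_id continuous_on_erfk continuous_on_gauss cs)
        (use sp L in auto)
    have "integral {a..t} ?\<psi> + integral {t..T} ?\<psi> = integral {a..T} ?\<psi>"
      using a by (intro Henstock_Kurzweil_Integration.integral_combine integrable_continuous_interval c) auto
    moreover have "integral {t..T} ?\<psi> = 0"
      by (intro integral_unique has_integral_is_0) (simp add: erfk_def gauss_def)
    moreover have "integral {a..t} (\<lambda>\<tau>. trace \<tau> * s' \<tau> + ?\<psi> \<tau>) = integral {a..t} (\<lambda>\<tau>. trace \<tau> * s' \<tau>) + integral {a..t} ?\<psi>"
      using a by (intro integral_add integrable_continuous_interval continuous_intros continuous_on_subset[OF c]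
         continuous_on_subset[OF trace_cont] continuous_on_subset[OF s'_cont]) auto
    moreover have "(\<lambda>\<tau>. trace \<tau> * s' \<tau> + ?\<psi> \<tau>) = ?\<phi>" by (simp add: fun_eq_iff algebra_simps)
    ultimately show ?thesis by simp
  qed
  ultimately show ?thesis by simp
qed

text \<open>
  The order of \<open>mass\<close> is one higher than that of \<open>trace\<close> and \<open>s'\<close>: these enter through an indefinite integral and under a
  kernel that is smooth in \<open>t\<close>. The Abel integral of \<open>w 0\<close> has the order of \<open>w 0\<close>, by rescaling about \<open>a\<close>.
\<close>

lemma mass_regular:
  assumes a: "0 < a"
    and w0: "cdiff_fun (Suc n) (\<lambda>_. 1) {a..T} (w 0)"
    and tr: "cdiff_fun n (\<lambda>_. 1) {a<..T} trace" and s': "cdiff_fun n (\<lambda>_. 1) {a<..T} s'"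
  shows "cdiff_fun (Suc n) (\<lambda>_. 1) {a<..T} mass"
proof -
  let ?L = "Psi_lim 0"
  have L: "?L > 0" by (rule Psi_lim_0_pos)
  have cs: "continuous_on {a..T} s" "continuous_on {a..T} s'" "continuous_on {a..T} trace"
    using a by (auto intro: continuous_on_subset[OF s_cont] continuous_on_subset[OF s'_cont] continuous_on_subset[OF trace_cont])
  have 1: "cdiff_fun (Suc n) (\<lambda>_. 1) {a<..T} (\<lambda>t. integral {0..s a} (\<lambda>\<xi>. w \<xi> a * erfk \<xi> (t - a)))"
    by (intro cdiff_fun_integral cdiff_mult cdiff_const_t section_cont a cdiff_erfk continuous_intros cdiff_diff cdiff_ident) auto
  have 2: "cdiff_fun (Suc n) (\<lambda>_. 1) {a<..T} (\<lambda>t. integral {a..t} (\<lambda>\<tau>. trace \<tau> * s' \<tau>))"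
  proof (rule cdiff_fun_antiderivative[OF _ cdiff_mult[OF tr s']])
    fix t assume t: "t \<in> {a<..T}"
    have "((\<lambda>t. integral {a..t} (\<lambda>\<tau>. trace \<tau> * s' \<tau>)) has_real_derivative trace t * s' t) (at t within {a..T})"
      using t by (intro integral_has_real_derivative continuous_intros cs) auto
    then show "((\<lambda>t. integral {a..t} (\<lambda>\<tau>. trace \<tau> * s' \<tau>)) has_real_derivative trace t * s' t) (at t within {a<..T})"
      by (rule DERIV_subset) auto
  qed
  have 3: "cdiff_fun (Suc n) (\<lambda>_. 1) {a<..T} (\<lambda>t. integral {a..T} (\<lambda>\<tau>. trace \<tau> * (s' \<tau> * (erfk (s \<tau>) (t - \<tau>) - 1) - 1 / ?L * gauss 0 1 (s \<tau>) (t - \<tau>))))"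
  proof -
    have Q: "cdiff (Suc n) (\<lambda>_. 1) {a<..T} {a..T} (\<lambda>t \<tau>. erfk (s \<tau>) (t - \<tau>))"
      using a s_pos by (intro cdiff_erfk cs cdiff_lag) auto
    have G: "cdiff (Suc n) (\<lambda>_. 1) {a<..T} {a..T} (\<lambda>t \<tau>. gauss 0 1 (s \<tau>) (t - \<tau>))"
      using a s_pos by (intro cdiff_gauss cdiff_const_t cs cdiff_lag) (auto simp: less_imp_neq[symmetric])
    show ?thesis
      by (intro cdiff_fun_integral cdiff_mult[OF cdiff_const_t[OF cs(3)]] cdiff_diff[OF cdiff_mult[OF cdiff_const_t[OF cs(2)] cdiff_diff[OF Q cdiff_const]] cdiff_cmult[OF G]]) auto
  qed
  have 4: "cdiff_fun (Suc n) (\<lambda>_. 1) {a<..T} (\<lambda>t. 2 / ?L * volterra a (\<lambda>_ _. 1) (w 0) t)"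
  proof -
    have "cdiff_fun (Suc n) (\<lambda>t. t - a) {a..T} (w 0)"
      by (rule cdiff_from_plain[OF cdiff_shift w0])
    from cdiff_volterra[OF cdiff_const this] have "cdiff_fun (Suc n) (\<lambda>t. t - a) {a..T} (volterra a (\<lambda>_ _. 1) (w 0))" .
    from cdiff_to_plain[OF this, of "{a<..T}"]
    have "cdiff_fun (Suc n) (\<lambda>_. 1) {a<..T} (volterra a (\<lambda>_ _. 1) (w 0))" by (simp del: cdiff.simps add: greaterThanAtMost_subseteq_atLeastAtMost_iff)
    then show ?thesis by (rule cdiff_cmult)
  qed
  show ?thesis
    by (rule cdiff_cong[OF cdiff_add[OF cdiff_add[OF cdiff_add[OF 1 2] 3] 4]]) (use mass_formula[of a _ T] a in simp)
qed

lemma trace_kernel_limit: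
  assumes "0 < T"
  shows "((\<lambda>\<tau>. integral {0..s \<tau>} (\<lambda>\<xi>. w \<xi> \<tau> * gauss 0 1 (s T - \<xi>) (T - \<tau>))) \<longlongrightarrow> trace T * Psi_lim 0) (at_left T)"
proof -
  obtain B where B: "\<forall>\<tau>\<in>{T/2..T}. \<forall>\<xi>\<in>{0..s \<tau>}. \<bar>w \<xi> \<tau>\<bar> \<le> B"
    using w_bounded[of "T/2" T] assms by auto
  have ev: "eventually (\<lambda>\<tau>. \<tau> \<in> {T/2<..<T}) (at_left T)"
    using assms by (intro eventually_at_left_real) simp
  have cs: "continuous_on {T/2..T} s" "continuous_on {T/2..T} s'"
    using assms by (auto intro: continuous_on_subset[OF s_cont] continuous_on_subset[OF s'_cont])
  have "bounded (s' ` {T/2..T})" "bounded (s ` {T/2..T})"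
    by (intro compact_imp_bounded compact_continuous_image cs compact_Icc)+
  then obtain C S where C: "\<forall>\<tau>\<in>{T/2..T}. \<bar>s' \<tau>\<bar> \<le> C" and S: "\<forall>\<tau>\<in>{T/2..T}. \<bar>s \<tau>\<bar> \<le> S"
    by (auto simp: bounded_iff)
  have lip: "\<bar>s T - s \<tau>\<bar> \<le> C * (T - \<tau>)" if "\<tau> \<in> {T/2..T}" for \<tau>
  proof -
    have "norm (s T - s \<tau>) \<le> C * norm (T - \<tau>)"
      by (rule field_differentiable_bound[of "{T/2..T}" s s' C])
        (use assms that C in \<open>auto intro!: has_field_derivative_at_within[OF s_deriv]\<close>)
    then show ?thesis using that by simp
  qed
  have "((\<lambda>\<tau>. integral {0..s \<tau>} (\<lambda>\<xi>. w \<xi> \<tau> * gauss 0 (0 + 1) (s T - \<xi>) (T - \<tau>))) \<longlongrightarrow> trace T * Psi_lim 0) (at_left T)"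
  proof (rule gauss_concentrates[where F="at_left T" and i=0 and l="trace T" and S=S and C=C and B=B and x="s T" and X="\<lambda>_. s T"
      and \<sigma>=s and r="\<lambda>\<tau>. T - \<tau>" and W="\<lambda>\<tau> \<xi>. w \<xi> \<tau>"])
    show "eventually (\<lambda>\<tau>. 0 < T - \<tau>) (at_left T)" using ev by eventually_elim simp
    show "((\<lambda>\<tau>. T - \<tau>) \<longlongrightarrow> 0) (at_left T)" by (auto intro!: tendsto_eq_intros)
    show "eventually (\<lambda>\<tau>. 0 \<le> s \<tau> \<and> s \<tau> \<le> S \<and> \<bar>s T - s \<tau>\<bar> \<le> C * (T - \<tau>)) (at_left T)"
      using ev
    proof eventually_elim
      fix \<tau> assume \<tau>: "\<tau> \<in> {T/2<..<T}"
      then show "0 \<le> s \<tau> \<and> s \<tau> \<le> S \<and> \<bar>s T - s \<tau>\<bar> \<le> C * (T - \<tau>)"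
        using bspec[OF S, of \<tau>] lip[of \<tau>] s_pos[of \<tau>] assms by auto
    qed
    show "((\<lambda>_. s T) \<longlongrightarrow> s T) (at_left T)" by simp
    show "0 < s T" by (rule s_pos[OF assms])
    show "eventually (\<lambda>\<tau>. continuous_on {0..s \<tau>} (\<lambda>\<xi>. w \<xi> \<tau>) \<and> (\<forall>\<xi>\<in>{0..s \<tau>}. \<bar>w \<xi> \<tau>\<bar> \<le> B)) (at_left T)"
      using ev
    proof eventually_elim
      fix \<tau> assume \<tau>: "\<tau> \<in> {T/2<..<T}"
      then show "continuous_on {0..s \<tau>} (\<lambda>\<xi>. w \<xi> \<tau>) \<and> (\<forall>\<xi>\<in>{0..s \<tau>}. \<bar>w \<xi> \<tau>\<bar> \<le> B)"
        using section_cont[of \<tau>] bspec[OF B, of \<tau>] assms by auto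
    qed
    fix \<epsilon> :: real assume "\<epsilon> > 0"
    have "(s T, T) \<in> {(x, t). 0 \<le> x \<and> x \<le> s t \<and> 0 < t}" using assms s_pos[of T] by auto
    then obtain d where d: "d > 0" "\<And>q. q \<in> {(x, t). 0 \<le> x \<and> x \<le> s t \<and> 0 < t} \<Longrightarrow> dist q (s T, T) < d \<Longrightarrow>
        dist (case q of (x, t) \<Rightarrow> w x t) (case (s T, T) of (x, t) \<Rightarrow> w x t) < \<epsilon>"
      using w_cont \<open>\<epsilon> > 0\<close> unfolding continuous_on_iff by meson
    have "eventually (\<lambda>\<tau>. dist \<tau> T < d / 2) (at_left T)"
      using tendstoD[OF tendsto_ident_at, of "d / 2" T "{..<T}"] d(1) by simp
    then have "eventually (\<lambda>\<tau>. \<forall>\<xi>\<in>{0..s \<tau>}. \<bar>\<xi> - s T\<bar> < d / 2 \<longrightarrow> \<bar>w \<xi> \<tau> - trace T\<bar> \<le> \<epsilon>) (at_left T)"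
      using ev
    proof eventually_elim
      fix \<tau> assume \<tau>: "dist \<tau> T < d / 2" "\<tau> \<in> {T/2<..<T}"
      show "\<forall>\<xi>\<in>{0..s \<tau>}. \<bar>\<xi> - s T\<bar> < d / 2 \<longrightarrow> \<bar>w \<xi> \<tau> - trace T\<bar> \<le> \<epsilon>"
      proof (intro ballI impI)
        fix \<xi> assume \<xi>: "\<xi> \<in> {0..s \<tau>}" "\<bar>\<xi> - s T\<bar> < d / 2"
        have "dist (\<xi>, \<tau>) (s T, T) \<le> dist \<xi> (s T) + dist \<tau> T"
          by (simp add: dist_Pair_Pair sqrt_sum_squares_le_sum)
        then have "dist (\<xi>, \<tau>) (s T, T) < d" using \<tau> \<xi> by (simp add: dist_real_def)
        from d(2)[OF _ this] show "\<bar>w \<xi> \<tau> - trace T\<bar> \<le> \<epsilon>"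
          using \<xi> \<tau> assms by (auto simp: dist_real_def trace_def)
      qed
    qed
    then show "\<exists>\<delta>>0. eventually (\<lambda>\<tau>. \<forall>\<xi>\<in>{0..s \<tau>}. \<bar>\<xi> - s T\<bar> < \<delta> \<longrightarrow> \<bar>w \<xi> \<tau> - trace T\<bar> \<le> \<epsilon>) (at_left T)"
      using d(1) by (intro exI[of _ "d / 2"]) auto
  qed
  then show ?thesis by simp
qed

text \<open>
  The difference quotient of \<open>s\<close> between \<open>\<tau> = a + (t - a) (1 - y\<^sup>2)\<close> and \<open>t\<close>, in Hadamard's form, which loses only one
  derivative of \<open>s\<close>.
\<close>

definition slope :: "real \<Rightarrow> real \<Rightarrow> real \<Rightarrow> real" where
  "slope a t y = integral {0..1} (\<lambda>\<theta>. s' (a + (t - a) * (1 - \<theta> * y\<^sup>2)))"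

text \<open>
  The kernel \<open>s' p - p\<^sub>x\<close> on the curve for the heat kernel \<open>p\<close> with pole \<open>(s t, t)\<close>, times \<open>2 sqrt (t - \<tau>)\<close>. As
  \<open>s t - s \<tau>\<close> is a multiple of \<open>t - \<tau>\<close>, the singularity of \<open>p\<^sub>x\<close> is no worse than that of \<open>p\<close>.
\<close>

definition trace_kernel :: "real \<Rightarrow> real \<Rightarrow> real \<Rightarrow> real" where
  "trace_kernel a t y = (2 * s' (a + (t - a) * (1 - y\<^sup>2)) - slope a t y) * exp (- ((t - a) * y\<^sup>2 * (slope a t y)\<^sup>2 / 4))"

lemma slope_eq:
  assumes "0 < a" "a \<le> t" "y \<in> {0..1}"
  shows "s t - s (a + (t - a) * (1 - y\<^sup>2)) = (t - a) * y\<^sup>2 * slope a t y"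
proof -
  let ?c = "(t - a) * y\<^sup>2"
  let ?g = "\<lambda>\<theta>. a + (t - a) * (1 - \<theta> * y\<^sup>2)"
  have y2: "0 \<le> y\<^sup>2" "y\<^sup>2 \<le> 1" using assms(3) by (auto simp: power_le_one)
  have pos: "0 < ?g \<theta>" if "\<theta> \<in> {0..1}" for \<theta>
  proof -
    have "\<theta> * y\<^sup>2 \<le> 1" using that y2 by (intro mult_le_one) auto
    then have "0 \<le> (t - a) * (1 - \<theta> * y\<^sup>2)" using assms by (intro mult_nonneg_nonneg) auto
    then show ?thesis using assms by simp
  qed
  have "((\<lambda>\<theta>. ?c * s' (?g \<theta>)) has_integral (- s (?g 1) - - s (?g 0))) {0..1}"
  proof (rule fundamental_theorem_of_calculus)
    fix \<theta> :: real assume "\<theta> \<in> {0..1}"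
    from s_deriv[OF pos[OF this]] have 1: "(s has_real_derivative s' (?g \<theta>)) (at (?g \<theta>))" .
    have 2: "(?g has_real_derivative - ?c) (at \<theta> within {0..1})" by (auto intro!: derivative_eq_intros)
    from DERIV_minus[OF DERIV_chain2[where g="?g", OF 1 2]]
    show "((\<lambda>\<theta>. - s (?g \<theta>)) has_vector_derivative ?c * s' (?g \<theta>)) (at \<theta> within {0..1})"
      by (simp add: has_real_derivative_iff_has_vector_derivative[symmetric] mult_ac)
  qed simp
  from integral_unique[OF this] show ?thesis by (simp add: slope_def)
qed

text \<open>
  Green's identity with the heat kernel with pole at the moving point \<open>(s t, t)\<close>. The left side is the jump relation: the
  pole lies on the boundary, which yields the factor \<open>Psi_lim 0\<close>, half the integral of the kernel over the line.
\<close>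

lemma trace_formula:
  assumes a: "0 < a" "a < t" "t \<le> T"
  shows "trace t * Psi_lim 0 = integral {0..s a} (\<lambda>\<xi>. w \<xi> a * gauss 0 1 (s t - \<xi>) (t - a)) + volterra a (trace_kernel a) trace t
     + integral {a..T} (\<lambda>\<tau>. 1/2 * (w 0 \<tau> * gauss 1 3 (s t) (t - \<tau>)) - wx 0 \<tau> * gauss 0 1 (s t) (t - \<tau>))"
proof -
  let ?p = "\<lambda>\<xi> \<tau>. gauss 0 1 (s t - \<xi>) (t - \<tau>)"
  let ?px = "\<lambda>\<xi> \<tau>. 1/2 * gauss 1 3 (s t - \<xi>) (t - \<tau>)"
  let ?pxx = "\<lambda>\<xi> \<tau>. 1/4 * gauss 2 5 (s t - \<xi>) (t - \<tau>) - 1/2 * gauss 0 3 (s t - \<xi>) (t - \<tau>)"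
  let ?E = "\<lambda>\<tau>. integral {0..s \<tau>} (\<lambda>\<xi>. w \<xi> \<tau> * ?p \<xi> \<tau>)"
  let ?E' = "\<lambda>\<tau>. w (s \<tau>) \<tau> * (s' \<tau> * ?p (s \<tau>) \<tau> - ?px (s \<tau>) \<tau>) - (wx 0 \<tau> * ?p 0 \<tau> - w 0 \<tau> * ?px 0 \<tau>)"
  let ?R = "sqrt (t - a)"
  have R: "?R > 0" "?R\<^sup>2 = t - a" using a by auto
  let ?\<phi> = "\<lambda>\<tau>. 1/2 * (w 0 \<tau> * gauss 1 3 (s t) (t - \<tau>)) - wx 0 \<tau> * gauss 0 1 (s t) (t - \<tau>)"
  let ?k = "\<lambda>\<rho>. trace (t - \<rho>\<^sup>2) * trace_kernel a t (\<rho> / ?R)"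
  let ?b = "\<lambda>\<rho>. ?k \<rho> + 2 * \<rho> * ?\<phi> (t - \<rho>\<^sup>2)"
  have cs: "continuous_on {a..T} s" "continuous_on {a..T} s'" "continuous_on {a..T} trace" "continuous_on {a..T} (w 0)" "continuous_on {a..T} (wx 0)"
    using a by (auto intro: continuous_on_subset[OF s_cont] continuous_on_subset[OF s'_cont] continuous_on_subset[OF trace_cont]
      continuous_on_subset[OF left_cont(1)] continuous_on_subset[OF left_cont(2)])
  have st: "s t > 0" using a by (intro s_pos) simp
  have E: "(?E has_real_derivative ?E' \<tau>) (at \<tau>)" if "0 < \<tau>" "\<tau> < t" for \<tau>
  proof (rule green_deriv[where T=t and pxx="?pxx", OF that])
    fix X X' \<tau> assume *: "\<tau> < t" "(X has_real_derivative X') (at \<tau>)"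
    have "((\<lambda>\<tau>. gauss 0 1 (s t - X \<tau>) (t - \<tau>)) has_real_derivative
       (- X') * gauss_x 0 1 (s t - X \<tau>) (t - \<tau>) + (- 1) * gauss_r 0 1 (s t - X \<tau>) (t - \<tau>)) (at \<tau>)"
      using * by (intro gauss_has_derivative) (auto intro!: derivative_eq_intros)
    then show "((\<lambda>\<tau>. ?p (X \<tau>) \<tau>) has_real_derivative ?px (X \<tau>) \<tau> * X' - ?pxx (X \<tau>) \<tau>) (at \<tau>)"
      by (simp add: gauss_x_def gauss_r_def eval_nat_numeral algebra_simps)
  next
    fix x \<tau> assume \<tau>: "\<tau> < t"
    have G: "((\<lambda>x. gauss i j (s t - x) (t - \<tau>)) has_real_derivative (- 1) * gauss_x i j (s t - x) (t - \<tau>) + 0 * gauss_r i j (s t - x) (t - \<tau>)) (at x)" for i j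
      using \<tau> by (intro gauss_has_derivative) (auto intro!: derivative_eq_intros)
    from G[of 0 1] show "((\<lambda>x. ?p x \<tau>) has_real_derivative ?px x \<tau>) (at x)"
      by (simp add: gauss_x_def eval_nat_numeral)
    from DERIV_cmult[OF G[of 1 3], of "1/2"] show "((\<lambda>x. ?px x \<tau>) has_real_derivative ?pxx x \<tau>) (at x)"
      by (simp add: gauss_x_def eval_nat_numeral diff_divide_distrib)
  next
    show "continuous_on (UNIV \<times> {..<t}) (\<lambda>q. ?p (fst q) (snd q))"
      "continuous_on (UNIV \<times> {..<t}) (\<lambda>q. ?px (fst q) (snd q))"
      "continuous_on (UNIV \<times> {..<t}) (\<lambda>q. ?pxx (fst q) (snd q))"
      by (intro continuous_intros continuous_on_gauss; auto)+
  qed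
  have E0: "trace t * Psi_lim 0 = ?E a + integral {0..?R} ?b"
  proof (rule parabolic_FTC[OF a(1,2) E])
    fix \<rho> assume \<rho>: "0 < \<rho>" "\<rho> < ?R"
    define y where "y = \<rho> / ?R"
    have y: "y \<in> {0..1}" using \<rho> R by (auto simp: y_def)
    have y2: "(t - a) * y\<^sup>2 = \<rho>\<^sup>2" using R a by (simp add: y_def power_divide)
    then have lag: "a + (t - a) * (1 - y\<^sup>2) = t - \<rho>\<^sup>2" by (simp add: algebra_simps)
    define S where "S = slope a t y"
    have sl: "s t - s (t - \<rho>\<^sup>2) = \<rho>\<^sup>2 * S"
      using slope_eq[OF a(1) less_imp_le[OF a(2)] y] by (simp only: lag y2 S_def)
    have ex: "exp (- (\<rho>\<^sup>2 * S)\<^sup>2 / (4 * \<rho>\<^sup>2)) = exp (- (\<rho>\<^sup>2 * S\<^sup>2 / 4))"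
      using \<rho> by (simp add: power_mult_distrib power2_eq_square)
    have k: "trace_kernel a t y = (2 * s' (t - \<rho>\<^sup>2) - S) * exp (- (\<rho>\<^sup>2 * S\<^sup>2 / 4))"
      by (simp only: trace_kernel_def lag y2 S_def)
    have p1: "2 * \<rho> * gauss 0 1 (\<rho>\<^sup>2 * S) (\<rho>\<^sup>2) = 2 * exp (- (\<rho>\<^sup>2 * S\<^sup>2 / 4))"
      using \<rho> ex by (simp add: gauss_def)
    have p2: "2 * \<rho> * (1/2 * gauss 1 3 (\<rho>\<^sup>2 * S) (\<rho>\<^sup>2)) = S * exp (- (\<rho>\<^sup>2 * S\<^sup>2 / 4))"
      using \<rho> ex by (simp add: gauss_def power_divide power2_eq_square power3_eq_cube)
    have "2 * \<rho> * (w (s (t - \<rho>\<^sup>2)) (t - \<rho>\<^sup>2) * (s' (t - \<rho>\<^sup>2) * gauss 0 1 (\<rho>\<^sup>2 * S) (\<rho>\<^sup>2) - 1/2 * gauss 1 3 (\<rho>\<^sup>2 * S) (\<rho>\<^sup>2))) =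
        trace (t - \<rho>\<^sup>2) * (s' (t - \<rho>\<^sup>2) * (2 * \<rho> * gauss 0 1 (\<rho>\<^sup>2 * S) (\<rho>\<^sup>2)) - 2 * \<rho> * (1/2 * gauss 1 3 (\<rho>\<^sup>2 * S) (\<rho>\<^sup>2)))"
      by (simp add: trace_def algebra_simps)
    also have "\<dots> = ?k \<rho>" unfolding p1 p2 y_def[symmetric] k by (simp add: algebra_simps)
    finally have K: "2 * \<rho> * (w (s (t - \<rho>\<^sup>2)) (t - \<rho>\<^sup>2) * (s' (t - \<rho>\<^sup>2) * gauss 0 1 (\<rho>\<^sup>2 * S) (\<rho>\<^sup>2) - 1/2 * gauss 1 3 (\<rho>\<^sup>2 * S) (\<rho>\<^sup>2))) = ?k \<rho>" .
    have tt: "t - (t - \<rho>\<^sup>2) = \<rho>\<^sup>2" by simp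
    have "2 * \<rho> * ?E' (t - \<rho>\<^sup>2) = ?k \<rho> - 2 * \<rho> * (wx 0 (t - \<rho>\<^sup>2) * gauss 0 1 (s t - 0) (\<rho>\<^sup>2) - w 0 (t - \<rho>\<^sup>2) * (1/2 * gauss 1 3 (s t - 0) (\<rho>\<^sup>2)))"
      unfolding sl tt K[symmetric] by (rule right_diff_distrib)
    also have "\<dots> = ?b \<rho>" by (simp add: algebra_simps)
    finally show "?b \<rho> = 2 * \<rho> * ?E' (t - \<rho>\<^sup>2)" by simp
  qed (use trace_kernel_limit[of t] a in auto)
  have cK: "continuous_on {0..1} (trace_kernel a t)"
  proof -
    have in01: "1 - \<theta> * y\<^sup>2 \<in> {0..1}" if "y \<in> {0..1}" "\<theta> \<in> {0..1}" for y \<theta> :: real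
      using that mult_le_one[of \<theta> "y\<^sup>2"] by (auto simp: power_le_one)
    have "a + (t - a) * (1 - \<theta> * y\<^sup>2) \<in> {a..T}" if "y \<in> {0..1}" "\<theta> \<in> {0..1}" for y \<theta> :: real
      using scale_mem[of t a T "1 - \<theta> * y\<^sup>2"] in01[OF that] a by auto
    then have "continuous_on ({0..1} \<times> cbox 0 1) (\<lambda>p. s' (a + (t - a) * (1 - snd p * (fst p)\<^sup>2)))"
      by (intro continuous_on_compose2[OF cs(2)] continuous_intros) auto
    then have "continuous_on ({0..1} \<times> cbox 0 1) (\<lambda>(y, \<theta>). s' (a + (t - a) * (1 - \<theta> * y\<^sup>2)))"
      by (simp add: case_prod_beta')
    from integral_continuous_on_param[OF this] have cS: "continuous_on {0..1} (slope a t)"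
      by (simp add: slope_def[abs_def])
    have "a + (t - a) * (1 - y\<^sup>2) \<in> {a..T}" if "y \<in> {0..1}" for y :: real
      using scale_mem[of t a T "1 - y\<^sup>2"] in01[OF that, of 1] a by auto
    then have c2: "continuous_on {0..1} (\<lambda>y. s' (a + (t - a) * (1 - y\<^sup>2)))"
      by (intro continuous_on_compose2[OF cs(2)] continuous_intros) auto
    show ?thesis unfolding trace_kernel_def[abs_def] by (intro continuous_intros cS c2) auto
  qed
  have sq: "t - \<rho>\<^sup>2 \<in> {a..T}" if "\<rho> \<in> {0..?R}" for \<rho>
  proof -
    have "\<rho>\<^sup>2 \<le> ?R\<^sup>2" using that by (intro power_mono) auto
    moreover have "0 \<le> \<rho>\<^sup>2" by simp
    ultimately show ?thesis unfolding R(2) atLeastAtMost_iff using a by linarith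
  qed
  have clag: "continuous_on {0..?R} (\<lambda>\<rho>. v (t - \<rho>\<^sup>2))" if "continuous_on {a..T} v" for v :: "real \<Rightarrow> real"
    by (rule continuous_on_compose2[OF that, of _ "\<lambda>\<rho>. t - \<rho>\<^sup>2"]) (use sq in \<open>auto intro!: continuous_intros\<close>)
  have ck: "continuous_on {0..?R} ?k"
  proof (intro continuous_on_mult clag cs)
    show "continuous_on {0..?R} (\<lambda>\<rho>. trace_kernel a t (\<rho> / ?R))"
      by (rule continuous_on_compose2[OF cK, of _ "\<lambda>\<rho>. \<rho> / ?R"]) (use R in \<open>auto intro!: continuous_intros\<close>)
  qed
  have c\<phi>: "continuous_on {a..T} ?\<phi>"
    by (intro continuous_on_mult continuous_on_diff continuous_on_const continuous_on_id continuous_on_gauss cs) (use st in auto)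
  have c\<phi>': "continuous_on {0..?R} (\<lambda>\<rho>. 2 * \<rho> * ?\<phi> (t - \<rho>\<^sup>2))"
    by (rule continuous_on_mult[OF _ clag[OF c\<phi>]]) (intro continuous_intros)
  have I1: "integral {0..?R} ?b = integral {0..?R} ?k + integral {0..?R} (\<lambda>\<rho>. 2 * \<rho> * ?\<phi> (t - \<rho>\<^sup>2))"
    by (rule integral_add[OF integrable_continuous_interval[OF ck] integrable_continuous_interval[OF c\<phi>']])
  have I2: "integral {0..?R} ?k = volterra a (trace_kernel a) trace t"
  proof -
    have "integral {0..?R} ?k = ?R * integral {0..1} (\<lambda>y. ?k (y * ?R))" by (rule integral_stretch[OF ck R(1)])
    moreover have "?k (y * ?R) = trace_kernel a t y * trace (a + (t - a) * (1 - y\<^sup>2))" for y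
    proof -
      have "(y * ?R)\<^sup>2 = y\<^sup>2 * (t - a)" by (simp only: power_mult_distrib R(2))
      then have "t - (y * ?R)\<^sup>2 = a + (t - a) * (1 - y\<^sup>2)" by (simp add: algebra_simps)
      moreover have "y * ?R / ?R = y" using R(1) by simp
      ultimately show ?thesis by (simp only: mult.commute)
    qed
    ultimately show ?thesis by (simp only: volterra_def)
  qed
  have I3: "integral {0..?R} (\<lambda>\<rho>. 2 * \<rho> * ?\<phi> (t - \<rho>\<^sup>2)) = integral {a..t} ?\<phi>"
  proof (rule integral_lag_substitution[where f="?\<phi>"])
    show "continuous_on {a..t} ?\<phi>" by (rule continuous_on_subset[OF c\<phi>]) (use a in auto)
  qed (use a in auto)
  have I4: "integral {a..t} ?\<phi> = integral {a..T} ?\<phi>"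
  proof -
    have "integral {a..t} ?\<phi> + integral {t..T} ?\<phi> = integral {a..T} ?\<phi>"
      using a by (intro Henstock_Kurzweil_Integration.integral_combine integrable_continuous_interval c\<phi>) auto
    moreover have "integral {t..T} ?\<phi> = 0"
      by (intro integral_unique has_integral_is_0) (simp add: gauss_def)
    ultimately show ?thesis by simp
  qed
  show ?thesis by (simp only: E0 I1 I2 I3 I4 add.assoc)
qed

text \<open>
  The boundary \<open>x = 0\<close> stays away from the moving point, so its contribution is as smooth as \<open>s\<close>, whatever the regularity of the flux \<open>wx 0\<close>;
  the initial values contribute a layer. At \<open>t = a\<close> the Volterra equation holds because the layer has the right value there.
\<close>

lemma trace_regular:
  assumes a: "0 < a" "a < T" and s': "cdiff_fun n (\<lambda>_. 1) {a..T} s'"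
  shows "cdiff_fun n (\<lambda>_. 1) {a<..T} trace"
proof -
  let ?L = "Psi_lim 0"
  have L: "?L > 0" by (rule Psi_lim_0_pos)
  have cs: "continuous_on {a..T} s" "continuous_on {a..T} s'" "continuous_on {a..T} trace" "continuous_on {a..T} (w 0)" "continuous_on {a..T} (wx 0)"
    using a by (auto intro: continuous_on_subset[OF s_cont] continuous_on_subset[OF s'_cont] continuous_on_subset[OF trace_cont]
      continuous_on_subset[OF left_cont(1)] continuous_on_subset[OF left_cont(2)])
  have s_within: "(s has_real_derivative s' t) (at t within {a..T})" if "t \<in> {a..T}" for t
    using that a by (intro has_field_derivative_at_within[OF s_deriv]) auto
  interpret L: initial_layer "\<lambda>\<xi>. w \<xi> a" s s' a T
    by unfold_locales (use a s_within cs section_cont s_pos in auto)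
  have s'\<omega>: "cdiff_fun n (\<lambda>t. t - a) {a..T} s'" by (rule cdiff_from_plain[OF cdiff_shift s'])
  have sn: "cdiff_fun n (\<lambda>_. 1) {a..T} s"
    by (rule cdiff_Suc_imp[OF cdiff_fun_antiderivative[OF s_within s']])
  let ?\<phi> = "\<lambda>t \<tau>. 1/2 * (w 0 \<tau> * gauss 1 3 (s t) (t - \<tau>)) - wx 0 \<tau> * gauss 0 1 (s t) (t - \<tau>)"
  have G: "cdiff n (\<lambda>_. 1) {a..T} {a..T} (\<lambda>t \<tau>. gauss i j (s t) (t - \<tau>))" for i j
    using s_pos a by (intro cdiff_gauss cdiff_fun_param[OF sn] cdiff_lag) (metis atLeastAtMost_iff less_irrefl less_le_trans)
  have flat: "cdiff_fun n (\<lambda>t. t - a) {a..T} (\<lambda>t. integral {a..T} (?\<phi> t))"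
    by (rule cdiff_from_plain[OF cdiff_shift cdiff_fun_integral[OF cdiff_diff[OF cdiff_cmult[OF cdiff_mult[OF cdiff_const_t[OF cs(4)] G]]
       cdiff_mult[OF cdiff_const_t[OF cs(5)] G]]]]) auto
  have slope: "cdiff n (\<lambda>t. t - a) {a..T} {0..1} (slope a)"
  proof -
    have "cdiff n (\<lambda>t. t - a) {a..T} ({0..1} \<times> {0..1}) (\<lambda>t p. s' (a + (t - a) * (1 - snd p * (fst p)\<^sup>2)))"
    proof (rule cdiff_scale_comp[OF s'\<omega>])
      show "(\<lambda>p. 1 - snd p * (fst p)\<^sup>2) ` ({0..1} \<times> {0..1}) \<subseteq> {0..1::real}"
      proof (rule image_subsetI)
        fix p :: "real \<times> real" assume "p \<in> {0..1} \<times> {0..1}"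
        then have "0 \<le> snd p * (fst p)\<^sup>2" "snd p * (fst p)\<^sup>2 \<le> 1"
          using mult_le_one[of "snd p" "(fst p)\<^sup>2"] by (auto simp: power_le_one)
        then show "1 - snd p * (fst p)\<^sup>2 \<in> {0..1}" by simp
      qed
    qed (intro continuous_intros)
    from cdiff_integral[OF this convex_real_interval(5) continuous_on_diff[OF continuous_on_id continuous_on_const]]
    show ?thesis by (simp only: slope_def[abs_def] fst_conv snd_conv)
  qed
  have lag: "cdiff n (\<lambda>t. t - a) {a..T} {0..1} (\<lambda>t y. s' (a + (t - a) * (1 - y\<^sup>2)))"
    by (rule cdiff_scale_comp[OF s'\<omega> _ lag_range]) (intro continuous_intros)
  have y2: "cdiff n (\<lambda>t. t - a) {a..T} {0..1} (\<lambda>t y::real. y\<^sup>2)"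
    by (rule cdiff_const_t) (intro continuous_intros)
  have "cdiff n (\<lambda>t. t - a) {a..T} {0..1} (\<lambda>t y. 1 / ?L * ((2 * s' (a + (t - a) * (1 - y\<^sup>2)) - slope a t y) *
       exp (- (1/4 * ((t - a) * y\<^sup>2 * (slope a t y)\<^sup>2)))))"
    by (rule cdiff_cmult[OF cdiff_mult[OF cdiff_diff[OF cdiff_cmult[OF lag] slope]
        cdiff_exp[OF cdiff_minus[OF cdiff_cmult[OF cdiff_mult[OF cdiff_mult[OF cdiff_fun_param[OF cdiff_shift] y2] cdiff_power[OF slope]]]]]]])
  then have K: "cdiff n (\<lambda>t. t - a) {a..T} {0..1} (\<lambda>t y. 1 / ?L * trace_kernel a t y)"
    by (rule cdiff_cong) (simp add: trace_kernel_def)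
  have F: "cdiff_fun n (\<lambda>t. t - a) {a..T} (\<lambda>t. 1 / ?L * (L.layer 0 t + integral {a..T} (?\<phi> t)))"
    by (rule cdiff_cmult[OF cdiff_add[OF L.cdiff_layer[OF s'\<omega>] flat]])
  have eq: "trace t = volterra a (\<lambda>t y. 1 / ?L * trace_kernel a t y) trace t + 1 / ?L * (L.layer 0 t + integral {a..T} (?\<phi> t))"
    if t: "t \<in> {a..T}" for t
  proof -
    have v: "volterra a (\<lambda>t y. 1 / ?L * trace_kernel a t y) trace t = 1 / ?L * volterra a (trace_kernel a) trace t"
      by (simp add: volterra_def)
    show ?thesis
    proof (cases "t = a")
      case True
      have "integral {a..T} (?\<phi> a) = 0"
        by (intro integral_unique has_integral_is_0) (simp add: gauss_def)
      then show ?thesis using L True by (simp add: L.layer_def volterra_def trace_def)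
    next
      case False
      then have "trace t * ?L = L.layer 0 t + volterra a (trace_kernel a) trace t + integral {a..T} (?\<phi> t)"
        using trace_formula[of a t T] a t by (simp add: L.layer_def)
      then have "trace t = (L.layer 0 t + volterra a (trace_kernel a) trace t + integral {a..T} (?\<phi> t)) / ?L"
        using L by (simp add: eq_divide_eq)
      then show ?thesis unfolding v by (simp add: add_divide_distrib)
    qed
  qed
  have "cdiff_fun n (\<lambda>t. t - a) {a..T} trace"
    by (rule volterra_regularity[OF a(2) K F cs(3) eq])
  then show ?thesis by (rule cdiff_to_plain) auto
qed

end

section \<open>Regularity of the free boundary\<close>

lemma islimpt_of_left_interval: "y < (x::real) \<Longrightarrow> {y..x} \<subseteq> S \<Longrightarrow> at x within S \<noteq> bot"
  using islimpt_subset[of x "{y..x}" S] by (simp add: trivial_limit_within)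

text \<open>
  The factor \<open>exp (lam t)\<close> absorbs the term \<open>- lam u\<close>. The vertical slice through an interior point is a
  neighbourhood in time, by continuity of \<open>s\<close>, so there the time derivative is two-sided.
\<close>

lemma heat_below_curve_of_solution:
  assumes sol: "classical_solution lam \<sigma> b f \<phi> u s"
    and w_def: "w = (\<lambda>x t. exp (lam * t) * u x t)"
    and s'_def: "s' = (\<lambda>t. integral {0..s t} (\<lambda>x. u x t - \<sigma>))"
  shows "\<exists>wx wxx. heat_below_curve w wx wxx s s'"
    and "\<And>t. t > 0 \<Longrightarrow> w 0 t = exp (lam * t) * f t"
    and "\<And>t. t > 0 \<Longrightarrow> s' t = exp (- lam * t) * integral {0..s t} (\<lambda>x. w x t) - \<sigma> * s t"
proof -
  from sol obtain ux ut uxx where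
    C1: "C_on 1 {0..} s" and s_pos: "\<forall>t\<ge>0. s t > 0" and hp: "has_partials s u ux ut uxx"
    and pde: "\<forall>t>0. \<forall>x. 0 < x \<and> x < s t \<longrightarrow> ut x t = uxx x t - lam * u x t"
    and left: "\<forall>t\<ge>0. u 0 t = f t"
    and neum: "\<forall>t>0. ux (s t) t = 0"
    and ds0: "\<forall>t>0. (s has_real_derivative integral {0..s t} (\<lambda>x. u x t - \<sigma>)) (at t)"
    unfolding classical_solution_def by (elim conjE exE) (rule that)
  have ds: "\<forall>t>0. (s has_real_derivative s' t) (at t)" using ds0 by (simp only: s'_def)
  let ?D = "{(x, t). 0 \<le> x \<and> x \<le> s t \<and> 0 < t}"
  have D: "?D \<subseteq> closed_domain s" by (auto simp: closed_domain_def)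
  have cont: "continuous_on (closed_domain s) (\<lambda>(x, t). u x t)" "continuous_on (closed_domain s) (\<lambda>(x, t). ux x t)"
    "continuous_on (closed_domain s) (\<lambda>(x, t). uxx x t)"
    using hp by (auto simp: has_partials_def)
  have part: "((\<lambda>y. u y t) has_real_derivative ux x t) (at x within {0..s t})"
     "((\<lambda>y. ux y t) has_real_derivative uxx x t) (at x within {0..s t})"
     "((\<lambda>r. u x r) has_real_derivative ut x t) (at t within {r. 0 \<le> r \<and> x \<le> s r})"
    if "0 \<le> x" "x \<le> s t" "0 \<le> t" for x t
    using hp that by (auto simp: has_partials_def closed_domain_def)
  have wcont: "continuous_on ?D (\<lambda>(x, t). exp (lam * t) * v x t)"
    if "continuous_on (closed_domain s) (\<lambda>(x, t). v x t)" for v :: "real \<Rightarrow> real \<Rightarrow> real"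
    using continuous_on_subset[OF that D] by (auto simp: case_prod_beta' intro!: continuous_intros)
  have s'_cont: "continuous_on {0<..} s'"
  proof -
    from C1 have "cdiff_fun (Suc 0) (\<lambda>_. 1) {0..} s" by (simp only: C_on_iff_cdiff One_nat_def)
    from cdiff_plain_SucE[OF this] obtain d where d: "\<And>t. t \<in> {0..} \<Longrightarrow> (s has_real_derivative d t) (at t within {0..})"
       "cdiff_fun 0 (\<lambda>_. 1) {0..} d" by blast
    have "d t = s' t" if "t \<in> {0<..}" for t
    proof -
      have "(s has_real_derivative d t) (at t within {0<..})" by (rule DERIV_subset[OF d(1)]) (use that in auto)
      then have "(s has_real_derivative d t) (at t)" using that by (simp add: at_within_open[of t "{0<..}"])
      then show ?thesis using ds that DERIV_unique by blast
    qed
    moreover have "continuous_on {0<..} d" by (rule continuous_on_subset[OF cdiff_fun_cont[OF d(2)]]) auto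
    ultimately show ?thesis by (rule continuous_on_eq[rotated])
  qed
  have "heat_below_curve w (\<lambda>x t. exp (lam * t) * ux x t) (\<lambda>x t. exp (lam * t) * uxx x t) s s'"
  proof
    show "(s has_real_derivative s' t) (at t)" if "t > 0" for t using ds that by blast
    show "continuous_on {0<..} s'" by (rule s'_cont)
    show "s t > 0" if "t > 0" for t using s_pos that by simp
    show "continuous_on ?D (\<lambda>(x, t). w x t)" unfolding w_def by (rule wcont[OF cont(1)])
    show "continuous_on ?D (\<lambda>(x, t). exp (lam * t) * ux x t)" by (rule wcont[OF cont(2)])
    show "continuous_on ?D (\<lambda>(x, t). exp (lam * t) * uxx x t)" by (rule wcont[OF cont(3)])
    show "exp (lam * t) * ux (s t) t = 0" if "t > 0" for t using neum that by simp
    fix x t :: real assume t: "0 < t"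
    {
      assume x: "0 \<le> x" "x \<le> s t"
      show "((\<lambda>y. w y t) has_real_derivative exp (lam * t) * ux x t) (at x within {0..s t})"
        unfolding w_def using part(1)[of x t] x t by (intro DERIV_cmult) auto
      show "((\<lambda>y. exp (lam * t) * ux y t) has_real_derivative exp (lam * t) * uxx x t) (at x within {0..s t})"
        using part(2)[of x t] x t by (intro DERIV_cmult) auto
    }
    assume x: "0 < x" "x < s t"
    have "isCont s t" using ds t DERIV_isCont by blast
    then have "(s \<longlongrightarrow> s t) (nhds t)" by (simp add: isCont_def tendsto_at_iff_tendsto_nhds)
    then have "eventually (\<lambda>r. x < s r) (nhds t)" using x(2) by (rule order_tendstoD(1))
    moreover have "eventually (\<lambda>r. r \<in> {0<..}) (nhds t)" using t by (intro eventually_nhds_in_open) auto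
    ultimately have "eventually (\<lambda>r. r \<in> {r. 0 \<le> r \<and> x \<le> s r}) (nhds t)" by eventually_elim auto
    then obtain V where V: "open V" "t \<in> V" "V \<subseteq> {r. 0 \<le> r \<and> x \<le> s r}" unfolding eventually_nhds by auto
    have "((\<lambda>r. u x r) has_real_derivative ut x t) (at t within V)"
      by (rule DERIV_subset[OF part(3) V(3)]) (use x t in auto)
    then have du: "((\<lambda>r. u x r) has_real_derivative ut x t) (at t)"
      by (simp only: at_within_open[OF V(2,1)])
    have "((\<lambda>r. exp (lam * r) * u x r) has_real_derivative (exp (lam * t) * lam) * u x t + ut x t * exp (lam * t)) (at t)"
      by (intro DERIV_mult du) (auto intro!: derivative_eq_intros)
    also have "(exp (lam * t) * lam) * u x t + ut x t * exp (lam * t) = exp (lam * t) * uxx x t"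
    proof -
      have eq: "ut x t = uxx x t - lam * u x t" using pde t x by blast
      show ?thesis unfolding eq by (simp add: algebra_simps)
    qed
    finally show "((\<lambda>r. w x r) has_real_derivative exp (lam * t) * uxx x t) (at t)" by (simp add: w_def)
  qed
  then show "\<exists>wx wxx. heat_below_curve w wx wxx s s'" by blast
  show "w 0 t = exp (lam * t) * f t" if "t > 0" for t using left that by (simp add: w_def)
  show "s' t = exp (- lam * t) * integral {0..s t} (\<lambda>x. w x t) - \<sigma> * s t" if t: "t > 0" for t
  proof -
    have "continuous_on {0..s t} (\<lambda>x. u x t)"
      by (rule DERIV_continuous_on[where D="\<lambda>x. ux x t"]) (use part(1) t in auto)
    then have "integral {0..s t} (\<lambda>x. u x t - \<sigma>) = integral {0..s t} (\<lambda>x. u x t) - integral {0..s t} (\<lambda>x. \<sigma>)"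
      by (intro integral_diff integrable_continuous_interval continuous_on_const)
    moreover have "integral {0..s t} (\<lambda>x. \<sigma>) = \<sigma> * s t" using spec[OF s_pos, of t] t by simp
    moreover have "integral {0..s t} (\<lambda>x. w x t) = exp (lam * t) * integral {0..s t} (\<lambda>x. u x t)" by (simp add: w_def)
    moreover have "exp (- lam * t) * (exp (lam * t) * I) = I" for I by (simp add: exp_minus)
    ultimately show ?thesis by (simp only: s'_def)
  qed
qed

text \<open>
  The bootstrap. Each step halves the initial time \<open>a\<close>: the trace is controlled on \<open>]a, T]\<close> in terms of \<open>s'\<close> on the
  closed interval \<open>[a, T]\<close>, which the induction hypothesis provides on \<open>]a/2, T]\<close>.
\<close>

lemma free_boundary_regularity:
  assumes sol: "classical_solution lam \<sigma> b f \<phi> u s" and T: "T > 0" and f: "C_on m {0<..T} f"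
  shows "C_on (m + 1) {0<..T} s"
proof -
  define w where "w = (\<lambda>x t. exp (lam * t) * u x t)"
  define s' where "s' = (\<lambda>t. integral {0..s t} (\<lambda>x. u x t - \<sigma>))"
  note sol' = heat_below_curve_of_solution[OF sol w_def s'_def]
  from sol'(1) obtain wx wxx where "heat_below_curve w wx wxx s s'" by blast
  then interpret heat_below_curve w wx wxx s s' .
  have expo: "cdiff_fun n (\<lambda>_. 1) U (\<lambda>t. exp (c * t))" for n U c
    by (intro cdiff_exp cdiff_cmult cdiff_ident)
  have fn: "cdiff_fun m (\<lambda>_. 1) {0<..T} f" using f by (simp only: C_on_iff_cdiff)
  have w0: "cdiff_fun m (\<lambda>_. 1) {a..T} (w 0)" if "a > 0" for a
    by (rule cdiff_cong[OF cdiff_mult[OF expo[of _ _ lam] cdiff_subset[OF fn]]]) (use that sol'(2) in auto)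
  have antider: "cdiff_fun (Suc k) (\<lambda>_. 1) {a<..T} s" if "cdiff_fun k (\<lambda>_. 1) {a<..T} s'" "a > 0" for k a
    using that by (intro cdiff_fun_antiderivative[OF _ that(1)] has_field_derivative_at_within[OF s_deriv]) auto
  have main: "cdiff_fun k (\<lambda>_. 1) {a<..T} s'" if "k \<le> m" "0 < a" "a < T" for k a
    using that
  proof (induction k arbitrary: a)
    case 0
    then have "continuous_on {a<..T} s'" by (intro continuous_on_subset[OF s'_cont]) auto
    then show ?case by (simp add: continuous_on_fun_iff)
  next
    case (Suc k)
    have "cdiff_fun k (\<lambda>_. 1) {a / 2<..T} s'" using Suc by auto
    then have s'k: "cdiff_fun k (\<lambda>_. 1) {a..T} s'" by (rule cdiff_subset) (use Suc.prems in auto)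
    have s'k': "cdiff_fun k (\<lambda>_. 1) {a<..T} s'" by (rule cdiff_subset[OF s'k]) auto
    have tr: "cdiff_fun k (\<lambda>_. 1) {a<..T} trace" by (rule trace_regular[OF Suc.prems(2,3) s'k])
    have "cdiff_fun (Suc k) (\<lambda>_. 1) {a..T} (w 0)" by (rule cdiff_mono[OF w0]) (use Suc.prems in auto)
    from mass_regular[OF Suc.prems(2) this tr s'k'] have ms: "cdiff_fun (Suc k) (\<lambda>_. 1) {a<..T} mass" .
    show ?case
      by (rule cdiff_cong[OF cdiff_diff[OF cdiff_mult[OF expo[of _ _ "- lam"] ms] cdiff_cmult[OF antider[OF s'k' Suc.prems(2)], of \<sigma>]]])
        (use sol'(3) Suc.prems in \<open>auto simp: mass_def\<close>)
  qed
  have "cdiff_fun (Suc m) (\<lambda>_. 1) {0<..T} s"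
  proof (rule cdiff_fun_local)
    fix x assume x: "x \<in> {0<..T}"
    have "cdiff_fun (Suc m) (\<lambda>_. 1) {x / 2<..T} s" by (rule antider[OF main]) (use x in auto)
    moreover have "{0<..T} \<inter> {x / 2<..} = {x / 2<..T}" using x by auto
    ultimately show "\<exists>V. open V \<and> x \<in> V \<and> cdiff_fun (Suc m) (\<lambda>_. 1) ({0<..T} \<inter> V) s"
      using x by (intro exI[of _ "{x / 2<..}"]) (simp del: cdiff.simps)
    show "at x within {0<..T} \<noteq> bot" using x by (intro islimpt_of_left_interval[of "x / 2"]) auto
  qed
  then show ?thesis by (simp only: C_on_iff_cdiff Suc_eq_plus1)
qed

theorem theorem2p1:
  fixes lam \<sigma> b :: real
    and f \<phi> s :: "real \<Rightarrow> real"
    and u :: "real \<Rightarrow> real \<Rightarrow> real"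
  assumes "lam > 0" and "\<sigma> > 0" and "b > 0"
    and "\<phi> 0 = f 0"
    and "classical_solution lam \<sigma> b f \<phi> u s"
  shows "(\<forall>(m::nat) T. m \<ge> 2 \<and> T > 0 \<and> C_on m {0<..T} f \<longrightarrow> C_on (m + 1) {0<..T} s)
       \<and> (C_inf_on {0<..} f \<longrightarrow> C_inf_on {0<..} s)"
proof (intro conjI allI impI)
  fix m :: nat and T :: real
  assume "m \<ge> 2 \<and> T > 0 \<and> C_on m {0<..T} f"
  then show "C_on (m + 1) {0<..T} s" using free_boundary_regularity[OF assms(5)] by blast
next
  assume f: "C_inf_on {0<..} f"
  show "C_inf_on {0<..} s"
    unfolding C_inf_on_def C_on_iff_cdiff
  proof
    fix n
    show "cdiff_fun n (\<lambda>_. 1) {0<..} s"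
    proof (rule cdiff_fun_local)
      fix x :: real assume x: "x \<in> {0<..}"
      have "cdiff_fun n (\<lambda>_. 1) {0<..} f" using f by (simp only: C_inf_on_def C_on_iff_cdiff)
      then have "cdiff_fun n (\<lambda>_. 1) {0<..2 * x} f" by (rule cdiff_subset) auto
      then have "C_on (n + 1) {0<..2 * x} s"
        using x by (intro free_boundary_regularity[OF assms(5)]) (simp_all only: C_on_iff_cdiff, simp)
      then have prev: "cdiff_fun (Suc n) (\<lambda>_. 1) {0<..2 * x} s" by (simp only: C_on_iff_cdiff Suc_eq_plus1)
      have "cdiff_fun n (\<lambda>_. 1) ({0<..} \<inter> {..<2 * x}) s"
        by (rule cdiff_subset[OF cdiff_Suc_imp[OF prev]]) auto
      then show "\<exists>V. open V \<and> x \<in> V \<and> cdiff_fun n (\<lambda>_. 1) ({0<..} \<inter> V) s"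
        using x by (intro exI[of _ "{..<2 * x}"]) (simp del: cdiff.simps)
      show "at x within {0<..} \<noteq> bot" using x by (intro islimpt_of_left_interval[of "x / 2"]) auto
    qed
  qed
qed

end
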